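(* Let $\mathcal V^\alpha$ denote the vacant set of two-dimensional random interlacements at level $\alpha>0$. (i) For any $\alpha>0$, $x\in\mathbb Z^2$ and finite $A\subset\mathbb Z^2$, $\mathbb P[A\subset\mathcal V^\alpha\mid x\in\mathcal V^\alpha]=\mathbb P[-A+x\subset\mathcal V^\alpha\mid x\in\mathcal V^\alpha]$. More generally, for $x\ne0$ and any isometry $M$ of the lattice $\mathbb Z^2$ exchanging $0$ and $x$, $\mathbb P[A\subset\mathcal V^\alpha\mid x\in\mathcal V^\alpha]=\mathbb P[MA\subset\mathcal V^\alpha\mid x\in\mathcal V^\alpha]$. (ii) $\mathbb P[x\in\mathcal V^\alpha]=\exp(-\pi\alpha a(x)/2)=e^{-\gamma'\pi\alpha/2}\|x\|^{-\alpha}(1+O(\|x\|^{-2}))$ as $\|x\|\to\infty$. (iii) For $A$ with $0\in A\subset B(r)$ and $x\in\mathbb Z^2$ with $\|x\|\ge 2r$, $$\mathbb P[A\subset\mathcal V^\alpha\mid x\in\mathcal V^\alpha]=\exp\Big(-\frac{\pi\alpha}{4}\mathrm{cap}(A)\frac{1+O\big(\frac{r\ln r\ln\|x\|}{\|x\|}\big)}{1-\frac{\mathrm{cap}(A)}{2a(x)}+O\big(\frac{r\ln r}{\|x\|}\big)}\Big).$$ (iv) For $x,y\ne0$, $x\ne y$, $\mathbb P[\{x,y\}\subset\mathcal V^\alpha]=\exp(-\pi\alpha\Psi)$ with $$\Psi=\frac{a(x)a(y)a(x-y)}{a(x)a(y)+a(x)a(x-y)+a(y)a(x-y)-\frac12(a^2(x)+a^2(y)+a^2(x-y))}.$$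 Moreover, if $s:=\|x\|\to\infty$ with $\ln\|y\|\sim\ln s$ and $\ln\|x-y\|\sim\beta\ln s$ for some $\beta\in[0,1]$, then $\mathbb P[\{x,y\}\subset\mathcal V^\alpha]=s^{-\frac{4\alpha}{4-\beta}+o(1)}$ and $\mathrm{Cor}(\mathbf 1\{x\in\mathcal V^\alpha\},\mathbf 1\{y\in\mathcal V^\alpha\})=s^{-\frac{\alpha\beta}{4-\beta}+o(1)}$. (v) If $\ln\|x\|\sim\ln s$ and $\ln r\sim\beta\ln s$ with $\beta<1$, then as $s\to\infty$, $\mathbb P[B(x,r)\subset\mathcal V^\alpha]=s^{-\frac{2\alpha}{2-\beta}+o(1)}$.
   Context: Let $(S_k)_{k\ge 0}$ be simple random walk on $\mathbb Z^2$ and $P_x$ its law when $S_0=x$. Write $\|\cdot\|$ for the Euclidean norm, $y\sim x$ for nearest neighbours, $B(x,r)=\{y\in\mathbb Z^2:\|y-x\|\le r\}$ for $x\in\mathbb Z^2$, real $r>0$, and $B(r)=B(0,r)$. Let $\tau_1(A)=\inf\{k\ge1:S_k\in A\}$. The potential kernel is $a(x)=\sum_{k\ge0}(P_0[S_k=0]-P_x[S_k=0])$; it satisfies $a(0)=0$, $a(x)>0$ for $x\ne0$, $\frac14\sum_{y\sim x}a(y)=a(x)$ for $x\neq 0$, and $a(x)=\frac2\pi\ln\|x\|+\gamma'+O(\|x\|^{-2})$ for a constant $\gamma'$. For finite nonempty $A\subset\mathbb Z^2$, the harmonic measure is $\mathrm{hm}_A(x)=\lim_{\|y\|\to\infty}P_y[S_{\tau_1(A)}=x]$.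 For finite $A\ni 0$, $\mathrm{cap}(A)=\sum_{x\in A}a(x)\mathrm{hm}_A(x)$; for finite nonempty $A\not\ni0$, $\mathrm{cap}(A)=\mathrm{cap}(A-z)$ for any $z\in A$. The conditioned walk $\widehat S$ is the Markov chain on $\mathbb Z^2\setminus\{0\}$ with transition probabilities $a(y)/(4a(x))$ for $y\sim x$; it is transient; $\widehat P_x$ is its law from $x$, $\widehat\tau_1(A)=\inf\{k\ge1:\widehat S_k\in A\}$. Let $\widehat e_A(x)=\mathbf 1\{x\in A\}\widehat P_x[\widehat\tau_1(A)=\infty]a(x)^2$ and $\widehat{\mathrm{cap}}(A)=\sum_x\widehat e_A(x)$. Two-dimensional random interlacements: let $W$ be the set of doubly infinite nearest-neighbour paths in $\mathbb Z^2$ visiting each site finitely often, $W^*$ the quotient by time shifts, $\chi^*$ the projection. There is a unique $\sigma$-finite measure $\nu$ on $W^*$ such that for each finite $A$, $\nu$ restricted to trajectories hitting $A$ is the image under $\chi^*$ of the measure $Q_A$ given by $Q_A[(\varrho_k)_{k\ge1}\in F,\varrho_0=x,(\varrho_{-k})_{k\ge1}\in G]=\widehat e_A(x)\widehat P_x[F]\widehat P_x[G\mid\widehat\tau_1(A)=\infty]$. Take a Poisson point process $\sum_\lambda\delta_{(w_\lambda^*,u_\lambda)}$ on $W^*\times\mathbb R_+$ with intensity $\nu\otimes du$; random interlacements at level $\alpha$ consist of the trajectories with $u_\lambda\le\pi\alpha$, and the vacant set $\mathcal V^\alpha$ is the set of sites of $\mathbb Z^2$ visited by none of them. Equivalently,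 on a finite set $A$, one sees a Poisson($\pi\alpha\widehat{\mathrm{cap}}(A)$) number of independent $\widehat S$-walks started from the normalized $\widehat e_A$. In particular $0\in\mathcal V^\alpha$ a.s. and $\mathbb P[A\subset\mathcal V^\alpha]=\exp(-\pi\alpha\,\mathrm{cap}(A))$ for every finite $A\ni0$. For events $E,F$, $\mathrm{Cor}(E,F)=\mathrm{Cov}(\mathbf 1_E,\mathbf 1_F)/\sqrt{\mathrm{Var}(\mathbf 1_E)\mathrm{Var}(\mathbf 1_F)}$. $O(g)$ denotes a quantity bounded in absolute value by a constant times $g$.
   Formalization: In (iii) r≥2 is assumed: at r=1 the error terms vanish and the formula fails, e.g. A={0,(1,0)}, x=(2,0). In (v) r≥1 is assumed (so β≥0): for r→0 with β<0 the ball is a single point and the exponent is wrong. *)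

theory Defs
  imports "HOL-Probability.Probability" "HOL-Library.Product_Plus" "HOL-Library.Landau_Symbols"
begin

type_synonym pt = "int \<times> int"

definition znorm :: "pt \<Rightarrow> real" where
  "znorm p = sqrt (real_of_int (fst p) ^ 2 + real_of_int (snd p) ^ 2)"

definition nbrs :: "pt \<Rightarrow> pt set" where
  "nbrs p = {(fst p + 1, snd p), (fst p - 1, snd p), (fst p, snd p + 1), (fst p, snd p - 1)}"

definition zball :: "pt \<Rightarrow> real \<Rightarrow> pt set" where
  "zball x r = {y. znorm (y - x) \<le> r}"

fun srw_prob :: "nat \<Rightarrow> pt \<Rightarrow> pt \<Rightarrow> real" where
  "srw_prob 0 x y = (if x = y then 1 else 0)"
| "srw_prob (Suc k) x y = (\<Sum>z\<in>nbrs x. srw_prob k z y) / 4"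

text \<open>first_hit A k y x = P_y[tau_1(A) = k, S_k = x]\<close>
fun first_hit :: "pt set \<Rightarrow> nat \<Rightarrow> pt \<Rightarrow> pt \<Rightarrow> real" where
  "first_hit A 0 y x = 0"
| "first_hit A (Suc k) y x =
     (\<Sum>z\<in>nbrs y. (if z \<in> A then (if k = 0 \<and> z = x then 1 else 0) else first_hit A k z x)) / 4"

definition hit_dist :: "pt set \<Rightarrow> pt \<Rightarrow> pt \<Rightarrow> real" where
  "hit_dist A y x = (\<Sum>k. first_hit A k y x)"

text \<open>harmonic measure: limit as norm y tends to infinity (= cofinite filter on Z^2)\<close>
definition hm :: "pt set \<Rightarrow> pt \<Rightarrow> real" where
  "hm A x = Lim cofinite (\<lambda>y. hit_dist A y x)"

definition pot :: "pt \<Rightarrow> real" where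
  "pot x = (\<Sum>k. srw_prob k 0 0 - srw_prob k x 0)"

text \<open>the constant gamma' in a(x) = (2/pi) ln|x| + gamma' + O(|x|^-2)\<close>
definition gamma' :: real where
  "gamma' = Lim cofinite (\<lambda>x. pot x - 2 / pi * ln (znorm x))"

definition cap0 :: "pt set \<Rightarrow> real" where
  "cap0 A = (\<Sum>x\<in>A. pot x * hm A x)"

definition cap :: "pt set \<Rightarrow> real" where
  "cap A = (if (0::pt) \<in> A then cap0 A else cap0 ((\<lambda>w. w - (SOME z. z \<in> A)) ` A))"

text \<open>Law of the vacant set V of 2D random interlacements at level alpha, given through
  its (law-determining) finite-set avoidance probabilities.\<close>
definition vacant_law :: "'w measure \<Rightarrow> real \<Rightarrow> ('w \<Rightarrow> pt set) \<Rightarrow> bool" where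
  "vacant_law M \<alpha> V \<longleftrightarrow> prob_space M \<and>
     (\<forall>A. finite A \<longrightarrow> {\<omega>\<in>space M. A \<subseteq> V \<omega>} \<in> sets M \<and>
        ((0::pt) \<in> A \<longrightarrow> measure M {\<omega>\<in>space M. A \<subseteq> V \<omega>} = exp (- pi * \<alpha> * cap A)))"

definition pv :: "'w measure \<Rightarrow> ('w \<Rightarrow> pt set) \<Rightarrow> pt set \<Rightarrow> real" where
  "pv M V A = measure M {\<omega>\<in>space M. A \<subseteq> V \<omega>}"

definition cpv :: "'w measure \<Rightarrow> ('w \<Rightarrow> pt set) \<Rightarrow> pt set \<Rightarrow> pt \<Rightarrow> real" where
  "cpv M V A x = pv M V (A \<union> {x}) / pv M V {x}"

text \<open>Cor(1{x in V}, 1{y in V}), Cov and Var of indicators written out\<close>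
definition vcor :: "'w measure \<Rightarrow> ('w \<Rightarrow> pt set) \<Rightarrow> pt \<Rightarrow> pt \<Rightarrow> real" where
  "vcor M V x y = (pv M V {x, y} - pv M V {x} * pv M V {y}) /
      sqrt (pv M V {x} * (1 - pv M V {x}) * (pv M V {y} * (1 - pv M V {y})))"

definition lattice_isometry :: "(pt \<Rightarrow> pt) \<Rightarrow> bool" where
  "lattice_isometry f \<longleftrightarrow> (\<forall>u v. znorm (f u - f v) = znorm (u - v))"

definition Psi :: "pt \<Rightarrow> pt \<Rightarrow> real" where
  "Psi x y = pot x * pot y * pot (x - y) /
     (pot x * pot y + pot x * pot (x - y) + pot y * pot (x - y)
      - (pot x ^ 2 + pot y ^ 2 + pot (x - y) ^ 2) / 2)"

end

theory Submission
  imports Defs "HOL-Real_Asymp.Real_Asymp"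
begin

text \<open>
  Rotating the lattice by 45 degrees makes the two coordinates of the walk independent. On the
  diagonal the series for the potential kernel \<open>a\<close> then telescopes, with
  \<open>a (n, n) - a (n - 1, n - 1) = 4 / (\<pi> (2 n - 1))\<close>, and harmonicity propagates the convergence to
  all points. The function \<open>ln \<bar>z\<bar> - Re (cnj z / z^3) / 12\<close> has discrete Laplacian
  \<open>O(\<bar>z\<bar>^-6)\<close> and matches the diagonal values up to \<open>O(n^-4)\<close>; a superharmonic barrier in the
  cone between the diagonals turns this into the asymptotics of \<open>a\<close> with error \<open>O(\<bar>z\<bar>^-2)\<close>.

  A bounded function that is harmonic off a finite set \<open>A\<close> is, by Liouville's theorem, a constant
  plus a combination of shifted kernels, so it has a limit at infinity. Hence harmonic measure
  exists, and \<open>\<Sum>z\<in>A. a (z - w) hm_A z\<close> does not depend on \<open>w \<in> A\<close>. This equilibrium identity yields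
  the invariance of the capacity under isometries, the capacities of two- and three-point sets by
  linear algebra, and a two-by-two linear system for the capacity of a set with a distant point
  added. All the probabilities are then explicit.
\<close>

section \<open>One-dimensional walk and the product formula\<close>

text \<open>The exponent 2 in the error is the critical decay rate of the cone between the
  diagonals: Re (z^-2) is harmonic, positive inside and zero on the sides. The bare logarithm leaves
  a source of order |z|^-4, which would resonate with this function and cost a logarithm; this is
  why its z^-4 term is cancelled before any comparison. The cone is bounded by the diagonals because
  the kernel is explicit there, and reflections carry the cone to the whole plane. At infinity only
  sublinear growth is known in advance, so a small multiple of Re z, harmonic and positive in the
  cone, is added to the barrier and removed at the end. The rate |z|^-2 gives (ii) at once. Since
  nonzero lattice points have norm at least 1, it also bounds \<open>pot (x - z) - pot x\<close> by
  a multiple of |z| / |x|, and this is the only source of error in (iii) and in the ball estimate of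
  (v). Capacities are treated as Robin constants, which have no distinguished origin; the origin
  enters only because it is almost surely vacant.\<close>

fun walk1 :: "nat \<Rightarrow> int \<Rightarrow> real" where
  "walk1 0 u = (if u = 0 then 1 else 0)"
| "walk1 (Suc k) u = (walk1 k (u - 1) + walk1 k (u + 1)) / 2"

lemma sum_nbrs:
  "(\<Sum>y\<in>nbrs x. f y) = f (fst x + 1, snd x) + f (fst x - 1, snd x) + f (fst x, snd x + 1) + f (fst x, snd x - 1)"
  for f :: "pt \<Rightarrow> real"
  by (simp add: nbrs_def)

lemma srw_prob_eq_walk1:
  "srw_prob k x 0 = walk1 k (fst x + snd x) * walk1 k (fst x - snd x)"
proof (induction k arbitrary: x)
  case 0
  show ?case by (cases x) (auto simp: zero_prod_def)
next
  case (Suc k)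
  have *: "srw_prob (Suc k) x 0 = (\<Sum>z\<in>nbrs x. walk1 k (fst z + snd z) * walk1 k (fst z - snd z)) / 4"
    by (simp add: Suc.IH)
  show ?case unfolding * sum_nbrs by (simp add: algebra_simps)
qed

lemma walk1_nonneg: "walk1 k u \<ge> 0"
  by (induction k arbitrary: u) auto

lemma walk1_uminus: "walk1 k (- u) = walk1 k u"
proof (induction k arbitrary: u)
  case (Suc k)
  have "walk1 k (- u - 1) = walk1 k (u + 1)" "walk1 k (- u + 1) = walk1 k (u - 1)"
    using Suc.IH[of "u + 1"] Suc.IH[of "u - 1"] by (metis minus_add_distrib uminus_add_conv_diff diff_minus_eq_add minus_diff_eq add.commute)+
  then show ?case by simp
qed simp

lemma walk1_parity: "odd (int k + u) \<Longrightarrow> walk1 k u = 0"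
  by (induction k arbitrary: u) auto

text \<open>For matching parity \<open>walk1 k u\<close> is the binomial coefficient of
  \<open>k\<close> over (k + u) / 2 divided by 2^k, and this is the ratio of two consecutive ones.
  Cleared of denominators, it also holds where both sides vanish by parity or range.\<close>

lemma walk1_space_step:
  "(of_nat k + of_int u + 2) * walk1 k (u + 2) = (of_nat k - of_int u) * walk1 k u"
proof (induction k arbitrary: u)
  case 0
  show ?case by auto
next
  case (Suc k)
  have 1: "(of_nat k + of_int u + 3) * walk1 k (u + 3) = (of_nat k - of_int u - 1) * walk1 k (u + 1)"
    using Suc.IH[of "u + 1"] by (simp add: algebra_simps)
  have 2: "(of_nat k + of_int u + 1) * walk1 k (u + 1) = (of_nat k - of_int u + 1) * walk1 k (u - 1)"
    using Suc.IH[of "u - 1"] by (simp add: algebra_simps)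
  have "walk1 (Suc k) (u + 2) = (walk1 k (u + 1) + walk1 k (u + 3)) / 2"
    by (simp add: algebra_simps)
  then show ?case unfolding walk1.simps(2)[of k u] of_nat_Suc using 1 2 by algebra
qed

declare walk1.simps(2) [simp del]

lemma walk1_time_step:
  "(of_nat k + 1 + of_int u) * walk1 (Suc k) u = (of_nat k + 1) * walk1 k (u - 1)"
  "(of_nat k + 1 - of_int u) * walk1 (Suc k) u = (of_nat k + 1) * walk1 k (u + 1)"
  using walk1_space_step[of k "u - 1"] by (simp_all add: walk1.simps(2) algebra_simps)

lemma walk1_two_steps:
  "(of_nat k + 2 + of_int u) * (of_nat k + 2 - of_int u) * walk1 (Suc (Suc k)) u
     = (of_nat k + 1) * (of_nat k + 2) * walk1 k u"
proof -
  have "(of_nat k + 2 + of_int u) * walk1 (Suc (Suc k)) u = (of_nat k + 2) * walk1 (Suc k) (u - 1)"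
    using walk1_time_step(1)[of "Suc k" u] by (simp add: algebra_simps)
  moreover have "(of_nat k + 2 - of_int u) * walk1 (Suc k) (u - 1) = (of_nat k + 1) * walk1 k u"
    using walk1_time_step(2)[of k "u - 1"] by (simp add: algebra_simps)
  ultimately have "(of_nat k + 2 - of_int u) * ((of_nat k + 2 + of_int u) * walk1 (Suc (Suc k)) u)
      = (of_nat k + 2) * ((of_nat k + 1) * walk1 k u)"
    by (simp only: mult.left_commute)
  then show ?thesis by (simp only: mult.assoc mult.left_commute)
qed

lemma walk1_antimono_aux: "walk1 k (int i + 2) \<le> walk1 k (int i)"
proof (cases "i \<le> k")
  case True
  have "(of_nat k + of_nat i + 2) * walk1 k (int i + 2) = (of_nat k - of_nat i) * walk1 k (int i)"
    using walk1_space_step[of k "int i"] by simp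
  also have "\<dots> \<le> (of_nat k + of_nat i + 2) * walk1 k (int i)"
    by (intro mult_right_mono walk1_nonneg) simp
  finally show ?thesis by (simp add: mult_le_cancel_left)
next
  case False
  have "(of_nat k + of_nat i + 2) * walk1 k (int i + 2) = (of_nat k - of_nat i) * walk1 k (int i)"
    using walk1_space_step[of k "int i"] by simp
  also have "\<dots> \<le> 0" using False walk1_nonneg[of k "int i"] by (intro mult_nonpos_nonneg) auto
  finally have "walk1 k (int i + 2) \<le> 0"
    by (simp add: mult_le_0_iff)
  then show ?thesis using walk1_nonneg[of k "int i"] by linarith
qed

lemma walk1_antimono: "walk1 k (int i + 2 * int j) \<le> walk1 k (int i)"
proof (induction j)
  case (Suc j)
  have "walk1 k (int (i + 2 * j) + 2) \<le> walk1 k (int (i + 2 * j))" by (rule walk1_antimono_aux)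
  then show ?case using Suc by (simp add: algebra_simps)
qed simp

lemma walk1_even_antimono:
  assumes "even u" "even w" "\<bar>u\<bar> \<le> \<bar>w\<bar>"
  shows "walk1 k w \<le> walk1 k u"
proof -
  have abs: "walk1 k \<bar>v\<bar> = walk1 k v" for v
    by (cases "v \<ge> 0") (auto simp: walk1_uminus)
  obtain j where "\<bar>w\<bar> - \<bar>u\<bar> = 2 * j" using assms by (metis dvd_def abs_dvd_iff dvd_diff dvd_abs_iff)
  then have "\<bar>w\<bar> = int (nat \<bar>u\<bar>) + 2 * int (nat j)" using assms by simp
  then have "walk1 k \<bar>w\<bar> \<le> walk1 k \<bar>u\<bar>" by (metis walk1_antimono abs_ge_zero int_nat_eq)
  then show ?thesis by (simp add: abs)
qed

abbreviation ret1 :: "nat \<Rightarrow> real" where "ret1 m \<equiv> walk1 (2 * m) 0"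

lemma walk1_even_le_ret1: "walk1 (2 * m) u \<le> ret1 m"
proof (cases "even u")
  case True
  then show ?thesis by (intro walk1_even_antimono) auto
next
  case False
  then show ?thesis using walk1_parity[of "2 * m" u] walk1_nonneg by simp
qed

lemma walk1_le_ret1: "walk1 k u \<le> ret1 (k div 2)"
proof (cases "even k")
  case True
  then show ?thesis using walk1_even_le_ret1[of "k div 2" u] by simp
next
  case False
  then obtain m where k: "k = Suc (2 * m)" by (metis oddE Suc_eq_plus1)
  have "walk1 k u = (walk1 (2 * m) (u - 1) + walk1 (2 * m) (u + 1)) / 2" by (simp add: k walk1.simps(2))
  also have "\<dots> \<le> (ret1 m + ret1 m) / 2"
    by (intro divide_right_mono add_mono walk1_even_le_ret1) simp
  also have "\<dots> = ret1 m" by simp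
  finally show ?thesis using k by simp
qed

lemma ret1_Suc: "2 * (real m + 1) * ret1 (Suc m) = (2 * real m + 1) * ret1 m"
proof -
  have "(2 * real m + 2) * ((2 * real m + 2) * ret1 (Suc m)) = (2 * real m + 2) * ((2 * real m + 1) * ret1 m)"
    using walk1_two_steps[of "2 * m" 0] by (simp add: algebra_simps)
  then show ?thesis by (subst (asm) mult_cancel_left) (simp add: algebra_simps)
qed

lemma ret1_pos: "ret1 m > 0"
proof (induction m)
  case (Suc m)
  have "2 * (real m + 1) * ret1 (Suc m) > 0" unfolding ret1_Suc using Suc by simp
  then show ?case by (simp add: zero_less_mult_iff)
qed simp

text \<open>The recursion \<open>ret1_Suc\<close> makes the Wallis products reciprocals of squared
  return probabilities, so the Wallis formula takes the place of Stirling's in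
  \<open>ret1_asymp\<close>.\<close>

lemma wallis_ret1: "(\<Prod>k=1..n. (4*real k^2) / (4*real k^2 - 1)) = 1 / ((2 * real n + 1) * ret1 n ^ 2)"
proof (induction n)
  case (Suc n)
  define x a b where "x = real n" and "a = ret1 n" and "b = ret1 (Suc n)"
  have pos: "x + 1 > 0" "2 * x + 1 > 0" "2 * x + 3 > 0" "a > 0" by (auto simp: x_def a_def ret1_pos)
  have r: "b = (2 * x + 1) * a / (2 * (x + 1))"
    using ret1_Suc[of n] pos by (simp add: field_simps a_def b_def x_def)
  have f: "4 * (x + 1)^2 - 1 = (2 * x + 1) * (2 * x + 3)" by (simp add: power2_eq_square algebra_simps)
  have "(\<Prod>k=1..Suc n. (4*real k^2) / (4*real k^2 - 1)) = 4 * (x + 1)^2 / (4 * (x + 1)^2 - 1) * (1 / ((2 * x + 1) * a ^ 2))"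
    unfolding a_def x_def Suc[symmetric] by (simp add: add.commute)
  also have "\<dots> = 1 / ((2 * x + 3) * b ^ 2)"
    unfolding r f using pos by (simp add: divide_simps power2_eq_square) (simp add: algebra_simps)
  also have "2 * x + 3 = 2 * real (Suc n) + 1" by (simp add: x_def)
  finally show ?case unfolding b_def .
qed simp

lemma ret1_asymp: "(\<lambda>m. real m * ret1 m ^ 2) \<longlonglongrightarrow> 1 / pi"
proof -
  have "(\<lambda>n. 1 / ((2 * real n + 1) * ret1 n ^ 2)) \<longlonglongrightarrow> pi / 2"
    using wallis unfolding wallis_ret1 .
  then have "(\<lambda>n. inverse (1 / ((2 * real n + 1) * ret1 n ^ 2))) \<longlonglongrightarrow> inverse (pi / 2)"
    by (intro tendsto_inverse) auto
  then have 1: "(\<lambda>n. (2 * real n + 1) * ret1 n ^ 2) \<longlonglongrightarrow> 2 / pi" by (simp)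
  have 2: "(\<lambda>n. real n / (2 * real n + 1)) \<longlonglongrightarrow> 1 / 2" by real_asymp
  have "(\<lambda>n. (real n / (2 * real n + 1)) * ((2 * real n + 1) * ret1 n ^ 2)) \<longlonglongrightarrow> 1 / 2 * (2 / pi)"
    by (intro tendsto_mult 1 2)
  moreover have "(real n / (2 * real n + 1)) * ((2 * real n + 1) * ret1 n ^ 2) = real n * ret1 n ^ 2" for n
    by (simp add: divide_simps)
  ultimately show ?thesis by simp
qed

lemma ret1_tendsto_0: "ret1 \<longlonglongrightarrow> 0"
proof -
  have "(\<lambda>m. (real m * ret1 m ^ 2) * (1 / real m)) \<longlonglongrightarrow> 1 / pi * 0"
    by (intro tendsto_mult ret1_asymp) real_asymp
  moreover have "eventually (\<lambda>m. (real m * ret1 m ^ 2) * (1 / real m) = ret1 m ^ 2) sequentially"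
    using eventually_gt_at_top[of 0] by eventually_elim (simp)
  ultimately have "(\<lambda>m. ret1 m ^ 2) \<longlonglongrightarrow> 1 / pi * 0" by (rule Lim_transform_eventually)
  then have "(\<lambda>m. ret1 m ^ 2) \<longlonglongrightarrow> 0" by simp
  then have "(\<lambda>m. sqrt (ret1 m ^ 2)) \<longlonglongrightarrow> sqrt 0" by (rule tendsto_real_sqrt)
  then show ?thesis by (simp add: walk1_nonneg)
qed

lemma srw_prob_nonneg: "srw_prob k x 0 \<ge> 0"
  by (simp add: srw_prob_eq_walk1 walk1_nonneg)

lemma srw_prob_tendsto_0: "(\<lambda>k. srw_prob k x 0) \<longlonglongrightarrow> 0"
proof (rule tendsto_sandwich[of "\<lambda>_. 0" _ _ "\<lambda>k. ret1 (k div 2) * ret1 (k div 2)"])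
  show "\<forall>\<^sub>F k in sequentially. srw_prob k x 0 \<le> ret1 (k div 2) * ret1 (k div 2)"
    unfolding srw_prob_eq_walk1 by (intro always_eventually allI mult_mono walk1_le_ret1 walk1_nonneg)
  have "filterlim (\<lambda>k::nat. k div 2) at_top sequentially"
    unfolding filterlim_at_top
  proof
    fix Z :: nat
    show "\<forall>\<^sub>F x in sequentially. Z \<le> x div 2"
      using eventually_ge_at_top[of "2 * Z"] by eventually_elim simp
  qed
  then have "(\<lambda>k. ret1 (k div 2)) \<longlonglongrightarrow> 0" by (rule filterlim_compose[OF ret1_tendsto_0])
  from tendsto_mult[OF this this] show "(\<lambda>k. ret1 (k div 2) * ret1 (k div 2)) \<longlonglongrightarrow> 0" by simp
qed (auto simp: srw_prob_nonneg)

section \<open>The potential kernel on the diagonal\<close>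

text \<open>Moving the displacement by two multiplies the term by a ratio that tends to 1, so every
  fixed even displacement inherits the limit of the return probability.\<close>

lemma ret1_mult_walk1_asymp: "(\<lambda>m. real m * ret1 m * walk1 (2 * m) (2 * int n)) \<longlonglongrightarrow> 1 / pi"
proof (induction n)
  case 0
  then show ?case using ret1_asymp by (simp add: power2_eq_square mult.assoc)
next
  case (Suc n)
  have 2: "(\<lambda>m. (real m - real n) / (real m + real n + 1)) \<longlonglongrightarrow> 1" by real_asymp
  have e: "real m * ret1 m * walk1 (2 * m) (2 * int n) * ((real m - real n) / (real m + real n + 1))
      = real m * ret1 m * walk1 (2 * m) (2 * int (Suc n))" for m
  proof -
    have "2 * ((real m + real n + 1) * walk1 (2 * m) (2 * int (Suc n))) = 2 * ((real m - real n) * walk1 (2 * m) (2 * int n))"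
      using walk1_space_step[of "2 * m" "2 * int n"] by (simp add: algebra_simps)
    then have "(real m + real n + 1) * walk1 (2 * m) (2 * int (Suc n)) = (real m - real n) * walk1 (2 * m) (2 * int n)"
      by simp
    moreover have "real m + real n + 1 > 0" by simp
    ultimately have "walk1 (2 * m) (2 * int n) * ((real m - real n) / (real m + real n + 1)) = walk1 (2 * m) (2 * int (Suc n))"
      by (simp add: field_simps)
    then show ?thesis by (simp only: mult.assoc)
  qed
  from tendsto_mult[OF Suc 2] show ?case unfolding e by simp
qed

text \<open>The summand is hypergeometric in the time and has a hypergeometric antiderivative; the
  right side is that antiderivative. The increment of the kernel along the diagonal thereby becomes
  the limit of a single boundary term.\<close>

lemma diag_increment_partial_sum:
  "(\<Sum>m<M. ret1 m * (walk1 (2 * m) (2 * int n) - walk1 (2 * m) (2 * int n + 2)))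
     = 4 * (real M - real n) / (2 * real n + 1) * (ret1 M * walk1 (2 * M) (2 * int n))"
proof (induction M)
  case 0
  then show ?case by auto
next
  case (Suc M)
  define c c' d where "c = walk1 (2 * M) (2 * int n)" and "c' = walk1 (2 * Suc M) (2 * int n)"
    and "d = walk1 (2 * M) (2 * int n + 2)"
  define a a' where "a = ret1 M" and "a' = ret1 (Suc M)"
  define x y where "x = real M" and "y = real n"
  have pos: "x + y + 1 > 0" "x + 1 > 0" "2 * y + 1 > 0" by (auto simp: x_def y_def)
  have "2 * ((x + y + 1) * d) = 2 * ((x - y) * c)"
    using walk1_space_step[of "2 * M" "2 * int n"] by (simp add: c_def d_def x_def y_def algebra_simps)
  then have d: "d = (x - y) * c / (x + y + 1)" using pos by (simp add: field_simps)
  have "2 * ((x + 1 + y) * (x + 1 - y)) * c' = (2 * x + 1) * (x + 1) * c"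
    using walk1_two_steps[of "2 * M" "2 * int n"] by (simp add: c_def c'_def x_def y_def field_simps)
  then have c': "(x + 1 - y) * c' = (2 * x + 1) * (x + 1) * c / (2 * (x + y + 1))" using pos by (simp add: field_simps)
  have "2 * (x + 1) * a' = (2 * x + 1) * a" using ret1_Suc[of M] by (simp add: a_def a'_def x_def)
  then have a': "a' = (2 * x + 1) * a / (2 * (x + 1))" using pos by (simp add: field_simps)
  have "4 * (x + 1 - y) / (2 * y + 1) * (a' * c') = 4 / (2 * y + 1) * a' * ((x + 1 - y) * c')" by simp
  also have "\<dots> = 4 / (2 * y + 1) * a * c * (2 * x + 1)^2 / (4 * (x + y + 1))"
    unfolding c' unfolding a' using pos by (simp add: divide_simps power2_eq_square) (simp add: algebra_simps)
  also have "\<dots> = 4 * (x - y) / (2 * y + 1) * (a * c) + a * (c - d)"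
    unfolding d using pos by (simp add: divide_simps power2_eq_square) (simp add: algebra_simps)
  finally show ?case using Suc by (simp add: a_def a'_def c_def c'_def d_def x_def y_def algebra_simps)
qed

lemma diag_increment_sums:
  "(\<lambda>m. ret1 m * (walk1 (2 * m) (2 * int n) - walk1 (2 * m) (2 * int n + 2))) sums (4 / (pi * (2 * real n + 1)))"
proof -
  have 1: "(\<lambda>M. (4 / (2 * real n + 1)) * ((real M - real n) / real M)) \<longlonglongrightarrow> 4 / (2 * real n + 1) * 1"
    by (intro tendsto_mult tendsto_const) real_asymp
  have "(\<lambda>M. (4 / (2 * real n + 1)) * ((real M - real n) / real M) * (real M * ret1 M * walk1 (2 * M) (2 * int n)))
     \<longlonglongrightarrow> 4 / (2 * real n + 1) * 1 * (1 / pi)"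
    by (rule tendsto_mult[OF 1 ret1_mult_walk1_asymp])
  moreover have "\<forall>\<^sub>F M in sequentially. (4 / (2 * real n + 1)) * ((real M - real n) / real M) * (real M * ret1 M * walk1 (2 * M) (2 * int n))
     = (\<Sum>m<M. ret1 m * (walk1 (2 * m) (2 * int n) - walk1 (2 * m) (2 * int n + 2)))"
    using eventually_gt_at_top[of 0] by eventually_elim (simp add: diag_increment_partial_sum)
  ultimately have "(\<lambda>M. \<Sum>m<M. ret1 m * (walk1 (2 * m) (2 * int n) - walk1 (2 * m) (2 * int n + 2)))
      \<longlonglongrightarrow> 4 / (2 * real n + 1) * 1 * (1 / pi)" by (rule Lim_transform_eventually)
  then show ?thesis unfolding sums_def by (simp add: mult.commute)
qed

section \<open>The potential kernel\<close>

declare srw_prob.simps(2) [simp del]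

definition avg :: "(pt \<Rightarrow> real) \<Rightarrow> pt \<Rightarrow> real" where
  "avg f x = (\<Sum>y\<in>nbrs x. f y) / 4"

lemma avg_expand:
  "avg f x = (f (fst x + 1, snd x) + f (fst x - 1, snd x) + f (fst x, snd x + 1) + f (fst x, snd x - 1)) / 4"
  by (simp add: avg_def sum_nbrs)

lemma finite_nbrs [simp]: "finite (nbrs x)"
  by (simp add: nbrs_def)

lemma avg_linear:
  "avg (\<lambda>x. f x + g x) x = avg f x + avg g x"
  "avg (\<lambda>x. f x - g x) x = avg f x - avg g x"
  "avg (\<lambda>x. c * f x) x = c * avg f x"
  "avg (\<lambda>x. - f x) x = - avg f x"
  "avg (\<lambda>x. c) x = c"
  by (simp_all add: avg_expand algebra_simps add_divide_distrib diff_divide_distrib)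

lemma avg_sum: "avg (\<lambda>x. \<Sum>i\<in>I. f i x) x = (\<Sum>i\<in>I. avg (f i) x)"
  by (induction I rule: infinite_finite_induct) (simp_all add: avg_linear)

lemma avg_mono: "(\<And>y. y \<in> nbrs x \<Longrightarrow> f y \<le> g y) \<Longrightarrow> avg f x \<le> avg g x"
  by (simp add: avg_def sum_mono divide_right_mono)

lemma avg_cong: "(\<And>y. y \<in> nbrs x \<Longrightarrow> f y = g y) \<Longrightarrow> avg f x = avg g x"
  by (simp add: avg_def)

text \<open>Rotated by 45 degrees the two coordinates of the walk are independent, so the terms
  of the series for \<^term>\<open>pot\<close> are of this form.\<close>

definition pterm :: "nat \<Rightarrow> int \<Rightarrow> int \<Rightarrow> real" where
  "pterm k u v = walk1 k 0 * walk1 k 0 - walk1 k u * walk1 k v"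

lemma srw_diff_eq_pterm: "srw_prob k 0 0 - srw_prob k x 0 = pterm k (fst x + snd x) (fst x - snd x)"
  by (simp add: pterm_def srw_prob_eq_walk1)

lemma pterm_sym: "pterm k v u = pterm k u v" "pterm k (- u) v = pterm k u v" "pterm k u (- v) = pterm k u v"
  by (simp_all add: pterm_def walk1_uminus)

lemma pterm_abs: "pterm k \<bar>u\<bar> \<bar>v\<bar> = pterm k u v"
  by (auto simp: pterm_sym abs_if)

lemma walk1_product_summable: "summable (\<lambda>k. walk1 k u * walk1 k v - walk1 (Suc k) u * walk1 (Suc k) v)"
  if "even (u + v)"
proof -
  from that obtain c where c: "u + v = 2 * c" by blast
  \<comment> \<open>The lattice point with rotated coordinates \<open>u\<close> and
    \<open>v\<close>; it is integral because their sum is even.\<close>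
  define x where "x = (c, u - c)"
  have x: "walk1 k u * walk1 k v = srw_prob k x 0" for k
  proof -
    have "fst x + snd x = u" "fst x - snd x = v" using c by (auto simp: x_def)
    then show ?thesis by (simp add: srw_prob_eq_walk1)
  qed
  show ?thesis unfolding x by (rule telescope_summable'[OF srw_prob_tendsto_0])
qed

text \<open>Harmonicity term by term: the mean of the four corner terms is the term at the centre
  plus a difference that telescopes in \<open>k\<close>.\<close>

lemma pterm_four_summable:
  assumes "summable (\<lambda>k. pterm k u v)" "even (u + v)"
  shows "summable (\<lambda>k. pterm k (u + 1) (v + 1) + pterm k (u + 1) (v - 1) + pterm k (u - 1) (v + 1) + pterm k (u - 1) (v - 1))"
proof -
  have "summable (\<lambda>k. 4 * (pterm k u v + (walk1 k u * walk1 k v - walk1 (Suc k) u * walk1 (Suc k) v)))"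
    by (intro summable_mult summable_add assms walk1_product_summable)
  moreover have "4 * (pterm k u v + (walk1 k u * walk1 k v - walk1 (Suc k) u * walk1 (Suc k) v))
      = pterm k (u + 1) (v + 1) + pterm k (u + 1) (v - 1) + pterm k (u - 1) (v + 1) + pterm k (u - 1) (v - 1)" for k
    by (simp add: pterm_def walk1.simps(2) field_simps)
  ultimately show ?thesis by simp
qed

definition diag :: "nat \<Rightarrow> real" where
  "diag n = 4 / pi * (\<Sum>j<n. 1 / (2 * real j + 1))"

lemma pterm_diag_sums: "(\<lambda>k. pterm k (2 * int n) 0) sums diag n"
proof (induction n)
  case 0
  show ?case by (simp add: pterm_def diag_def)
next
  case (Suc n)
  have "(\<lambda>m. ret1 m * (walk1 (2 * m) (2 * int n) - walk1 (2 * m) (2 * int n + 2)))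
      = (\<lambda>m. (\<lambda>k. walk1 k 0 * (walk1 k (2 * int n) - walk1 k (2 * int n + 2))) (2 * m))" by simp
  moreover have "strict_mono (\<lambda>m::nat. 2 * m)" by (simp add: strict_mono_def)
  \<comment> \<open>Odd times contribute nothing by parity, so the series over even times is the
    whole series.\<close>
  moreover have "walk1 k 0 * (walk1 k (2 * int n) - walk1 k (2 * int n + 2)) = 0" if "k \<notin> range (\<lambda>m. 2 * m)" for k
  proof -
    have "odd k" using that by auto
    then show ?thesis by (simp add: walk1_parity)
  qed
  ultimately have "(\<lambda>k. walk1 k 0 * (walk1 k (2 * int n) - walk1 k (2 * int n + 2))) sums (4 / (pi * (2 * real n + 1)))"
    using diag_increment_sums[of n] sums_mono_reindex[of "\<lambda>m. 2 * m"
        "\<lambda>k. walk1 k 0 * (walk1 k (2 * int n) - walk1 k (2 * int n + 2))"] by simp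
  from sums_add[OF Suc this] show ?case
    by (simp add: pterm_def diag_def algebra_simps)
qed

text \<open>The axes of the rotated coordinates are the lattice diagonals, where the series is
  known. Elsewhere the four-corner relation at the point one step inwards is solved for its
  outermost corner, the other three having smaller coordinate sum. Next to an axis two corners are
  mirror images of the other two, which explains the factors 1/2 and 1/4.\<close>

lemma pterm_summable_nat: "even (u + v) \<Longrightarrow> summable (\<lambda>k. pterm k (int u) (int v))"
proof (induction "u + v" arbitrary: u v rule: less_induct)
  case less
  have IH: "summable (\<lambda>k. pterm k (int a) (int b))" if "a + b < u + v" "even (a + b)" for a b
    using less(1)[OF that] .
  have diag: "summable (\<lambda>k. pterm k (int a) 0)" if "even a" for a
  proof -
    from that obtain n where "a = 2 * n" by blast
    then show ?thesis using pterm_diag_sums[of n] by (simp add: sums_iff)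
  qed
  have diag': "summable (\<lambda>k. pterm k 0 (int a))" if "even a" for a
    using diag[OF that] pterm_sym(1) by simp
  have edge: "summable (\<lambda>k. pterm k (int a + 1) 1)" if "even a" "a + 2 \<le> u + v" for a
  proof (cases "a = 0")
    case True
    have "summable (\<lambda>k. pterm k 1 1 + pterm k 1 (-1) + pterm k (-1) 1 + pterm k (-1) (-1))"
      using pterm_four_summable[of 0 0] diag[of 0] by simp
    then have "summable (\<lambda>k. (1/4) * (4 * pterm k 1 1))" by (intro summable_mult) (simp add: pterm_sym)
    then show ?thesis using True by simp
  next
    case False
    have "summable (\<lambda>k. pterm k (int a + 1) 1 + pterm k (int a + 1) (- 1) + pterm k (int a - 1) 1 + pterm k (int a - 1) (- 1))"
      using pterm_four_summable[of "int a" 0] diag[of a] that(1) by simp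
    then have "summable (\<lambda>k. (1/2) * (2 * pterm k (int a + 1) 1 + 2 * pterm k (int a - 1) 1) - pterm k (int (a - 1)) (int 1))"
      using False that by (intro summable_diff summable_mult IH) (auto simp: pterm_sym algebra_simps)
    then show ?thesis using False by (simp add: of_nat_diff add_divide_distrib)
  qed
  consider "u = 0" | "v = 0" | "v = 1" "u > 0" | "u = 1" "v > 0" | "u > 1" "v > 1" by linarith
  then show ?case
  proof cases
    case 1
    then show ?thesis using diag' less by simp
  next
    case 2
    then show ?thesis using diag less by simp
  next
    case 3
    then show ?thesis using edge[of "u - 1"] less(2) by (simp add: of_nat_diff)
  next
    case 4
    then show ?thesis using edge[of "v - 1"] less(2) by (simp add: of_nat_diff pterm_sym(1)[of _ _ 1])
  next
    case 5
    define a b where "a = u - 1" and "b = v - 1"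
    have ab: "u = a + 1" "v = b + 1" "a > 0" "b > 0" using 5 by (auto simp: a_def b_def)
    have ev: "even (a + b)" using less(2) ab by simp
    have s: "summable (\<lambda>k. pterm k (int a) (int b))" using IH[of a b] ab ev by simp
    have "summable (\<lambda>k. (pterm k (int a + 1) (int b + 1) + pterm k (int a + 1) (int b - 1) + pterm k (int a - 1) (int b + 1) + pterm k (int a - 1) (int b - 1))
        - pterm k (int (a + 1)) (int (b - 1)) - pterm k (int (a - 1)) (int (b + 1)) - pterm k (int (a - 1)) (int (b - 1)))"
      using ab ev by (intro summable_diff pterm_four_summable s IH) auto
    then show ?thesis using ab by (simp add: of_nat_diff algebra_simps)
  qed
qed

lemma pterm_summable:
  assumes "even (u + v)" shows "summable (\<lambda>k. pterm k u v)"
proof -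
  have "even (\<bar>u\<bar> + \<bar>v\<bar>)" using assms by simp
  then have "even (nat \<bar>u\<bar> + nat \<bar>v\<bar>)" by (simp add: even_nat_iff flip: nat_add_distrib)
  from pterm_summable_nat[OF this] show ?thesis by (simp add: pterm_abs)
qed

lemma pot_sums: "(\<lambda>k. srw_prob k 0 0 - srw_prob k x 0) sums pot x"
proof -
  have "summable (\<lambda>k. srw_prob k 0 0 - srw_prob k x 0)"
    unfolding srw_diff_eq_pterm by (rule pterm_summable) simp
  then show ?thesis by (simp add: pot_def summable_sums)
qed

lemma pot_eq_pterm: "pot x = (\<Sum>k. pterm k (fst x + snd x) (fst x - snd x))"
  by (simp only: pot_def srw_diff_eq_pterm)

lemma pot_0 [simp]: "pot 0 = 0" "pot (0, 0) = 0"
  by (simp_all add: pot_def flip: zero_prod_def)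

lemma pot_diag: "pot (int n, int n) = diag n"
  using pterm_diag_sums[of n] by (simp add: pot_eq_pterm sums_iff)

lemma pot_swap: "pot (b, a) = pot (a, b)"
proof -
  have "pterm k (b + a) (b - a) = pterm k (a + b) (a - b)" for k
    using pterm_sym(3)[of k "a + b" "a - b"] by (simp add: add.commute)
  then show ?thesis by (simp add: pot_eq_pterm)
qed

lemma pot_neg_fst: "pot (- a, b) = pot (a, b)"
proof -
  have "pterm k (- a + b) (- a - b) = pterm k (a + b) (a - b)" for k
    using pterm_sym(2)[of k "a - b" "- a - b"] pterm_sym(3)[of k "a - b" "a + b"] pterm_sym(1)[of k "a + b" "a - b"]
    by (simp add: algebra_simps)
  then show ?thesis by (simp add: pot_eq_pterm)
qed

lemma pot_neg_snd: "pot (a, - b) = pot (a, b)"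
  using pot_swap pot_neg_fst by metis

lemma pot_uminus [simp]: "pot (- x) = pot x"
  by (cases x) (simp add: pot_neg_fst pot_neg_snd)

lemma pot_commute: "pot (x - y) = pot (y - x)"
  using pot_uminus[of "x - y"] by simp

lemma avg_srw_prob: "avg (\<lambda>y. srw_prob k y 0) x = srw_prob (Suc k) x 0"
  by (simp add: avg_def srw_prob.simps(2))

text \<open>Averaging shifts the time index of the series by one; the difference telescopes and
  leaves the time-zero term, a unit charge at the origin.\<close>

lemma avg_pot: "avg pot x = pot x + (if x = 0 then 1 else 0)"
proof -
  have e: "(\<Sum>y\<in>nbrs x. srw_prob k 0 0 - srw_prob k y 0) / 4 = srw_prob k 0 0 - srw_prob (Suc k) x 0" for k
    using avg_linear(2)[of "\<lambda>_. srw_prob k 0 0" "\<lambda>y. srw_prob k y 0" x]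
    unfolding avg_srw_prob avg_linear(5) unfolding avg_def .
  have "(\<lambda>k. (\<Sum>y\<in>nbrs x. srw_prob k 0 0 - srw_prob k y 0)) sums (\<Sum>y\<in>nbrs x. pot y)"
    by (intro sums_sum pot_sums)
  then have "(\<lambda>k. (\<Sum>y\<in>nbrs x. srw_prob k 0 0 - srw_prob k y 0) / 4) sums avg pot x"
    unfolding avg_def by (rule sums_divide)
  then have "(\<lambda>k. srw_prob k 0 0 - srw_prob (Suc k) x 0) sums avg pot x"
    by (simp only: e)
  moreover have "(\<lambda>k. (srw_prob k 0 0 - srw_prob k x 0) + (srw_prob k x 0 - srw_prob (Suc k) x 0)) sums (pot x + (srw_prob 0 x 0 - 0))"
    by (intro sums_add pot_sums telescope_sums' srw_prob_tendsto_0)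
  ultimately show ?thesis by (auto dest: sums_unique2)
qed

lemma avg_pot_nonzero: "x \<noteq> 0 \<Longrightarrow> avg pot x = pot x"
  by (simp add: avg_pot)

lemma pot_unit: "pot (1, 0) = 1"
proof -
  have "avg pot 0 = 1" by (simp add: avg_pot)
  then show ?thesis using pot_neg_fst[of 1 0] pot_neg_snd[of 0 1] pot_swap[of 1 0]
    by (simp add: avg_expand)
qed

lemma pot_nbr_0: "0 \<in> nbrs x \<Longrightarrow> pot x = 1"
proof -
  assume "0 \<in> nbrs x"
  then have "x = (1, 0) \<or> x = (-1, 0) \<or> x = (0, 1) \<or> x = (0, -1)"
    by (cases x) (auto simp: nbrs_def zero_prod_def)
  then show "pot x = 1"
    using pot_unit pot_neg_fst[of 1 0] pot_neg_snd[of 0 1] pot_swap[of 1 0] by auto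
qed

section \<open>Elementary bounds for the potential kernel\<close>

lemma pterm_nonneg: "even u \<Longrightarrow> even v \<Longrightarrow> pterm k u v \<ge> 0"
  unfolding pterm_def using walk1_even_antimono[of 0 u k] walk1_even_antimono[of 0 v k]
  by (simp add: mult_mono walk1_nonneg)

lemma pot_ge_1_even: "x \<noteq> 0 \<Longrightarrow> even (fst x + snd x) \<Longrightarrow> pot x \<ge> 1"
proof -
  assume x: "x \<noteq> 0" "even (fst x + snd x)"
  have ev: "even (fst x - snd x)" using x(2) by presburger
  have "pterm 0 (fst x + snd x) (fst x - snd x) = 1"
    using x(1) by (cases x) (auto simp: pterm_def zero_prod_def)
  moreover have "sum (\<lambda>k. pterm k (fst x + snd x) (fst x - snd x)) {0} \<le> pot x"
    unfolding pot_eq_pterm using x(2) ev by (intro sum_le_suminf pterm_summable pterm_nonneg) auto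
  ultimately show ?thesis by simp
qed

text \<open>At even sites all terms of the series are nonnegative and the first one is 1. At odd
  sites the kernel is either 1, next to the origin, or a mean over nonzero even sites.\<close>

lemma pot_ge_1: "x \<noteq> 0 \<Longrightarrow> pot x \<ge> 1"
proof (cases "even (fst x + snd x)")
  case False
  assume x: "x \<noteq> 0"
  show ?thesis
  proof (cases "0 \<in> nbrs x")
    case True
    then show ?thesis by (simp add: pot_nbr_0)
  next
    case n: False
    have "pot y \<ge> 1" if "y \<in> nbrs x" for y
    proof (rule pot_ge_1_even)
      show "y \<noteq> 0" using n that by auto
      show "even (fst y + snd y)" using that False by (auto simp: nbrs_def)
    qed
    then have "avg (\<lambda>_. 1) x \<le> avg pot x" by (intro avg_mono)
    then show ?thesis using x by (simp add: avg_linear avg_pot)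
  qed
qed (simp add: pot_ge_1_even)

lemma pot_nonneg: "pot x \<ge> 0"
  using pot_ge_1[of x] by (cases "x = 0") auto

lemma pot_pos: "x \<noteq> 0 \<Longrightarrow> pot x > 0"
  using pot_ge_1[of x] by simp

lemma diag_mono: "m \<le> n \<Longrightarrow> diag m \<le> diag n"
  unfolding diag_def by (intro mult_left_mono sum_mono2) auto

text \<open>Monotonicity pushes both rotated coordinates out to the larger one,
  \<open>2 * n\<close>, and a^2 - q^2 <= 2 a (a - q) reduces to a diagonal series; hence the factor
  2. This crude bound makes \<open>pot\<close> sublinear before its asymptotics are known.\<close>

lemma pot_le_diag_even:
  assumes "even (fst x + snd x)"
  shows "pot x \<le> 2 * diag (nat (\<bar>fst x\<bar> + \<bar>snd x\<bar>))"
proof -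
  define u v where "u = fst x + snd x" and "v = fst x - snd x"
  have ev: "even u" "even v" using assms by (auto simp: u_def v_def)
  define n where "n = nat (max \<bar>u\<bar> \<bar>v\<bar> div 2)"
  have "even (max \<bar>u\<bar> \<bar>v\<bar>)" using ev by (simp add: max_def)
  then have n: "2 * int n = max \<bar>u\<bar> \<bar>v\<bar>" unfolding n_def by auto
  then have n': "\<bar>u\<bar> \<le> \<bar>2 * int n\<bar>" "\<bar>v\<bar> \<le> \<bar>2 * int n\<bar>" by auto
  have le: "pterm k u v \<le> 2 * pterm k (2 * int n) 0" for k
  proof -
    define a q where "a = walk1 k 0" and "q = walk1 k (2 * int n)"
    have q: "q \<le> walk1 k u" "q \<le> walk1 k v" "0 \<le> q" "q \<le> a"
      unfolding q_def a_def using ev n' by (auto intro!: walk1_even_antimono walk1_nonneg)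
    have "pterm k u v \<le> a * a - q * q"
      unfolding pterm_def a_def[symmetric] using q by (intro diff_left_mono mult_mono) auto
    also have "\<dots> = (a + q) * (a - q)" by (simp add: algebra_simps)
    also have "\<dots> \<le> (2 * a) * (a - q)" using q by (intro mult_right_mono) auto
    also have "\<dots> = 2 * pterm k (2 * int n) 0" by (simp add: pterm_def a_def q_def algebra_simps)
    finally show ?thesis .
  qed
  have "pot x \<le> (\<Sum>k. 2 * pterm k (2 * int n) 0)"
    unfolding pot_eq_pterm u_def[symmetric] v_def[symmetric] using le ev
    by (intro suminf_le summable_mult pterm_summable) auto
  also have "\<dots> = 2 * diag n" using pterm_diag_sums[of n] by (simp add: suminf_mult sums_iff)
  also have "diag n \<le> diag (nat (\<bar>fst x\<bar> + \<bar>snd x\<bar>))"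
  proof (rule diag_mono)
    have "2 * int n \<le> \<bar>fst x\<bar> + \<bar>snd x\<bar>" unfolding n u_def v_def by linarith
    then show "n \<le> nat (\<bar>fst x\<bar> + \<bar>snd x\<bar>)" by linarith
  qed
  finally show ?thesis by simp
qed

lemma pot_le_diag: "pot x \<le> 2 * diag (nat (\<bar>fst x\<bar> + \<bar>snd x\<bar> + 1))"
proof (cases "even (fst x + snd x)")
  case True
  have "diag (nat (\<bar>fst x\<bar> + \<bar>snd x\<bar>)) \<le> diag (nat (\<bar>fst x\<bar> + \<bar>snd x\<bar> + 1))" by (rule diag_mono) auto
  then show ?thesis using pot_le_diag_even[OF True] by linarith
next
  case False
  then have "x \<noteq> 0" by auto
  then have "pot x = avg pot x" by (simp add: avg_pot)
  also have "\<dots> \<le> avg (\<lambda>_. 2 * diag (nat (\<bar>fst x\<bar> + \<bar>snd x\<bar> + 1))) x"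
  proof (rule avg_mono)
    fix y assume y: "y \<in> nbrs x"
    have "pot y \<le> 2 * diag (nat (\<bar>fst y\<bar> + \<bar>snd y\<bar>))" using y False by (intro pot_le_diag_even) (auto simp: nbrs_def)
    moreover have "diag (nat (\<bar>fst y\<bar> + \<bar>snd y\<bar>)) \<le> diag (nat (\<bar>fst x\<bar> + \<bar>snd x\<bar> + 1))"
      using y by (intro diag_mono) (auto simp: nbrs_def)
    ultimately show "pot y \<le> 2 * diag (nat (\<bar>fst x\<bar> + \<bar>snd x\<bar> + 1))" by linarith
  qed
  also have "\<dots> = 2 * diag (nat (\<bar>fst x\<bar> + \<bar>snd x\<bar> + 1))" by (simp add: avg_linear)
  finally show ?thesis .
qed

section \<open>Maximum principle\<close>

text \<open>A maximiser with largest first coordinate replaces a connectedness argument: a positive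
  maximum is attained at its right neighbour too, which must then lie in \<open>D\<close> and
  contradicts the choice.\<close>

lemma max_principle:
  fixes f :: "pt \<Rightarrow> real"
  assumes fin: "finite D" and sub: "\<And>x. x \<in> D \<Longrightarrow> f x \<le> avg f x"
    and bd: "\<And>x y. x \<in> D \<Longrightarrow> y \<in> nbrs x \<Longrightarrow> y \<notin> D \<Longrightarrow> f y \<le> 0" and x: "x \<in> D"
  shows "f x \<le> 0"
proof (rule ccontr)
  assume pos: "\<not> f x \<le> 0"
  define m where "m = Max (f ` D)"
  define E where "E = {y \<in> D. f y = m}"
  have fm: "f y \<le> m" if "y \<in> D" for y unfolding m_def using fin that by auto
  have m0: "m > 0" using fm[OF x] pos by linarith
  have "m \<in> f ` D" unfolding m_def using fin x by (intro Max_in) auto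
  then have "E \<noteq> {}" by (auto simp: E_def)
  moreover have finE: "finite E" using fin by (simp add: E_def)
  ultimately have "Max (fst ` E) \<in> fst ` E" by (intro Max_in) auto
  then obtain q where q: "q \<in> E" "Max (fst ` E) = fst q" by auto
  have qD: "q \<in> D" "f q = m" using q by (auto simp: E_def)
  have le: "f y \<le> m" if "y \<in> nbrs q" for y
    using fm[of y] bd[OF qD(1) that] m0 by (cases "y \<in> D") auto
  define r where "r = (fst q + 1, snd q)"
  have rn: "r \<in> nbrs q" by (simp add: r_def nbrs_def)
  have "4 * m \<le> f (fst q + 1, snd q) + f (fst q - 1, snd q) + f (fst q, snd q + 1) + f (fst q, snd q - 1)"
    using sub[OF qD(1)] qD(2) by (simp add: avg_expand)
  moreover have "f (fst q - 1, snd q) \<le> m" "f (fst q, snd q + 1) \<le> m" "f (fst q, snd q - 1) \<le> m"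
    by (auto intro!: le simp: nbrs_def)
  ultimately have "f r \<ge> m" by (simp add: r_def)
  then have fr: "f r = m" using le[OF rn] by simp
  then have "r \<in> D" using bd[OF qD(1) rn] m0 by force
  then have "r \<in> E" using fr by (simp add: E_def)
  then have "fst r \<le> fst q" unfolding q(2)[symmetric] using finE by simp
  then show False by (simp add: r_def)
qed

lemma comparison_principle:
  fixes f w :: "pt \<Rightarrow> real"
  assumes fin: "finite D" and sup: "\<And>x. x \<in> D \<Longrightarrow> \<bar>avg f x - f x\<bar> \<le> w x - avg w x"
    and bd: "\<And>x y. x \<in> D \<Longrightarrow> y \<in> nbrs x \<Longrightarrow> y \<notin> D \<Longrightarrow> \<bar>f y\<bar> \<le> w y" and x: "x \<in> D"
  shows "\<bar>f x\<bar> \<le> w x"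
proof -
  have "f x - w x \<le> 0"
    by (rule max_principle[OF fin _ _ x, of "\<lambda>x. f x - w x"]) (use sup bd in \<open>force simp: avg_linear\<close>)+
  moreover have "- f x - w x \<le> 0"
    by (rule max_principle[OF fin _ _ x, of "\<lambda>x. - f x - w x"]) (use sup bd in \<open>force simp: avg_linear\<close>)+
  ultimately show ?thesis by linarith
qed

section \<open>Discrete Laplacians of the comparison functions\<close>

definition cpt :: "pt \<Rightarrow> complex" where
  "cpt p = Complex (of_int (fst p)) (of_int (snd p))"

lemma cmod_cpt: "cmod (cpt p) = znorm p"
  by (simp add: cpt_def znorm_def cmod_def)

lemma cpt_eq_0_iff [simp]: "cpt p = 0 \<longleftrightarrow> p = 0"
  by (cases p) (auto simp: cpt_def complex_eq_iff zero_prod_def)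

lemma znorm_eq_0_iff [simp]: "znorm p = 0 \<longleftrightarrow> p = 0"
  by (simp flip: cmod_cpt)

lemma znorm_0 [simp]: "znorm 0 = 0"
  by simp

lemma znorm_nonneg [simp]: "znorm p \<ge> 0"
  by (simp flip: cmod_cpt)

definition cavg :: "(complex \<Rightarrow> 'a::real_normed_field) \<Rightarrow> complex \<Rightarrow> 'a" where
  "cavg g z = (g (z + 1) + g (z - 1) + g (z + \<i>) + g (z - \<i>)) / 4"

lemma avg_cpt: "avg (\<lambda>p. g (cpt p)) p = cavg g (cpt p)"
proof -
  have "cpt (fst p + 1, snd p) = cpt p + 1" "cpt (fst p - 1, snd p) = cpt p - 1"
    "cpt (fst p, snd p + 1) = cpt p + \<i>" "cpt (fst p, snd p - 1) = cpt p - \<i>"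
    by (simp_all add: cpt_def complex_eq_iff)
  then show ?thesis by (simp add: avg_expand cavg_def)
qed

lemma cavg_Re: "cavg (\<lambda>w. Re (g w)) z = Re (cavg g z)"
  by (simp add: cavg_def)

section \<open>Taylor remainders of negative powers on the disc of radius 1/2\<close>

lemma half_le_norm_1_plus: "cmod s \<le> 1/2 \<Longrightarrow> 1/2 \<le> cmod (1 + s)"
  using norm_triangle_ineq2[of 1 "- s"] by simp

lemma cmod_poly_bound:
  assumes "cmod s \<le> 1/2"
  shows "cmod (a + b * s + c * s^2 + d * s^3) \<le> cmod a + cmod b / 2 + cmod c / 4 + cmod d / 8"
proof -
  have "cmod s ^ 2 \<le> (1/2)^2" "cmod s ^ 3 \<le> (1/2)^3" by (intro power_mono assms norm_ge_zero)+
  then have "cmod b * cmod s \<le> cmod b * (1/2)" "cmod c * cmod s ^ 2 \<le> cmod c * (1/2)^2" "cmod d * cmod s ^ 3 \<le> cmod d * (1/2)^3"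
    by (intro mult_left_mono assms norm_ge_zero; simp)+
  moreover have "cmod (a + b * s + c * s^2 + d * s^3) \<le> cmod a + cmod (b * s) + cmod (c * s^2) + cmod (d * s^3)"
    by (intro order_trans[OF norm_triangle_ineq] add_mono order_refl)
  ultimately show ?thesis by (simp add: norm_mult norm_power power2_eq_square power3_eq_cube)
qed

lemma inverse_power_bound: "cmod s \<le> 1/2 \<Longrightarrow> cmod (inverse ((1 + s)^n)) \<le> 2 ^ n"
proof -
  assume "cmod s \<le> 1/2"
  then have "(1/2)^n \<le> cmod (1 + s) ^ n" by (intro power_mono half_le_norm_1_plus) auto
  then have "inverse (cmod (1 + s) ^ n) \<le> inverse ((1/2)^n)" by (intro le_imp_inverse_le) auto
  then show ?thesis by (simp add: norm_inverse norm_power power_one_over)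
qed

text \<open>The hypothesis \<open>eq\<close> says that the cubic Taylor polynomial inverts (1 + s)^n
  up to s^4 times an explicit cofactor. Bounding the cofactor on the disc, and the inverse power by
  2^n, gives the constants below: 4 * 7 = 28, 8 * 29.5 = 236 and 16 * 97 = 1552.\<close>

lemma binomial_remainder_bound:
  assumes s: "cmod s \<le> 1/2"
    and eq: "(1 + s)^n * (1 + c1 * s + c2 * s^2 + c3 * s^3) = 1 - s^4 * (a + b * s + c * s^2 + d * s^3)"
    and C: "2 ^ n * (cmod a + cmod b / 2 + cmod c / 4 + cmod d / 8) \<le> C"
  shows "cmod (inverse ((1 + s)^n) - (1 + c1 * s + c2 * s^2 + c3 * s^3)) \<le> C * cmod s ^ 4"
proof -
  have "1 + s \<noteq> 0" using half_le_norm_1_plus[OF s] by auto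
  then have "inverse ((1 + s)^n) * ((1 + s)^n * (1 + c1 * s + c2 * s^2 + c3 * s^3)) = (1 + c1 * s + c2 * s^2 + c3 * s^3)"
    by simp
  then have "inverse ((1 + s)^n) - (1 + c1 * s + c2 * s^2 + c3 * s^3)
      = inverse ((1 + s)^n) * (s^4 * (a + b * s + c * s^2 + d * s^3))"
    unfolding eq by (simp add: algebra_simps)
  also have "cmod \<dots> = cmod (inverse ((1 + s)^n)) * cmod (a + b * s + c * s^2 + d * s^3) * cmod s ^ 4"
    by (simp add: norm_mult norm_power)
  also have "\<dots> \<le> (2 ^ n * (cmod a + cmod b / 2 + cmod c / 4 + cmod d / 8)) * cmod s ^ 4"
    by (intro mult_right_mono mult_mono inverse_power_bound cmod_poly_bound s) auto
  also have "\<dots> \<le> C * cmod s ^ 4" using C by (intro mult_right_mono) auto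
  finally show ?thesis .
qed

lemma inverse_power2_remainder:
  "cmod s \<le> 1/2 \<Longrightarrow> cmod (inverse ((1 + s)^2) - (1 + (-2) * s + 3 * s^2 + (-4) * s^3)) \<le> 28 * cmod s ^ 4"
  by (rule binomial_remainder_bound[where a = 5 and b = 4 and c = 0 and d = 0]) (simp_all add: algebra_simps power2_eq_square power3_eq_cube power4_eq_xxxx)

lemma inverse_power3_remainder:
  "cmod s \<le> 1/2 \<Longrightarrow> cmod (inverse ((1 + s)^3) - (1 + (-3) * s + 6 * s^2 + (-10) * s^3)) \<le> 236 * cmod s ^ 4"
  by (rule binomial_remainder_bound[where a = 15 and b = 24 and c = 10 and d = 0]) (simp_all add: algebra_simps power2_eq_square power3_eq_cube power4_eq_xxxx)

lemma inverse_power4_remainder: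
  "cmod s \<le> 1/2 \<Longrightarrow> cmod (inverse ((1 + s)^4) - (1 + (-4) * s + 10 * s^2 + (-20) * s^3)) \<le> 1552 * cmod s ^ 4"
  by (rule binomial_remainder_bound[where a = 35 and b = 84 and c = 70 and d = 20]) (simp_all add: algebra_simps power2_eq_square power3_eq_cube power4_eq_xxxx)

text \<open>Averaging over the four units kills every Taylor term whose degree is not divisible by
  four; weighting with the conjugate unit selects the linear term.\<close>

lemma four_point_average:
  assumes G: "\<And>s. cmod s \<le> 1/2 \<Longrightarrow> cmod (G s - (1 + c1 * s + c2 * s^2 + c3 * s^3)) \<le> C * cmod s ^ 4"
    and t: "cmod t \<le> 1/2"
  shows "cmod ((G t + G (- t) + G (\<i> * t) + G (- (\<i> * t))) / 4 - 1) \<le> C * cmod t ^ 4"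
    and "cmod ((G t - G (- t) - \<i> * G (\<i> * t) + \<i> * G (- (\<i> * t))) / 4 - c1 * t) \<le> C * cmod t ^ 4"
proof -
  define P where "P s = 1 + c1 * s + c2 * s^2 + c3 * s^3" for s
  define E where "E s = G s - P s" for s
  have E: "cmod (E t) \<le> C * cmod t ^ 4" "cmod (E (- t)) \<le> C * cmod t ^ 4"
    "cmod (E (\<i> * t)) \<le> C * cmod t ^ 4" "cmod (E (- (\<i> * t))) \<le> C * cmod t ^ 4"
    using G[of t] G[of "- t"] G[of "\<i> * t"] G[of "- (\<i> * t)"] t by (simp_all add: E_def P_def norm_mult)
  have i3: "(\<i> * t)^3 = - \<i> * t^3" by (simp add: power_mult_distrib power3_eq_cube[of \<i>])
  have i2: "(\<i> * t)^2 = - (t^2)" by (simp add: power_mult_distrib)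
  have "P t + P (- t) + P (\<i> * t) + P (- (\<i> * t)) = 4"
    unfolding P_def by (simp add: i2 i3 power3_eq_cube[of \<i>] algebra_simps)
  then have e1: "(G t + G (- t) + G (\<i> * t) + G (- (\<i> * t))) / 4 - 1 = (E t + E (- t) + E (\<i> * t) + E (- (\<i> * t))) / 4"
    unfolding E_def by (simp add: field_simps)
  have "cmod (E t + E (- t) + E (\<i> * t) + E (- (\<i> * t))) \<le> 4 * (C * cmod t ^ 4)"
    using E norm_triangle_ineq[of "E t + E (- t) + E (\<i> * t)" "E (- (\<i> * t))"] norm_triangle_ineq[of "E t + E (- t)" "E (\<i> * t)"]
      norm_triangle_ineq[of "E t" "E (- t)"] by linarith
  then show "cmod ((G t + G (- t) + G (\<i> * t) + G (- (\<i> * t))) / 4 - 1) \<le> C * cmod t ^ 4"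
    unfolding e1 by (simp add: norm_divide)
  have "P t - P (- t) - \<i> * P (\<i> * t) + \<i> * P (- (\<i> * t)) = 4 * c1 * t"
    unfolding P_def by (simp add: i2 i3 power3_eq_cube[of \<i>] algebra_simps)
  moreover have "G t - G (- t) - \<i> * G (\<i> * t) + \<i> * G (- (\<i> * t)) = (E t - E (- t) - \<i> * E (\<i> * t) + \<i> * E (- (\<i> * t)))
      + (P t - P (- t) - \<i> * P (\<i> * t) + \<i> * P (- (\<i> * t)))"
    unfolding E_def by (simp add: algebra_simps)
  ultimately have e2: "(G t - G (- t) - \<i> * G (\<i> * t) + \<i> * G (- (\<i> * t))) / 4 - c1 * t = (E t - E (- t) - \<i> * E (\<i> * t) + \<i> * E (- (\<i> * t))) / 4"
    by (simp add: add_divide_distrib)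
  have "cmod (E t - E (- t) - \<i> * E (\<i> * t) + \<i> * E (- (\<i> * t))) \<le> 4 * (C * cmod t ^ 4)"
    using E norm_triangle_ineq[of "E t - E (- t) - \<i> * E (\<i> * t)" "\<i> * E (- (\<i> * t))"] norm_triangle_ineq4[of "E t - E (- t)" "\<i> * E (\<i> * t)"]
      norm_triangle_ineq4[of "E t" "E (- t)"] by (simp add: norm_mult)
  then show "cmod ((G t - G (- t) - \<i> * G (\<i> * t) + \<i> * G (- (\<i> * t))) / 4 - c1 * t) \<le> C * cmod t ^ 4"
    unfolding e2 by (simp add: norm_divide)
qed

lemma cmod_inverse_le: "cmod z \<ge> R \<Longrightarrow> R > 0 \<Longrightarrow> cmod (inverse z) \<le> 1 / R"
  by (simp add: norm_inverse divide_inverse le_imp_inverse_le)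

text \<open>With t = 1/z each neighbour is z (1 + w t) for a unit w, so the four-point averages
  apply. The second estimate serves functions with a factor \<open>cnj w\<close>: at a neighbour
  this factor is \<open>cnj z\<close> plus a conjugate unit, and the conjugate units are the weights
  1, -1, -i, i.\<close>

lemma cavg_inverse_power:
  assumes z: "cmod z \<ge> 2"
    and G: "\<And>s. cmod s \<le> 1/2 \<Longrightarrow> cmod (inverse ((1 + s)^n) - (1 + c1 * s + c2 * s^2 + c3 * s^3)) \<le> C * cmod s ^ 4"
  shows "cmod (cavg (\<lambda>w. inverse (w^n)) z - inverse (z^n)) \<le> C * cmod (inverse z) ^ (n + 4)"
    and "cmod (((inverse ((z + 1)^n) - inverse ((z - 1)^n) - \<i> * inverse ((z + \<i>)^n) + \<i> * inverse ((z - \<i>)^n)) / 4) - c1 * inverse z ^ (n + 1)) \<le> C * cmod (inverse z) ^ (n + 4)"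
proof -
  define t where "t = inverse z"
  have t: "cmod t \<le> 1/2" unfolding t_def using cmod_inverse_le[OF z] by simp
  have z0: "z \<noteq> 0" using z by auto
  define G where "G s = inverse ((1 + s)^n)" for s :: complex
  have sh: "inverse ((z + w)^n) = t^n * G (w * t)" for w
  proof -
    have "z + w = z * (1 + w * t)" using z0 by (simp add: t_def field_simps)
    then show ?thesis by (simp add: G_def t_def power_mult_distrib power_inverse)
  qed
  have iz: "inverse (z^n) = t^n" by (simp add: t_def power_inverse)
  have s: "inverse ((z + 1)^n) = t^n * G t" "inverse ((z - 1)^n) = t^n * G (- t)"
    "inverse ((z + \<i>)^n) = t^n * G (\<i> * t)" "inverse ((z - \<i>)^n) = t^n * G (- (\<i> * t))"
    using sh[of 1] sh[of "-1"] sh[of \<i>] sh[of "-\<i>"] by simp_all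
  note av = four_point_average[of G c1 c2 c3 C t, OF _ t]
  have 1: "cavg (\<lambda>w. inverse (w^n)) z - inverse (z^n) = t^n * ((G t + G (- t) + G (\<i> * t) + G (- (\<i> * t))) / 4 - 1)"
    unfolding cavg_def s iz by (simp add: field_simps)
  show "cmod (cavg (\<lambda>w. inverse (w^n)) z - inverse (z^n)) \<le> C * cmod (inverse z) ^ (n + 4)"
    unfolding 1 t_def[symmetric] using mult_left_mono[OF av(1), of "cmod t ^ n"] assms(2)
    by (simp add: norm_mult norm_power G_def power_add mult_ac)
  have 2: "(inverse ((z + 1)^n) - inverse ((z - 1)^n) - \<i> * inverse ((z + \<i>)^n) + \<i> * inverse ((z - \<i>)^n)) / 4 - c1 * inverse z ^ (n + 1)
      = t^n * ((G t - G (- t) - \<i> * G (\<i> * t) + \<i> * G (- (\<i> * t))) / 4 - c1 * t)"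
    unfolding s t_def[symmetric] by (simp add: field_simps)
  show "cmod ((inverse ((z + 1)^n) - inverse ((z - 1)^n) - \<i> * inverse ((z + \<i>)^n) + \<i> * inverse ((z - \<i>)^n)) / 4 - c1 * inverse z ^ (n + 1)) \<le> C * cmod (inverse z) ^ (n + 4)"
    unfolding 2 unfolding t_def[symmetric] using mult_left_mono[OF av(2), of "cmod t ^ n"] assms(2)
    by (simp add: norm_mult norm_power G_def power_add mult_ac)
qed

text \<open>The term -3 z^-4 is the continuum value, a quarter of the Laplacian of cnj z / z^3. The
  constant is 236 from the part multiplied by \<open>cnj z\<close> and 236 / 2 from the other, which
  has one more factor 1/|z| <= 1/2.\<close>

lemma cavg_cnj_inverse_cube:
  assumes z: "cmod z \<ge> 2"
  shows "cmod (cavg (\<lambda>w. cnj w * inverse (w^3)) z - cnj z * inverse (z^3) + 3 * inverse z ^ 4) \<le> 354 * cmod (inverse z) ^ 6"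
proof -
  note av = cavg_inverse_power[OF z inverse_power3_remainder]
  have z0: "z \<noteq> 0" using z by auto
  have t: "cmod (inverse z) \<le> 1/2" using cmod_inverse_le[OF z] by simp
  have "cavg (\<lambda>w. cnj w * inverse (w^3)) z - cnj z * inverse (z^3) + 3 * inverse z ^ 4
     = cnj z * (cavg (\<lambda>w. inverse (w^3)) z - inverse (z^3))
      + (((inverse ((z + 1)^3) - inverse ((z - 1)^3) - \<i> * inverse ((z + \<i>)^3) + \<i> * inverse ((z - \<i>)^3)) / 4) - (-3) * inverse z ^ (3 + 1))"
    by (simp add: cavg_def algebra_simps add_divide_distrib diff_divide_distrib)
  also have "cmod \<dots> \<le> cmod z * (236 * cmod (inverse z) ^ 7) + 236 * cmod (inverse z) ^ 7"
    using av by (intro order_trans[OF norm_triangle_ineq] add_mono) (auto simp: norm_mult intro!: mult_left_mono)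
  also have "cmod z * (236 * cmod (inverse z) ^ 7) = 236 * cmod (inverse z) ^ 6"
  proof -
    have "cmod z * cmod (inverse z) = 1" using z0 by (simp add: norm_inverse)
    moreover have "cmod z * (236 * cmod (inverse z) ^ 7) = 236 * (cmod z * cmod (inverse z)) * cmod (inverse z) ^ 6"
      using power_Suc[of "cmod (inverse z)" 6] by simp
    ultimately show ?thesis by simp
  qed
  also have "236 * cmod (inverse z) ^ 7 \<le> 118 * cmod (inverse z) ^ 6"
  proof -
    have "cmod (inverse z) * cmod (inverse z) ^ 6 \<le> 1/2 * cmod (inverse z) ^ 6" by (intro mult_right_mono t) auto
    then show ?thesis by (simp add: eval_nat_numeral)
  qed
  finally show ?thesis by simp
qed

lemma ln_cmod_1_minus_bound:
  assumes "cmod t \<le> 1/16"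
  shows "\<bar>ln (cmod (1 - t)) + Re t\<bar> \<le> 10 * cmod t ^ 2"
proof -
  define x where "x = - 2 * Re t + cmod t ^ 2"
  have sq: "cmod (1 - t) ^ 2 = 1 + x"
    unfolding x_def cmod_power2 by (simp add: power2_eq_square algebra_simps)
  have "cmod t ^ 2 \<le> 1 * cmod t" unfolding power2_eq_square using assms by (intro mult_right_mono) auto
  moreover have Re: "\<bar>Re t\<bar> \<le> cmod t" by (rule abs_Re_le_cmod)
  ultimately have x: "\<bar>x\<bar> \<le> 3 * cmod t" unfolding x_def using zero_le_power2[of "cmod t"] norm_ge_zero[of t] by linarith
  have "cmod (1 - t) > 0" using assms by auto
  then have "ln (cmod (1 - t)) = ln (1 + x) / 2" using ln_realpow[of "cmod (1 - t)" 2] sq by simp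
  moreover have "\<bar>ln (1 + x) - x\<bar> \<le> 2 * x ^ 2"
    using abs_ln_one_plus_x_minus_x_bound[of x] x assms by simp
  moreover have "x ^ 2 \<le> (3 * cmod t) ^ 2" using x by (intro abs_le_square_iff[THEN iffD1]) simp
  ultimately show ?thesis unfolding x_def power_mult_distrib by (simp add: abs_le_iff x_def field_simps)
qed

text \<open>Averaging the logarithm leaves the defect -Re (z^-4) / 4, and averaging cnj z / z^3
  leaves -3 z^-4; the coefficient 1/12 makes the two cancel.\<close>

definition log_approx :: "complex \<Rightarrow> real" where
  "log_approx z = ln (cmod z) - Re (cnj z * inverse (z^3)) / 12"

text \<open>The neighbours multiply to z^4 - 1, so the mean of the logarithms is exact.\<close>

lemma cavg_ln_cmod:
  assumes z: "cmod z \<ge> 2"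
  shows "cavg (\<lambda>w. ln (cmod w)) z = ln (cmod z) + ln (cmod (1 - inverse z ^ 4)) / 4"
proof -
  have ne: "cmod (z + 1) > 0" "cmod (z - 1) > 0" "cmod (z + \<i>) > 0" "cmod (z - \<i>) > 0"
    using z norm_triangle_ineq2[of z "-1"] norm_triangle_ineq2[of z 1] norm_triangle_ineq2[of z "-\<i>"] norm_triangle_ineq2[of z "\<i>"]
    by (auto simp del: zero_less_norm_iff)
  have z0: "z \<noteq> 0" using z by auto
  have prod: "(z + 1) * (z - 1) * (z + \<i>) * (z - \<i>) = z^4 * (1 - inverse z ^ 4)"
    using z0 by (simp add: algebra_simps power4_eq_xxxx)
  have "ln (cmod (z + 1)) + ln (cmod (z - 1)) + ln (cmod (z + \<i>)) + ln (cmod (z - \<i>)) = ln (cmod ((z + 1) * (z - 1) * (z + \<i>) * (z - \<i>)))"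
    using ne by (simp add: norm_mult ln_mult)
  also have "\<dots> = ln (cmod z ^ 4 * cmod (1 - inverse z ^ 4))" unfolding prod by (simp add: norm_mult norm_power)
  also have "\<dots> = 4 * ln (cmod z) + ln (cmod (1 - inverse z ^ 4))"
  proof -
    have "z^4 * (1 - inverse z ^ 4) \<noteq> 0" unfolding prod[symmetric] using ne by auto
    then show ?thesis using z0 by (simp add: ln_mult ln_realpow)
  qed
  finally show ?thesis by (simp add: cavg_def)
qed

lemma log_approx_laplacian:
  assumes z: "cmod z \<ge> 2"
  shows "\<bar>cavg log_approx z - log_approx z\<bar> \<le> 40 * cmod (inverse z) ^ 6"
proof -
  define t where "t = inverse z"
  have t: "cmod t \<le> 1/2" unfolding t_def using cmod_inverse_le[OF z] by simp
  have "cmod t ^ 4 \<le> (1/2)^4" using t by (intro power_mono) auto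
  then have t4: "cmod (t ^ 4) \<le> 1/16" by (simp add: norm_power power_one_over)
  define D where "D = cavg (\<lambda>w. cnj w * inverse (w^3)) z - cnj z * inverse (z^3)"
  have "cavg log_approx z = cavg (\<lambda>w. ln (cmod w)) z - Re (cavg (\<lambda>w. cnj w * inverse (w^3)) z) / 12"
    by (simp add: log_approx_def cavg_def field_simps)
  then have e: "cavg log_approx z - log_approx z = ln (cmod (1 - t ^ 4)) / 4 - Re D / 12"
    unfolding cavg_ln_cmod[OF z] by (simp add: log_approx_def D_def t_def diff_divide_distrib)
  have "\<bar>Re (D + 3 * t^4)\<bar> \<le> 354 * cmod t ^ 6"
    using cavg_cnj_inverse_cube[OF z] abs_Re_le_cmod[of "D + 3 * t^4"] unfolding D_def t_def by linarith
  moreover have "Re (D + 3 * t^4) = Re D + 3 * Re (t^4)" by simp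
  moreover have "\<bar>ln (cmod (1 - t^4)) + Re (t^4)\<bar> \<le> 10 * cmod t ^ 8"
    using ln_cmod_1_minus_bound[OF t4] by (simp add: norm_power flip: power_mult)
  moreover have "cmod t ^ 8 \<le> cmod t ^ 6" using t by (intro power_decreasing) auto
  \<comment> \<open>The z^-4 parts cancel, and the remainders add up to 10/4 + 354/12 = 32, below
    40.\<close>
  ultimately show ?thesis unfolding e t_def[symmetric] by (simp only: abs_le_iff) linarith
qed

text \<open>A one-sided Taylor bound: multiplied by (1 + y)^2 the cubic falls short of 1 by y^4 (5 +
  4 y), which is nonnegative for |y| < 1. The odd terms drop out when opposite neighbours are
  averaged.\<close>

lemma inverse_square_convex:
  fixes s x :: real
  assumes "s > 0" "\<bar>x\<bar> < s"
  shows "inverse ((s + x)^2) \<ge> inverse (s^2) * (1 - 2 * (x / s) + 3 * (x / s)^2 - 4 * (x / s)^3)"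
proof -
  define y where "y = x / s"
  have y: "\<bar>y\<bar> < 1" "s + x = s * (1 + y)" using assms by (simp_all add: y_def field_simps)
  have "(1 + y)^2 * (1 - 2 * y + 3 * y^2 - 4 * y^3) = 1 - y^4 * (5 + 4 * y)"
    by (simp add: algebra_simps power2_eq_square power3_eq_cube power4_eq_xxxx)
  also have "\<dots> \<le> 1" using y by simp
  finally have "1 - 2 * y + 3 * y^2 - 4 * y^3 \<le> inverse ((1 + y)^2)"
    using y by (simp add: field_simps)
  then have "inverse (s^2) * (1 - 2 * y + 3 * y^2 - 4 * y^3) \<le> inverse (s^2) * inverse ((1 + y)^2)"
    by (intro mult_left_mono) auto
  then show ?thesis unfolding y by (simp add: y_def power_mult_distrib)
qed

text \<open>A quarter of the continuum Laplacian of |z|^-4 is 4 |z|^-6; the coefficient 3 gives room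
  for the lower-order terms once |z| >= 6.\<close>

lemma cavg_inverse_quartic:
  assumes z: "cmod z \<ge> 6"
  shows "cavg (\<lambda>w. inverse (cmod w ^ 4)) z \<ge> cmod (inverse z) ^ 4 + 3 * cmod (inverse z) ^ 6"
proof -
  obtain p q where pq: "z = Complex p q" by (cases z)
  define R where "R = p^2 + q^2"
  define s where "s = R + 1"
  have Rz: "R = cmod z ^ 2" by (simp add: pq R_def cmod_power2)
  have R: "R \<ge> 36" unfolding Rz using z power_mono[of 6 "cmod z" 2] by simp
  have s0: "s > 0" using R by (simp add: s_def)
  have quart: "inverse (cmod w ^ 4) = inverse ((cmod w ^ 2)^2)" for w by (simp flip: power_mult)
  have e: "cmod (z + 1) ^ 2 = s + 2 * p" "cmod (z - 1) ^ 2 = s + (- 2 * p)"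
    "cmod (z + \<i>) ^ 2 = s + 2 * q" "cmod (z - \<i>) ^ 2 = s + (- 2 * q)"
    by (simp_all add: pq cmod_power2 s_def R_def, simp_all add: power2_eq_square algebra_simps)
  have lt: "\<bar>2 * p\<bar> < s" "\<bar>2 * q\<bar> < s"
  proof -
    have "\<bar>p\<bar> \<le> cmod z" "\<bar>q\<bar> \<le> cmod z" using abs_Re_le_cmod[of z] abs_Im_le_cmod[of z] by (simp_all add: pq)
    moreover have "2 * cmod z < s" using z unfolding s_def Rz power2_eq_square
      using mult_mono[of 6 "cmod z" "cmod z" "cmod z"] by simp
    ultimately show "\<bar>2 * p\<bar> < s" "\<bar>2 * q\<bar> < s" by linarith+
  qed
  define T where "T x = inverse (s^2) * (1 - 2 * (x / s) + 3 * (x / s)^2 - 4 * (x / s)^3)" for x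
  have T: "inverse ((s + x)^2) \<ge> T x" if "\<bar>x\<bar> < s" for x
    unfolding T_def by (rule inverse_square_convex[OF s0 that])
  have "(T (2 * p) + T (- 2 * p) + T (2 * q) + T (- 2 * q)) / 4 = inverse (s^2) * (1 + 6 * R / s^2)"
  proof -
    define P Q i where "P = 2 * p / s" and "Q = 2 * q / s" and "i = inverse (s^2)"
    have pq': "2 * p / s = P" "- 2 * p / s = - P" "2 * q / s = Q" "- 2 * q / s = - Q" by (simp_all add: P_def Q_def)
    have "(T (2 * p) + T (- 2 * p) + T (2 * q) + T (- 2 * q)) / 4 = i * (1 + 3 * (P^2 + Q^2) / 2)"
      unfolding T_def pq' i_def[symmetric] by (simp add: algebra_simps)
    also have "3 * (P^2 + Q^2) / 2 = 6 * R / s^2"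
      using s0 by (simp add: P_def Q_def R_def power_divide field_simps)
    finally show ?thesis by (simp add: i_def)
  qed
  moreover have "cavg (\<lambda>w. inverse (cmod w ^ 4)) z \<ge> (T (2 * p) + T (- 2 * p) + T (2 * q) + T (- 2 * q)) / 4"
    unfolding cavg_def quart e using T[of "2 * p"] T[of "- 2 * p"] T[of "2 * q"] T[of "- 2 * q"] lt
    by (intro divide_right_mono add_mono) auto
  moreover have "inverse (s^2) * (1 + 6 * R / s^2) \<ge> (R + 3) / R^3"
  proof -
    have R0: "R > 0" using R by simp
    \<comment> \<open>The difference of the two sides after clearing denominators; its leading
      coefficient 1 is the gap between 4 and 3.\<close>
    have "R^4 - 17 * R^3 - 22 * R^2 - 13 * R - 3 \<ge> 0"
    proof -
      have step: "36 * R ^ k \<le> R ^ Suc k" for k using R by (simp add: mult_right_mono)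
      have "36 * R \<le> R^2" using step[of 1] by (simp only: power_one_right Suc_1)
      moreover have "36 * R^2 \<le> R^3" "36 * R^3 \<le> R^4" using step[of 2] step[of 3] by simp_all
      ultimately show ?thesis using R by linarith
    qed
    then have "(R + 3) * s^4 \<le> R^3 * (s^2 + 6 * R)"
      by (simp add: s_def algebra_simps power2_eq_square power3_eq_cube power4_eq_xxxx)
    then have "(R + 3) / R^3 \<le> (s^2 + 6 * R) / s^4" using R0 s0 by (simp add: field_simps)
    also have "\<dots> = inverse (s^2) * (1 + 6 * R / s^2)" using s0 by (simp add: field_simps power2_eq_square power4_eq_xxxx)
    finally show ?thesis .
  qed
  moreover have "(R + 3) / R^3 = cmod (inverse z) ^ 4 + 3 * cmod (inverse z) ^ 6"
  proof -
    have z0: "cmod z > 0" using z by linarith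
    show ?thesis unfolding Rz norm_inverse using z0 by (simp add: field_simps flip: power_mult)
  qed
  ultimately show ?thesis by linarith
qed

text \<open>In the cone of the points with \<open>\<bar>Im z\<bar> \<le> Re z\<close> the leading term, harmonic up to lower
  order, vanishes on the boundary; the other two terms make the function strictly superharmonic
  and of order \<open>\<bar>z\<bar> ^ (-4)\<close> on the boundary.\<close>

definition barrier :: "complex \<Rightarrow> real" where
  "barrier z = Re (inverse (z^2)) - 30 * Re (inverse (z^4)) - 15 * inverse (cmod z ^ 4)"

text \<open>The constants of \<open>barrier\<close> are tuned here. The weight 15 contributes at
  most -45 |z|^-6, which absorbs the error 28 |z|^-6 of Re (z^-2). The weight 30 costs 30 * 1552
  |z|^-8, little more than |z|^-6 for |z| >= 199; it exceeds 15 so that the barrier is positive on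
  the diagonals, where Re (z^-4) = -|z|^-4.\<close>

lemma barrier_laplacian:
  assumes z: "cmod z \<ge> 199"
  shows "cavg barrier z - barrier z \<le> - 2 * cmod (inverse z) ^ 6"
proof -
  define t where "t = inverse z"
  have z2: "cmod z \<ge> 2" and z6: "cmod z \<ge> 6" using z by auto
  have t: "cmod t \<le> 1/199" unfolding t_def using cmod_inverse_le[OF z] by simp
  have 2: "\<bar>Re (cavg (\<lambda>w. inverse (w^2)) z - inverse (z^2))\<bar> \<le> 28 * cmod t ^ 6"
    using cavg_inverse_power(1)[OF z2 inverse_power2_remainder] abs_Re_le_cmod order_trans unfolding t_def by fastforce
  have 4: "\<bar>Re (cavg (\<lambda>w. inverse (w^4)) z - inverse (z^4))\<bar> \<le> 1552 * cmod t ^ 8"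
    using cavg_inverse_power(1)[OF z2 inverse_power4_remainder] abs_Re_le_cmod order_trans unfolding t_def by fastforce
  have 3: "cavg (\<lambda>w. inverse (cmod w ^ 4)) z \<ge> inverse (cmod z ^ 4) + 3 * cmod t ^ 6"
    using cavg_inverse_quartic[OF z6] by (simp add: t_def norm_inverse power_inverse)
  have "cmod t ^ 2 \<le> (1/199)^2" using t by (intro power_mono) auto
  then have "cmod t ^ 2 * cmod t ^ 6 \<le> (1/199)^2 * cmod t ^ 6" by (intro mult_right_mono) auto
  then have 8: "cmod t ^ 8 \<le> (1/39601) * cmod t ^ 6" by (simp add: power_divide flip: power_add)
  have "cavg barrier z - barrier z = Re (cavg (\<lambda>w. inverse (w^2)) z - inverse (z^2)) - 30 * Re (cavg (\<lambda>w. inverse (w^4)) z - inverse (z^4))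
     - 15 * (cavg (\<lambda>w. inverse (cmod w ^ 4)) z - inverse (cmod z ^ 4))"
  proof -
    have lin: "cavg (\<lambda>w. f w - 30 * g w - 15 * k w) z = cavg f z - 30 * cavg g z - 15 * cavg k z"
      for f g k :: "complex \<Rightarrow> real"
      by (simp add: cavg_def field_simps)
    have "cavg barrier z = cavg (\<lambda>w. Re (inverse (w^2)) - 30 * Re (inverse (w^4)) - 15 * inverse (cmod w ^ 4)) z"
      by (simp add: cavg_def barrier_def)
    then show ?thesis unfolding lin cavg_Re by (simp add: barrier_def)
  qed
  also have "\<dots> \<le> 28 * cmod t ^ 6 + 30 * (1552 * cmod t ^ 8) - 15 * (3 * cmod t ^ 6)"
  proof -
    have "x - 30 * y - 15 * v \<le> a + 30 * b - 15 * c" if "\<bar>x\<bar> \<le> a" "\<bar>y\<bar> \<le> b" "c \<le> v" for x y v a b c :: real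
      using that by linarith
    from this[OF 2 4, of "3 * cmod t ^ 6"] 3 show ?thesis by (simp only: le_diff_eq add.commute)
  qed
  also have "\<dots> \<le> - 2 * cmod t ^ 6" using 8 zero_le_power[OF norm_ge_zero[of t], of 6] by linarith
  finally show ?thesis by (simp add: t_def)
qed

text \<open>In polar form u is the cosine of twice the argument, and the double-angle formula turns
  -30 (2 u^2 - 1) - 15 into 15 (1 - 4 u^2).\<close>

lemma barrier_eq:
  assumes "z \<noteq> 0"
  shows "barrier z = (let r = cmod z; u = (Re z ^ 2 - Im z ^ 2) / r ^ 2 in u / r^2 + 15 * (1 - 4 * u^2) / r^4)"
proof -
  obtain p q where pq: "z = Complex p q" by (cases z)
  define R where "R = p^2 + q^2"
  have R: "R > 0" using assms unfolding R_def pq by (simp add: complex_eq_iff sum_power2_gt_zero_iff)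
  have r2: "cmod z ^ 2 = R" by (simp add: pq R_def cmod_power2)
  have r4: "cmod z ^ 4 = R ^ 2" unfolding r2[symmetric] by (simp flip: power_mult)
  define A B where "A = p^2 - q^2" and "B = 2 * p * q"
  have AB: "A^2 + B^2 = R^2" by (simp add: A_def B_def R_def power2_eq_square algebra_simps)
  have z2: "Re (z^2) = A" "Im (z^2) = B" by (simp_all add: pq A_def B_def Re_power2 Im_power2)
  have a: "Re (inverse (z^2)) = A / R^2"
    by (simp only: inverse_complex.sel z2 AB)
  have "z^4 = (z^2)^2" by (simp flip: power_mult)
  then have z4: "Re (z^4) = A^2 - B^2" "Im (z^4) = 2 * A * B"
    using Re_power2[of "z^2"] Im_power2[of "z^2"] unfolding z2 by simp_all
  have "(A^2 - B^2)^2 + (2 * A * B)^2 = (A^2 + B^2)^2" by (simp add: power2_eq_square algebra_simps)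
  also have "\<dots> = R^4" unfolding AB by (simp flip: power_mult)
  finally have d: "(A^2 - B^2)^2 + (2 * A * B)^2 = R^4" .
  have "Re (inverse (z^4)) = (A^2 - B^2) / R^4"
    by (simp only: inverse_complex.sel z4 d)
  also have "A^2 - B^2 = 2 * A^2 - R^2" using AB by simp
  finally have b: "Re (inverse (z^4)) = (2 * A^2 - R^2) / R^4" .
  have u: "Re z ^ 2 - Im z ^ 2 = A" by (simp add: pq A_def)
  have "A / R^2 - 30 * ((2 * A^2 - R^2) / R^4) - 15 * inverse (R^2) = A / R / R + 15 * (1 - 4 * (A / R)^2) / R^2"
    using R by (simp add: field_simps power2_eq_square power4_eq_xxxx)
  then show ?thesis unfolding barrier_def a b r4 Let_def r2 u .
qed

lemma barrier_pos:
  assumes r: "cmod z \<ge> 8" and c: "\<bar>Im z\<bar> \<le> Re z"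
  shows "barrier z > 0" and "barrier z \<le> 16 * inverse (cmod z ^ 2)"
proof -
  have z0: "z \<noteq> 0" using r by auto
  define R u where "R = cmod z ^ 2" and "u = (Re z ^ 2 - Im z ^ 2) / R"
  have R: "R \<ge> 64" unfolding R_def using r power_mono[of 8 "cmod z" 2] by simp
  have b: "barrier z = u / R + 15 * (1 - 4 * u^2) / R^2"
    unfolding barrier_eq[OF z0] Let_def R_def u_def by (simp flip: power_mult)
  have "Im z ^ 2 \<le> Re z ^ 2" using c by (intro abs_le_square_iff[THEN iffD1]) simp
  then have u0: "u \<ge> 0" unfolding u_def using R by simp
  have u1: "u \<le> 1" unfolding u_def using R by (simp add: R_def cmod_power2)
  \<comment> \<open>Near the sides, u < 1/2, the second term is positive. Away from them the first
    dominates, since R >= 64 and u^2 <= u give u R >= 60 u^2.\<close>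
  have num: "u * R + 15 * (1 - 4 * u^2) > 0"
  proof (cases "u < 1/2")
    case True
    have "u^2 < (1/2)^2" using True u0 by (intro power_strict_mono) auto
    then have "1 - 4 * u^2 > 0" by (simp add: power2_eq_square)
    moreover have "u * R \<ge> 0" using u0 R by simp
    ultimately show ?thesis by simp
  next
    case False
    have "u^2 \<le> u * 1" unfolding power2_eq_square using u0 u1 by (intro mult_left_mono) auto
    moreover have "u * 64 \<le> u * R" using u0 R by (intro mult_left_mono) auto
    moreover have "u * R + 15 * (1 - 4 * u^2) = u * R + 15 - 60 * u^2" by simp
    ultimately show ?thesis using False by linarith
  qed
  have "barrier z = (u * R + 15 * (1 - 4 * u^2)) / R^2" unfolding b using R by (simp add: field_simps power2_eq_square)
  then show "barrier z > 0" using num R by simp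
  have "15 * (1 - 4 * u^2) / R^2 \<le> 15 / R^2" by (intro divide_right_mono) auto
  also have "\<dots> \<le> 15 / R" using R by (intro divide_left_mono) (auto simp: power2_eq_square)
  finally have "barrier z \<le> 1 / R + 15 / R" unfolding b using u1 R by (intro add_mono divide_right_mono) auto
  then show "barrier z \<le> 16 * inverse (cmod z ^ 2)" by (simp add: R_def field_simps)
qed

lemma barrier_diag: "z \<noteq> 0 \<Longrightarrow> \<bar>Im z\<bar> = \<bar>Re z\<bar> \<Longrightarrow> barrier z = 15 / cmod z ^ 4"
proof -
  assume "z \<noteq> 0" "\<bar>Im z\<bar> = \<bar>Re z\<bar>"
  then have "Re z ^ 2 - Im z ^ 2 = 0" by (metis power2_abs diff_self)
  then show ?thesis using barrier_eq[OF \<open>z \<noteq> 0\<close>] by (simp add: Let_def)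
qed

section \<open>Asymptotics of the potential kernel\<close>

text \<open>The telescoping majorant gives |X n - X m| <= c n - c m for large n <= m; letting m tend
  to infinity yields both the limit and the rate.\<close>

lemma tendsto_with_telescoping_rate:
  fixes X c :: "nat \<Rightarrow> real"
  assumes ev: "\<forall>\<^sub>F n in sequentially. \<bar>X (Suc n) - X n\<bar> \<le> c n - c (Suc n)" and c: "c \<longlonglongrightarrow> 0"
  shows "\<exists>L. X \<longlonglongrightarrow> L \<and> (\<forall>\<^sub>F n in sequentially. \<bar>X n - L\<bar> \<le> c n)"
proof -
  obtain N where N: "\<And>n. n \<ge> N \<Longrightarrow> \<bar>X (Suc n) - X n\<bar> \<le> c n - c (Suc n)"
    using ev by (auto simp: eventually_sequentially)
  have step: "\<bar>X m - X n\<bar> \<le> c n - c m" if "n \<ge> N" "m \<ge> n" for m n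
    using that(2)
  proof (induction m rule: dec_induct)
    case (step k)
    then show ?case using N[of k] that(1) by linarith
  qed simp
  have "summable (\<lambda>n. X (Suc n) - X n)"
    by (rule summable_comparison_test_ev[OF _ telescope_summable'[OF c]]) (use ev in simp)
  then have "convergent (\<lambda>n. X n - X 0)" unfolding summable_iff_convergent sum_lessThan_telescope .
  then obtain L where "(\<lambda>n. X n - X 0) \<longlonglongrightarrow> L - X 0" by (metis add_diff_cancel_right' convergent_def)
  from tendsto_add[OF this tendsto_const[of "X 0"]] have L: "X \<longlonglongrightarrow> L" by simp
  have "\<bar>X n - L\<bar> \<le> c n" if n: "n \<ge> N" for n
  proof (rule tendsto_le)
    show "(\<lambda>m. \<bar>X n - X m\<bar>) \<longlonglongrightarrow> \<bar>X n - L\<bar>" by (intro tendsto_intros L)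
    show "(\<lambda>m. c n - c m) \<longlonglongrightarrow> c n" using tendsto_diff[OF tendsto_const c, of "c n"] by simp
    show "\<forall>\<^sub>F m in sequentially. \<bar>X n - X m\<bar> \<le> c n - c m"
      using eventually_ge_at_top[of n] by eventually_elim (use step[of n] n in \<open>simp add: abs_minus_commute\<close>)
  qed simp
  then show ?thesis using L by (auto simp: eventually_sequentially)
qed

text \<open>The term 1 / (24 n^2) is the next term in the expansion of the odd harmonic sum. It
  coincides with the correction in \<open>log_approx\<close> at (n, n), see
  \<open>log_approx_diag\<close>, so on the diagonal only an error of order n^-4 remains, the size
  of the barrier there.\<close>

definition diag_corr :: "nat \<Rightarrow> real" where
  "diag_corr n = pi / 2 * diag n - ln (real n) - 1 / (24 * real n ^ 2)"

lemma diag_corr_limit: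
  "\<exists>L. diag_corr \<longlonglongrightarrow> L \<and> (\<forall>\<^sub>F n in sequentially. \<bar>diag_corr n - L\<bar> \<le> 1 / real n ^ 4)"
proof (rule tendsto_with_telescoping_rate)
  have d: "diag_corr (Suc n) - diag_corr n = 2 / (2 * real n + 1) - ln (real n + 1) + ln (real n)
      - 1 / (24 * (real n + 1) ^ 2) + 1 / (24 * real n ^ 2)" for n
  proof -
    have "pi / 2 * diag (Suc n) = pi / 2 * diag n + 2 / (2 * real n + 1)"
    proof -
      have "pi / 2 * diag m = 2 * (\<Sum>j<m. 1 / (2 * real j + 1))" for m by (simp add: diag_def)
      then show ?thesis by (simp only: sum.lessThan_Suc distrib_left)
    qed
    then show ?thesis unfolding diag_corr_def of_nat_Suc by (simp only: add.commute[of 1])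
  qed
  have 1: "\<forall>\<^sub>F n in sequentially. 2 / (2 * real n + 1) - ln (real n + 1) + ln (real n)
      - 1 / (24 * (real n + 1) ^ 2) + 1 / (24 * real n ^ 2) \<le> 1 / real n ^ 4 - 1 / (real n + 1) ^ 4"
    by real_asymp
  have 2: "\<forall>\<^sub>F n in sequentially. - (2 / (2 * real n + 1) - ln (real n + 1) + ln (real n)
      - 1 / (24 * (real n + 1) ^ 2) + 1 / (24 * real n ^ 2)) \<le> 1 / real n ^ 4 - 1 / (real n + 1) ^ 4"
    by real_asymp
  show "\<forall>\<^sub>F n in sequentially. \<bar>diag_corr (Suc n) - diag_corr n\<bar> \<le> 1 / real n ^ 4 - 1 / real (Suc n) ^ 4"
    using 1 2 by eventually_elim (simp only: d abs_le_iff of_nat_Suc add.commute[of 1])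
  show "(\<lambda>n. 1 / real n ^ 4) \<longlonglongrightarrow> 0" by real_asymp
qed

lemma diag_sublinear: "(\<lambda>n. diag n / real n) \<longlonglongrightarrow> 0"
proof -
  obtain L where L: "diag_corr \<longlonglongrightarrow> L" using diag_corr_limit by blast
  have 1: "(\<lambda>n. 1 / real n) \<longlonglongrightarrow> 0" by real_asymp
  have 2: "(\<lambda>n. (ln (real n) + 1 / (24 * real n ^ 2)) / real n) \<longlonglongrightarrow> 0" by real_asymp
  have "(\<lambda>n. 2 / pi * (diag_corr n * (1 / real n) + (ln (real n) + 1 / (24 * real n ^ 2)) / real n)) \<longlonglongrightarrow> 2 / pi * (L * 0 + 0)"
    by (intro tendsto_intros L 1 2)
  also have "(\<lambda>n. 2 / pi * (diag_corr n * (1 / real n) + (ln (real n) + 1 / (24 * real n ^ 2)) / real n)) = (\<lambda>n. diag n / real n)"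
  proof
    show "2 / pi * (diag_corr n * (1 / real n) + (ln (real n) + 1 / (24 * real n ^ 2)) / real n) = diag n / real n" for n
      by (cases "n = 0") (simp_all add: diag_corr_def field_simps)
  qed
  finally show ?thesis by simp
qed

lemma abs_coord_le_znorm: "\<bar>of_int (fst p)\<bar> \<le> znorm p" "\<bar>of_int (snd p)\<bar> \<le> znorm p"
  using abs_Re_le_cmod[of "cpt p"] abs_Im_le_cmod[of "cpt p"] by (simp_all add: cmod_cpt, simp_all add: cpt_def)

lemma znorm_le_coords: "znorm p \<le> \<bar>of_int (fst p)\<bar> + \<bar>of_int (snd p)\<bar>"
  using cmod_le[of "cpt p"] by (simp add: cmod_cpt) (simp add: cpt_def)

lemma znorm_ge_1: "p \<noteq> 0 \<Longrightarrow> znorm p \<ge> 1"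
proof -
  assume "p \<noteq> 0"
  then have "\<bar>fst p\<bar> \<ge> 1 \<or> \<bar>snd p\<bar> \<ge> 1" by (cases p) (auto simp: zero_prod_def)
  then have "\<bar>real_of_int (fst p)\<bar> \<ge> 1 \<or> \<bar>real_of_int (snd p)\<bar> \<ge> 1" by linarith
  then show ?thesis using abs_coord_le_znorm[of p] by linarith
qed

lemma finite_znorm_le: "finite {p. znorm p \<le> R}"
proof (rule finite_subset)
  show "{p. znorm p \<le> R} \<subseteq> {- \<lceil>R\<rceil>..\<lceil>R\<rceil>} \<times> {- \<lceil>R\<rceil>..\<lceil>R\<rceil>}"
  proof
    fix p assume "p \<in> {p. znorm p \<le> R}"
    then have "\<bar>real_of_int (fst p)\<bar> \<le> R" "\<bar>real_of_int (snd p)\<bar> \<le> R" using abs_coord_le_znorm[of p] by auto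
    then have "\<bar>fst p\<bar> \<le> \<lceil>R\<rceil>" "\<bar>snd p\<bar> \<le> \<lceil>R\<rceil>" by linarith+
    then show "p \<in> {- \<lceil>R\<rceil>..\<lceil>R\<rceil>} \<times> {- \<lceil>R\<rceil>..\<lceil>R\<rceil>}" by (cases p) auto
  qed
qed auto

lemma znorm_at_top: "filterlim znorm at_top cofinite"
proof -
  have "finite {x. \<not> Z \<le> znorm x}" for Z by (rule finite_subset[OF _ finite_znorm_le[of Z]]) auto
  then show ?thesis by (simp add: filterlim_at_top eventually_cofinite)
qed

section \<open>Sublinear growth at infinity\<close>

abbreviation sublinear :: "(pt \<Rightarrow> real) \<Rightarrow> bool" where
  "sublinear u \<equiv> u \<in> o[cofinite](znorm)"

lemma sublinearI:
  assumes "\<forall>\<^sub>F x in cofinite. \<bar>u x\<bar> \<le> g (znorm x)" and "((\<lambda>r. g r / r) \<longlongrightarrow> 0) at_top"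
  shows "sublinear u"
proof (rule smalloI_tendsto)
  have z: "\<forall>\<^sub>F x in cofinite. 1 \<le> znorm x" using znorm_at_top unfolding filterlim_at_top by blast
  then show "\<forall>\<^sub>F x in cofinite. znorm x \<noteq> 0" by eventually_elim auto
  have "\<forall>\<^sub>F x in cofinite. norm (u x / znorm x) \<le> g (znorm x) / znorm x"
    using assms(1) z by eventually_elim (simp add: divide_right_mono)
  then show "((\<lambda>x. u x / znorm x) \<longlongrightarrow> 0) cofinite"
    by (rule Lim_null_comparison) (rule filterlim_compose[OF assms(2) znorm_at_top])
qed

lemma sublinear_bounded:
  assumes "\<And>x. \<bar>u x\<bar> \<le> B"
  shows "sublinear u"
  by (rule sublinearI[where g = "\<lambda>_. B"]) (use assms in \<open>auto, real_asymp\<close>)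

lemma sublinear_pot: "sublinear pot"
proof (rule sublinearI)
  define N where "N r = nat \<lceil>2 * r\<rceil> + 1" for r :: real
  show "\<forall>\<^sub>F x in cofinite. \<bar>pot x\<bar> \<le> 2 * diag (N (znorm x))"
  proof (intro always_eventually allI)
    fix x
    have "real_of_int (\<bar>fst x\<bar> + \<bar>snd x\<bar>) \<le> 2 * znorm x" using abs_coord_le_znorm[of x] by simp
    then have "nat (\<bar>fst x\<bar> + \<bar>snd x\<bar> + 1) \<le> N (znorm x)" unfolding N_def by linarith
    then show "\<bar>pot x\<bar> \<le> 2 * diag (N (znorm x))"
      using pot_le_diag[of x] diag_mono pot_nonneg[of x] by fastforce
  qed
  have "filterlim N at_top at_top"
    unfolding filterlim_at_top
  proof
    show "\<forall>\<^sub>F r in at_top. Z \<le> N r" for Z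
      using eventually_ge_at_top[of "real Z"] by eventually_elim (unfold N_def, linarith)
  qed
  then have "((\<lambda>r. 8 * (diag (N r) / real (N r))) \<longlongrightarrow> 8 * 0) at_top"
    by (intro tendsto_mult tendsto_const filterlim_compose[OF diag_sublinear])
  moreover have "\<forall>\<^sub>F r in at_top. norm (2 * diag (N r) / r) \<le> 8 * (diag (N r) / real (N r))"
    using eventually_ge_at_top[of 1]
  proof eventually_elim
    case (elim r)
    have d: "diag (N r) \<ge> 0" using diag_mono[of 0 "N r"] by (simp add: diag_def)
    have "real (N r) \<le> 4 * r" "real (N r) > 0" unfolding N_def using elim by linarith+
    then have "diag (N r) / r \<le> diag (N r) / (real (N r) / 4)" using d elim by (intro divide_left_mono) auto
    then show ?case using d elim by simp
  qed
  ultimately show "((\<lambda>r. 2 * diag (N r) / r) \<longlongrightarrow> 0) at_top" by (simp add: Lim_null_comparison)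
qed

lemma znorm_nbr: "y \<in> nbrs x \<Longrightarrow> \<bar>znorm y - znorm x\<bar> \<le> 1"
proof -
  assume "y \<in> nbrs x"
  then have "cpt y - cpt x \<in> {1, -1, \<i>, -\<i>}" by (auto simp: nbrs_def cpt_def complex_eq_iff)
  then have "cmod (cpt y - cpt x) = 1" by auto
  then show ?thesis using norm_triangle_ineq3[of "cpt y" "cpt x"] by (simp add: cmod_cpt)
qed

lemma cofinite_le_imp_le_plus_const:
  fixes f g :: "'a \<Rightarrow> real"
  assumes "\<forall>\<^sub>F x in cofinite. f x \<le> g x"
  shows "\<exists>C\<ge>0. \<forall>x. f x \<le> g x + C"
proof -
  define F where "F = {x. \<not> f x \<le> g x}"
  have fin: "finite F" using assms by (simp add: F_def eventually_cofinite)
  have "f x \<le> g x + (\<Sum>y\<in>F. \<bar>f y - g y\<bar>)" for x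
  proof (cases "x \<in> F")
    case True
    then have "\<bar>f x - g x\<bar> \<le> (\<Sum>y\<in>F. \<bar>f y - g y\<bar>)" using fin by (intro member_le_sum) auto
    then show ?thesis by linarith
  next
    case False
    moreover have "(\<Sum>y\<in>F. \<bar>f y - g y\<bar>) \<ge> 0" by (intro sum_nonneg) auto
    ultimately show ?thesis by (simp add: F_def)
  qed
  then show ?thesis by (intro exI[of _ "\<Sum>y\<in>F. \<bar>f y - g y\<bar>"]) (auto intro: sum_nonneg)
qed

section \<open>Comparison in the cone between the diagonals\<close>

definition cone :: "pt set" where
  "cone = {p. \<bar>snd p\<bar> < fst p}"

definition closed_cone :: "pt set" where
  "closed_cone = {p. \<bar>snd p\<bar> \<le> fst p}"

text \<open>A step from the open cone never jumps across a diagonal, so the lateral boundary values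
  of the comparison lie exactly where the kernel is known.\<close>

lemma nbr_cone: "p \<in> cone \<Longrightarrow> y \<in> nbrs p \<Longrightarrow> y \<in> closed_cone"
  by (auto simp: cone_def closed_cone_def nbrs_def)

lemma closed_cone_fst: "p \<in> closed_cone \<Longrightarrow> znorm p \<le> 2 * of_int (fst p) \<and> of_int (fst p) \<ge> (0::real)"
  using znorm_le_coords[of p] by (auto simp: closed_cone_def)

lemma closed_cone_cpt: "p \<in> closed_cone \<Longrightarrow> \<bar>Im (cpt p)\<bar> \<le> Re (cpt p)"
  by (auto simp: closed_cone_def cpt_def)

lemma log_approx_growth: "z \<noteq> 0 \<Longrightarrow> cmod z \<ge> 1 \<Longrightarrow> \<bar>log_approx z\<bar> \<le> ln (cmod z) + 1"
proof -
  assume z: "z \<noteq> 0" "cmod z \<ge> 1"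
  have "\<bar>Re (cnj z * inverse (z^3))\<bar> \<le> cmod (cnj z * inverse (z^3))" by (rule abs_Re_le_cmod)
  also have "\<dots> = inverse (cmod z ^ 2)"
    using z by (simp add: norm_mult norm_inverse norm_power norm_divide field_simps eval_nat_numeral)
  also have "\<dots> \<le> 1" using z by (simp add: field_simps)
  finally have "\<bar>Re (cnj z * inverse (z^3))\<bar> \<le> 1" .
  moreover have "ln (cmod z) \<ge> 0" using z by simp
  ultimately show ?thesis unfolding log_approx_def by linarith
qed

lemma log_approx_diag:
  assumes "n > 0"
  shows "log_approx (Complex (real n) (real n)) = ln (real n) + ln 2 / 2 + 1 / (24 * real n ^ 2)"
proof -
  define z where "z = Complex (real n) (real n)"
  have z: "z = of_nat n * (1 + \<i>)" by (simp add: z_def complex_eq_iff)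
  have "cmod z = real n * sqrt 2" by (simp add: z norm_mult cmod_def real_sqrt_mult)
  then have l: "ln (cmod z) = ln (real n) + ln 2 / 2" using assms by (simp add: ln_mult ln_sqrt)
  have "z^3 = of_nat n ^ 3 * (1 + \<i>)^3" by (simp add: z power_mult_distrib)
  also have "(1 + \<i>)^3 = -2 + 2 * \<i>" by (simp add: power3_eq_cube algebra_simps)
  finally have z3: "z^3 = of_nat n ^ 3 * (-2 + 2 * \<i>)" .
  have "cnj z = - (of_nat n * (-2 + 2 * \<i>)) / 2" by (simp add: z complex_eq_iff)
  then have "cnj z * inverse (z^3) = - (of_nat n * (-2 + 2 * \<i>)) / 2 * inverse (of_nat n ^ 3 * (-2 + 2 * \<i>))" unfolding z3 by simp
  also have "\<dots> = - 1 / (2 * of_nat n ^ 2)"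
  proof -
    have "(-2 + 2 * \<i>) \<noteq> 0" by (simp add: complex_eq_iff)
    then show ?thesis using assms by (simp add: field_simps eval_nat_numeral)
  qed
  also have "\<dots> = of_real (- 1 / (2 * real n ^ 2))" by simp
  finally have "Re (cnj z * inverse (z^3)) = - 1 / (2 * real n ^ 2)" by (metis Re_complex_of_real)
  then show ?thesis unfolding z_def[symmetric] log_approx_def l by simp
qed

lemma log_approx_mult_i: "log_approx (\<i> * z) = log_approx z"
proof -
  have "cnj (\<i> * z) * inverse ((\<i> * z)^3) = cnj z * inverse (z^3)"
    by (simp add: power_mult_distrib power3_eq_cube[of \<i>] field_simps)
  then show ?thesis by (simp add: log_approx_def norm_mult)
qed

lemma log_approx_cnj: "log_approx (cnj z) = log_approx z"
proof -
  have "cnj (cnj z) * inverse ((cnj z)^3) = cnj (cnj z * inverse (z^3))" by simp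
  then have "Re (cnj (cnj z) * inverse ((cnj z)^3)) = Re (cnj z * inverse (z^3))" by (metis cnj.sel(1))
  then show ?thesis by (simp add: log_approx_def)
qed

definition pot_error :: "real \<Rightarrow> pt \<Rightarrow> real" where
  "pot_error g p = pi / 2 * (pot p - g) - log_approx (cpt p)"

lemma pot_error_sym:
  "pot_error g (a, - b) = pot_error g (a, b)" "pot_error g (- a, b) = pot_error g (a, b)"
  "pot_error g (b, a) = pot_error g (a, b)"
proof -
  have 1: "cpt (a, - b) = cnj (cpt (a, b))" for a b by (simp add: cpt_def complex_eq_iff)
  have 2: "cpt (- b, a) = \<i> * cpt (a, b)" for a b by (simp add: cpt_def complex_eq_iff)
  have s: "pot_error g (a, - b) = pot_error g (a, b)" for a b
    by (simp add: pot_error_def pot_neg_snd 1 log_approx_cnj)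
  have t: "pot_error g (- b, a) = pot_error g (a, b)" for a b
    by (simp add: pot_error_def pot_neg_fst pot_swap[of b a] 2 log_approx_mult_i)
  show "pot_error g (a, - b) = pot_error g (a, b)" by (rule s)
  show "pot_error g (b, a) = pot_error g (a, b)" using t[of "- b" a] s by simp
  show "pot_error g (- a, b) = pot_error g (a, b)" using t[of a b] t[of "- b" a] s[of b a] s[of a b] by simp
qed

lemma pot_error_diag:
  "\<exists>g K. \<forall>p. \<bar>snd p\<bar> = fst p \<longrightarrow> p \<noteq> 0 \<longrightarrow> \<bar>pot_error g p\<bar> \<le> K * barrier (cpt p)"
proof -
  obtain L where L: "\<forall>\<^sub>F n in sequentially. \<bar>diag_corr n - L\<bar> \<le> 1 / real n ^ 4" using diag_corr_limit by blast
  \<comment> \<open>Chosen to absorb both the limit \<open>L\<close> and the logarithm of the factor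
    sqrt 2 in the norm of (n, n).\<close>
  define g where "g = 2 / pi * (L - ln 2 / 2)"
  have e: "pot_error g (int n, int n) = diag_corr n - L" if "n > 0" for n
  proof -
    have "cpt (int n, int n) = Complex (real n) (real n)" by (simp add: cpt_def)
    then show ?thesis using that
      by (simp add: pot_error_def pot_diag log_approx_diag diag_corr_def g_def algebra_simps)
  qed
  \<comment> \<open>The rate holds only eventually; boundedness of this sequence extends it to all n
    > 0 at the price of a constant.\<close>
  define X where "X n = (diag_corr n - L) * real n ^ 4" for n
  have "\<forall>\<^sub>F n in sequentially. norm (X n) \<le> norm (1::real)"
    using L eventually_gt_at_top[of 0] by eventually_elim (simp add: X_def abs_mult pos_le_divide_eq)
  then have "Bseq X" by (rule Bseq_eventually_mono) simp
  then obtain B where B: "B > 0" "\<And>n. \<bar>X n\<bar> \<le> B" by (auto elim: BseqE)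
  \<comment> \<open>At (n, n) and (n, -n) the barrier equals 15 / |z|^4 = 15 / (4 n^4).\<close>
  have "\<bar>pot_error g p\<bar> \<le> (4 * B / 15) * barrier (cpt p)" if p: "\<bar>snd p\<bar> = fst p" "p \<noteq> 0" for p
  proof -
    define n where "n = nat (fst p)"
    have n: "fst p = int n" using p by (simp add: n_def)
    then have sp: "snd p = int n \<or> snd p = - int n" using p by linarith
    have n0: "n > 0" using p n by (cases p) (auto simp: zero_prod_def)
    have pp: "p = (int n, int n) \<or> p = (int n, - int n)" using n sp by (cases p) auto
    then have "pot_error g p = pot_error g (int n, int n)" using pot_error_sym(1) by auto
    then have "\<bar>pot_error g p\<bar> = \<bar>X n\<bar> / real n ^ 4" using n0 by (simp add: e X_def abs_mult)
    also have "\<dots> \<le> B / real n ^ 4" using B(2)[of n] by (intro divide_right_mono) auto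
    also have "\<dots> = (4 * B / 15) * barrier (cpt p)"
    proof -
      have "cmod (cpt p) ^ 2 = 2 * real n ^ 2" using pp by (auto simp: cmod_power2 cpt_def)
      then have "(cmod (cpt p) ^ 2)^2 = (2 * real n ^ 2)^2" by simp
      then have c4: "cmod (cpt p) ^ 4 = 4 * real n ^ 4" by (simp add: power_mult_distrib flip: power_mult)
      have "barrier (cpt p) = 15 / cmod (cpt p) ^ 4"
        using pp p(2) by (intro barrier_diag) (auto, auto simp: cpt_def)
      then show ?thesis unfolding c4 using n0 by simp
    qed
    finally show ?thesis .
  qed
  then show ?thesis by blast
qed

text \<open>A Phragmen-Lindelof majorant: the first coordinate is harmonic and comparable to the
  norm in the cone, so it dominates any sublinear function with arbitrarily small slope.\<close>

lemma pot_error_growth: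
  assumes e: "d > 0"
  shows "\<exists>N. \<forall>p\<in>closed_cone. znorm p > N \<longrightarrow> \<bar>pot_error g p\<bar> \<le> d * of_int (fst p)"
proof -
  have "\<forall>\<^sub>F p in cofinite. p \<noteq> (0::pt)" by (simp add: eventually_cofinite)
  then have "\<forall>\<^sub>F p in cofinite. \<bar>log_approx (cpt p)\<bar> \<le> ln (znorm p) + 1"
    by eventually_elim (metis log_approx_growth cmod_cpt cpt_eq_0_iff znorm_ge_1)
  then have "sublinear (\<lambda>p. log_approx (cpt p))" by (rule sublinearI) real_asymp
  moreover have "sublinear (\<lambda>p. pi / 2 * (pot p - g))"
    using sum_in_smallo(2)[OF sublinear_pot sublinear_bounded[of "\<lambda>_. g" "\<bar>g\<bar>"]]
    by (subst landau_o.small.cmult_in_iff) auto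
  ultimately have "sublinear (pot_error g)"
    unfolding pot_error_def[abs_def] by (intro sum_in_smallo)
  then have "\<forall>\<^sub>F p in cofinite. norm (pot_error g p) \<le> d / 4 * norm (znorm p)"
    using e by (intro landau_o.smallD) auto
  from cofinite_le_imp_le_plus_const[OF this]
  obtain C where C: "\<And>p. \<bar>pot_error g p\<bar> \<le> d / 4 * znorm p + C" by auto
  have "\<bar>pot_error g p\<bar> \<le> d * of_int (fst p)" if p: "p \<in> closed_cone" "znorm p > 4 * C / d" for p
  proof -
    have "C \<le> d / 4 * znorm p" using p(2) e by (simp add: field_simps)
    moreover have "d / 2 * znorm p \<le> d / 2 * (2 * of_int (fst p))"
      using closed_cone_fst[OF p(1)] e by (intro mult_left_mono) auto
    ultimately show ?thesis using C[of p] by simp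
  qed
  then show ?thesis by blast
qed

lemma pot_error_laplacian:
  assumes "znorm p \<ge> 2"
  shows "\<bar>avg (pot_error g) p - pot_error g p\<bar> \<le> 40 * cmod (inverse (cpt p)) ^ 6"
proof -
  have p0: "p \<noteq> 0" using assms by auto
  have "avg (pot_error g) p = avg (\<lambda>p. pi / 2 * (pot p - g) - log_approx (cpt p)) p"
    by (simp add: avg_expand pot_error_def)
  also have "\<dots> = pi / 2 * (avg pot p - g) - avg (\<lambda>p. log_approx (cpt p)) p"
    by (simp only: avg_linear)
  also have "\<dots> = pi / 2 * (pot p - g) - cavg log_approx (cpt p)"
    unfolding avg_cpt avg_pot_nonzero[OF p0] by simp
  finally have "avg (pot_error g) p - pot_error g p = - (cavg log_approx (cpt p) - log_approx (cpt p))"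
    by (simp add: pot_error_def)
  then show ?thesis using log_approx_laplacian[of "cpt p"] assms by (simp only: abs_minus_cancel cmod_cpt)
qed

lemma pot_error_cone:
  "\<exists>g K. \<forall>p\<in>closed_cone. znorm p \<ge> 200 \<longrightarrow> \<bar>pot_error g p\<bar> \<le> K / znorm p ^ 2"
proof -
  obtain g K1 where K1: "\<And>p. \<bar>snd p\<bar> = fst p \<Longrightarrow> p \<noteq> 0 \<Longrightarrow> \<bar>pot_error g p\<bar> \<le> K1 * barrier (cpt p)"
    using pot_error_diag by blast
  \<comment> \<open>The inner rim: points of the cone reached by one step inwards from the region of
    norm at least 200.\<close>
  define F where "F = {p \<in> closed_cone. 199 \<le> znorm p \<and> znorm p \<le> 200}"
  have "finite F" unfolding F_def by (rule finite_subset[OF _ finite_znorm_le[of 200]]) auto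
  have bpos: "barrier (cpt p) > 0" "barrier (cpt p) \<le> 16 / znorm p ^ 2" if "p \<in> closed_cone" "znorm p \<ge> 199" for p
    using barrier_pos[of "cpt p"] that closed_cone_cpt[of p] by (simp_all add: cmod_cpt divide_inverse)
  \<comment> \<open>Large enough for three tasks: 20 turns the Laplacian bound 2 of the barrier into
    the 40 of \<open>pot_error\<close>, \<open>K1\<close> serves the diagonals, and the sum serves
    the inner rim.\<close>
  define K where "K = 20 + \<bar>K1\<bar> + (\<Sum>p\<in>F. \<bar>pot_error g p\<bar> / barrier (cpt p))"
  have sum0: "(\<Sum>p\<in>F. \<bar>pot_error g p\<bar> / barrier (cpt p)) \<ge> 0"
    by (intro sum_nonneg) (auto simp: F_def intro!: divide_nonneg_nonneg less_imp_le[OF bpos(1)])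
  have K20: "K \<ge> 20" using sum0 by (simp add: K_def)
  have KK1: "K1 \<le> K" using sum0 by (simp add: K_def)
  have KF: "\<bar>pot_error g p\<bar> \<le> K * barrier (cpt p)" if p: "p \<in> F" for p
  proof -
    have b: "barrier (cpt p) > 0" using p bpos by (auto simp: F_def)
    have "\<bar>pot_error g p\<bar> / barrier (cpt p) \<le> (\<Sum>p\<in>F. \<bar>pot_error g p\<bar> / barrier (cpt p))"
      using \<open>finite F\<close> p by (intro member_le_sum) (auto simp: F_def intro!: divide_nonneg_nonneg less_imp_le[OF bpos(1)])
    also have "\<dots> \<le> K" by (simp add: K_def)
    finally show ?thesis using b by (simp add: field_simps)
  qed
  have diagK: "\<bar>pot_error g p\<bar> \<le> K * barrier (cpt p)" if p: "p \<in> closed_cone" "p \<notin> cone" "znorm p \<ge> 199" for p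
  proof -
    have "\<bar>snd p\<bar> = fst p" "p \<noteq> 0" using p by (auto simp: cone_def closed_cone_def)
    then have "\<bar>pot_error g p\<bar> \<le> K1 * barrier (cpt p)" using K1 by blast
    also have "\<dots> \<le> K * barrier (cpt p)" using KK1 bpos[OF p(1,3)] by (intro mult_right_mono) auto
    finally show ?thesis .
  qed
  have main: "\<bar>pot_error g p\<bar> \<le> K * barrier (cpt p) + d * of_int (fst p)"
    if d: "d > 0" and p: "p \<in> cone" "znorm p \<ge> 200" for d p
  proof -
    obtain N0 where N0: "\<And>p. p \<in> closed_cone \<Longrightarrow> znorm p > N0 \<Longrightarrow> \<bar>pot_error g p\<bar> \<le> d * of_int (fst p)"
      using pot_error_growth[OF d] by blast
    define N where "N = max N0 (znorm p)"
    define D where "D = {q \<in> cone. 200 \<le> znorm q \<and> znorm q \<le> N}"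
    show ?thesis
    proof (rule comparison_principle[where D = D])
      show "finite D" unfolding D_def by (rule finite_subset[OF _ finite_znorm_le[of N]]) auto
      show "p \<in> D" using p by (simp add: D_def N_def)
    next
      fix q assume "q \<in> D"
      then have zq: "znorm q \<ge> 200" by (simp add: D_def)
      define T where "T = cmod (inverse (cpt q)) ^ 6"
      have fst_h: "avg (\<lambda>q. of_int (fst q)) q = of_int (fst q)" by (simp add: avg_expand)
      have "2 * T \<le> barrier (cpt q) - cavg barrier (cpt q)"
        using barrier_laplacian[of "cpt q"] zq by (simp add: cmod_cpt T_def)
      then have "20 * (2 * T) \<le> K * (barrier (cpt q) - cavg barrier (cpt q))"
        using K20 by (intro mult_mono) (auto simp: T_def)
      then show "\<bar>avg (pot_error g) q - pot_error g q\<bar> \<le> (K * barrier (cpt q) + d * of_int (fst q))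
          - avg (\<lambda>q. K * barrier (cpt q) + d * of_int (fst q)) q"
        using pot_error_laplacian[of q g] zq by (simp add: avg_linear avg_cpt fst_h T_def right_diff_distrib)
    next
      fix q y assume q: "q \<in> D" and y: "y \<in> nbrs q" "y \<notin> D"
      have yc: "y \<in> closed_cone" using nbr_cone[of q y] q y by (auto simp: D_def)
      have zy: "znorm y \<ge> 199" using znorm_nbr[OF y(1)] q by (auto simp: D_def)
      have b: "barrier (cpt y) > 0" using bpos[OF yc zy] by simp
      have "\<bar>pot_error g y\<bar> \<le> K * barrier (cpt y) \<or> \<bar>pot_error g y\<bar> \<le> d * of_int (fst y)"
      proof (cases "y \<in> cone")
        case True
        then have "y \<in> F \<or> znorm y > N" using y(2) yc zy by (auto simp: D_def F_def)
        then show ?thesis using KF[of y] N0[OF yc] by (auto simp: N_def)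
      next
        case False
        then show ?thesis using diagK[OF yc _ zy] by blast
      qed
      moreover have "d * of_int (fst y) \<ge> 0" "K * barrier (cpt y) \<ge> 0" using d closed_cone_fst[OF yc] b K20 by simp_all
      ultimately show "\<bar>pot_error g y\<bar> \<le> K * barrier (cpt y) + d * of_int (fst y)" by linarith
    qed
  qed
  \<comment> \<open>The truncation radius was chosen in terms of \<open>d\<close>, but the resulting
    bound has \<open>K\<close> independent of \<open>d\<close>, so \<open>d\<close> can tend to 0 at
    a fixed point.\<close>
  have inside: "\<bar>pot_error g p\<bar> \<le> K * barrier (cpt p)" if p: "p \<in> cone" "znorm p \<ge> 200" for p
  proof (rule field_le_epsilon)
    fix e :: real assume "e > 0"
    moreover have "real_of_int (fst p) > 0" using p(1) by (auto simp: cone_def)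
    ultimately show "\<bar>pot_error g p\<bar> \<le> K * barrier (cpt p) + e"
      using main[OF _ p, of "e / of_int (fst p)"] by simp
  qed
  have "\<bar>pot_error g p\<bar> \<le> (16 * K) / znorm p ^ 2" if p: "p \<in> closed_cone" "znorm p \<ge> 200" for p
  proof -
    have p199: "znorm p \<ge> 199" using p by simp
    have "\<bar>pot_error g p\<bar> \<le> K * barrier (cpt p)"
      using inside[OF _ p(2)] diagK[OF p(1) _ p199] by blast
    also have "\<dots> \<le> K * (16 / znorm p ^ 2)" using bpos[OF p(1) p199] K20 by (intro mult_left_mono) auto
    finally show ?thesis by (simp add: mult.commute)
  qed
  then show ?thesis by blast
qed

lemma pot_error_bound:
  "\<exists>g K. \<forall>p. znorm p \<ge> 200 \<longrightarrow> \<bar>pot_error g p\<bar> \<le> K / znorm p ^ 2"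
proof -
  obtain g K where K: "\<And>p. p \<in> closed_cone \<Longrightarrow> znorm p \<ge> 200 \<Longrightarrow> \<bar>pot_error g p\<bar> \<le> K / znorm p ^ 2"
    using pot_error_cone by blast
  have "\<bar>pot_error g p\<bar> \<le> K / znorm p ^ 2" if p: "znorm p \<ge> 200" for p
  proof -
    define a b where "a = max \<bar>fst p\<bar> \<bar>snd p\<bar>" and "b = min \<bar>fst p\<bar> \<bar>snd p\<bar>"
    have abs: "pot_error g (\<bar>x\<bar>, \<bar>y\<bar>) = pot_error g (x, y)" for x y
      by (auto simp: abs_if pot_error_sym)
    have "pot_error g (a, b) = pot_error g p"
      using abs[of "fst p" "snd p"] pot_error_sym(3)[of g "\<bar>fst p\<bar>" "\<bar>snd p\<bar>"] by (auto simp: a_def b_def max_def min_def)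
    moreover have "znorm (a, b) = znorm p" by (auto simp: a_def b_def max_def min_def znorm_def)
    moreover have "(a, b) \<in> closed_cone" by (auto simp: a_def b_def closed_cone_def)
    ultimately show ?thesis using K[of "(a, b)"] p by simp
  qed
  then show ?thesis by blast
qed

theorem pot_asymptotic_exists:
  "\<exists>g C. \<forall>p. p \<noteq> 0 \<longrightarrow> \<bar>pot p - 2 / pi * ln (znorm p) - g\<bar> \<le> C / znorm p ^ 2"
proof -
  obtain g K where K: "\<And>p. znorm p \<ge> 200 \<Longrightarrow> \<bar>pot_error g p\<bar> \<le> K / znorm p ^ 2"
    using pot_error_bound by blast
  define G where "G p = pot p - 2 / pi * ln (znorm p) - g" for p
  have big: "\<bar>G p\<bar> \<le> (\<bar>K\<bar> + 1) / znorm p ^ 2" if p: "znorm p \<ge> 200" for p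
  proof -
    have z0: "znorm p > 0" "p \<noteq> 0" using p by auto
    define X where "X = Re (cnj (cpt p) * inverse (cpt p ^ 3))"
    have e: "pot_error g p - X / 12 = pi / 2 * (pot p - g) - ln (znorm p)"
      by (simp add: pot_error_def log_approx_def X_def cmod_cpt)
    have "G p = 2 / pi * (pot_error g p - X / 12)" unfolding e by (simp add: G_def right_diff_distrib)
    then have "\<bar>G p\<bar> = 2 / pi * \<bar>pot_error g p - X / 12\<bar>"
      by (simp only: abs_mult) simp
    also have "\<dots> \<le> 1 * \<bar>pot_error g p - X / 12\<bar>"
      using pi_gt3 by (intro mult_right_mono) auto
    also have "\<dots> \<le> \<bar>pot_error g p\<bar> + \<bar>X\<bar>"
    proof -
      have "\<bar>X / 12\<bar> \<le> \<bar>X\<bar>" by simp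
      then show ?thesis using abs_triangle_ineq4[of "pot_error g p" "X / 12"] by simp
    qed
    also have "\<bar>pot_error g p\<bar> \<le> \<bar>K\<bar> / znorm p ^ 2"
      using K[OF p] by (rule order_trans) (intro divide_right_mono, auto)
    also have "\<bar>X\<bar> \<le> cmod (cnj (cpt p) * inverse (cpt p ^ 3))" unfolding X_def by (rule abs_Re_le_cmod)
    also have "\<dots> = 1 / znorm p ^ 2"
      using z0 by (simp add: norm_mult norm_inverse norm_power norm_divide cmod_cpt field_simps eval_nat_numeral)
    finally show ?thesis by (simp add: add_divide_distrib)
  qed
  have "\<forall>\<^sub>F p in cofinite. 200 \<le> znorm p" using znorm_at_top unfolding filterlim_at_top by blast
  then have "\<forall>\<^sub>F p in cofinite. \<bar>G p\<bar> * znorm p ^ 2 \<le> \<bar>K\<bar> + 1"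
  proof eventually_elim
    case (elim p)
    then have "znorm p ^ 2 > 0" by (intro zero_less_power) linarith
    then show ?case using big[OF elim] by (simp only: pos_le_divide_eq)
  qed
  from cofinite_le_imp_le_plus_const[OF this]
  obtain C where C: "\<And>p. \<bar>G p\<bar> * znorm p ^ 2 \<le> \<bar>K\<bar> + 1 + C" by blast
  have "\<bar>G p\<bar> \<le> (\<bar>K\<bar> + 1 + C) / znorm p ^ 2" if "p \<noteq> 0" for p
  proof -
    have "znorm p ^ 2 > 0" using that by simp
    then show ?thesis using C[of p] by (simp only: pos_le_divide_eq)
  qed
  then show ?thesis unfolding G_def by blast
qed

lemma pot_log_bound: "\<exists>C\<ge>0. \<forall>p. p \<noteq> 0 \<longrightarrow> \<bar>pot p - 2 / pi * ln (znorm p)\<bar> \<le> C"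
proof -
  obtain g C where C: "\<And>p. p \<noteq> 0 \<Longrightarrow> \<bar>pot p - 2 / pi * ln (znorm p) - g\<bar> \<le> C / znorm p ^ 2"
    using pot_asymptotic_exists by blast
  have "\<bar>pot p - 2 / pi * ln (znorm p)\<bar> \<le> \<bar>C\<bar> + \<bar>g\<bar>" if p: "p \<noteq> 0" for p
  proof -
    have "znorm p ^ 2 \<ge> 1" using znorm_ge_1[OF p] by simp
    then have "C / znorm p ^ 2 \<le> \<bar>C\<bar> / 1" by (intro frac_le) auto
    then show ?thesis using C[OF p] by linarith
  qed
  then show ?thesis by (intro exI[of _ "\<bar>C\<bar> + \<bar>g\<bar>"]) auto
qed

lemma znorm_triangle: "znorm (x + y) \<le> znorm x + znorm y" "znorm (x - y) \<le> znorm x + znorm y"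
  "znorm x - znorm y \<le> znorm (x - y)"
proof -
  have c: "cpt (x + y) = cpt x + cpt y" "cpt (x - y) = cpt x - cpt y" by (simp_all add: cpt_def complex_eq_iff)
  show "znorm (x + y) \<le> znorm x + znorm y" "znorm (x - y) \<le> znorm x + znorm y" "znorm x - znorm y \<le> znorm (x - y)"
    unfolding cmod_cpt[symmetric] c by (rule norm_triangle_ineq norm_triangle_ineq4 norm_triangle_ineq2)+
qed

lemma znorm_uminus [simp]: "znorm (- x) = znorm x"
  by (simp add: znorm_def)

lemma znorm_minus_commute: "znorm (x - y) = znorm (y - x)"
  using znorm_uminus[of "x - y"] by simp

text \<open>The difference of the logarithms is of order |z| / |x|. The error terms at
  \<open>x\<close> and \<open>x - z\<close> are of order |x|^-2 and are absorbed because a nonzero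
  \<open>z\<close> has norm at least 1.\<close>

lemma pot_diff_bound:
  "\<exists>C>0. \<forall>x z. x \<noteq> 0 \<longrightarrow> znorm z \<le> znorm x / 2 \<longrightarrow> \<bar>pot (x - z) - pot x\<bar> \<le> C * znorm z / znorm x"
proof -
  obtain g C where C: "\<And>p. p \<noteq> 0 \<Longrightarrow> \<bar>pot p - 2 / pi * ln (znorm p) - g\<bar> \<le> C / znorm p ^ 2"
    using pot_asymptotic_exists by blast
  have "\<bar>pot (x - z) - pot x\<bar> \<le> (5 * \<bar>C\<bar> + 2) * znorm z / znorm x"
    if x: "x \<noteq> 0" and z: "znorm z \<le> znorm x / 2" for x z
  proof (cases "z = 0")
    case False
    define r s t where "r = znorm x" and "s = znorm (x - z)" and "t = znorm z"
    have r1: "r \<ge> 1" and t1: "t \<ge> 1" using znorm_ge_1 x False by (auto simp: r_def t_def)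
    have tr: "t \<le> r / 2" using z by (simp add: r_def t_def)
    have s: "s \<ge> r - t" "s \<le> r + t" using znorm_triangle[of x z] by (auto simp: r_def s_def t_def)
    have s2: "s \<ge> r / 2" using s tr by linarith
    have s0: "s > 0" using s2 r1 by linarith
    have xz: "x - z \<noteq> 0" using s0 by (auto simp: s_def)
    have C0: "C / q ^ 2 \<le> \<bar>C\<bar> / q ^ 2" for q :: real by (intro divide_right_mono) auto
    have a: "\<bar>pot x - 2 / pi * ln r - g\<bar> \<le> \<bar>C\<bar> / r ^ 2" using C[OF x] C0[of r] by (simp add: r_def)
    have "\<bar>pot (x - z) - 2 / pi * ln s - g\<bar> \<le> \<bar>C\<bar> / s ^ 2" using C[OF xz] C0[of s] by (simp add: s_def)
    also have "\<dots> \<le> \<bar>C\<bar> / (r / 2) ^ 2" using s2 r1 by (intro divide_left_mono power_mono) auto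
    finally have b: "\<bar>pot (x - z) - 2 / pi * ln s - g\<bar> \<le> 4 * (\<bar>C\<bar> / r ^ 2)" by (simp add: power_divide mult.commute)
    have le: "q / p \<le> 2 * (t / r)" if "q \<le> t" "r / 2 \<le> p" for p q
    proof -
      have "q / p \<le> t / p" using that r1 by (intro divide_right_mono) auto
      also have "\<dots> \<le> t / (r / 2)" using that t1 r1 by (intro divide_left_mono) auto
      finally show ?thesis by (simp add: mult.commute)
    qed
    have "ln s - ln r \<le> (s - r) / r" "ln r - ln s \<le> (r - s) / s" using r1 s0 by (intro ln_diff_le; simp)+
    then have "\<bar>ln s - ln r\<bar> \<le> 2 * (t / r)" using le[of "s - r" r] le[of "r - s" s] s s2 r1 by simp
    then have "\<bar>2 / pi * (ln s - ln r)\<bar> \<le> 1 * (2 * (t / r))"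
      unfolding abs_mult using pi_gt3 by (intro mult_mono) auto
    then have c: "\<bar>2 / pi * ln s - 2 / pi * ln r\<bar> \<le> 2 * (t / r)" by (simp add: right_diff_distrib)
    \<comment> \<open>Uses t >= 1 and r >= 1. The factor 5 below collects 1 from \<open>x\<close>
      and 4 from \<open>x - z\<close>, whose norm is at least r / 2.\<close>
    have "\<bar>C\<bar> / r ^ 2 \<le> \<bar>C\<bar> * (t / r)"
    proof -
      have "1 / r ^ 2 \<le> t / r" using r1 t1 mult_mono[of 1 t 1 r] by (simp add: field_simps power2_eq_square)
      then have "\<bar>C\<bar> * (1 / r ^ 2) \<le> \<bar>C\<bar> * (t / r)" by (intro mult_left_mono) auto
      then show ?thesis by simp
    qed
    then have "\<bar>pot (x - z) - pot x\<bar> \<le> 5 * (\<bar>C\<bar> * (t / r)) + 2 * (t / r)" using a b c by linarith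
    also have "\<dots> = (5 * \<bar>C\<bar> + 2) * t / r" by (simp add: add_divide_distrib distrib_right)
    finally show ?thesis by (simp add: r_def t_def)
  qed simp
  then show ?thesis by (intro exI[of _ "5 * \<bar>C\<bar> + 2"]) auto
qed

lemma cofinite_pt_neq_bot: "(cofinite :: pt filter) \<noteq> bot"
  by (simp add: finite_prod infinite_UNIV_int)

lemma pot_at_top: "filterlim pot at_top cofinite"
proof -
  obtain C where C: "\<And>p. p \<noteq> 0 \<Longrightarrow> \<bar>pot p - 2 / pi * ln (znorm p)\<bar> \<le> C" using pot_log_bound by blast
  have "filterlim (\<lambda>r. 2 / pi * ln r - C) at_top at_top" by real_asymp
  then have "filterlim (\<lambda>p. 2 / pi * ln (znorm p) - C) at_top cofinite"
    by (rule filterlim_compose[OF _ znorm_at_top])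
  moreover have "\<forall>\<^sub>F p in cofinite. 2 / pi * ln (znorm p) - C \<le> pot p"
    unfolding eventually_cofinite
  proof (rule finite_subset)
    show "{p. \<not> 2 / pi * ln (znorm p) - C \<le> pot p} \<subseteq> {0}" using C by (force simp: abs_le_iff)
  qed simp
  ultimately show ?thesis by (rule filterlim_at_top_mono)
qed

lemma finite_pot_le: "finite {p. pot p \<le> N}"
proof -
  have "\<forall>\<^sub>F p in cofinite. N + 1 \<le> pot p" using pot_at_top by (simp add: filterlim_at_top)
  then have "finite {p. \<not> N + 1 \<le> pot p}" by (simp add: eventually_cofinite)
  then show ?thesis by (rule rev_finite_subset) auto
qed

lemma pot_diff_tendsto_0: "((\<lambda>y. pot (y - z) - pot y) \<longlongrightarrow> 0) cofinite"
proof -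
  obtain C where C: "\<And>x z. x \<noteq> 0 \<Longrightarrow> znorm z \<le> znorm x / 2 \<Longrightarrow> \<bar>pot (x - z) - pot x\<bar> \<le> C * znorm z / znorm x"
    using pot_diff_bound by blast
  have "((\<lambda>r. C * znorm z / r) \<longlongrightarrow> 0) at_top" by real_asymp
  then have t: "((\<lambda>y. C * znorm z / znorm y) \<longlongrightarrow> 0) cofinite" by (rule filterlim_compose[OF _ znorm_at_top])
  have "\<forall>\<^sub>F y in cofinite. max 1 (2 * znorm z) \<le> znorm y"
    using znorm_at_top unfolding filterlim_at_top by blast
  then have "\<forall>\<^sub>F y in cofinite. norm (pot (y - z) - pot y) \<le> C * znorm z / znorm y"
  proof eventually_elim
    case (elim y)
    then have "y \<noteq> 0" by auto
    then show ?case using C[of y z] elim by simp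
  qed
  then show ?thesis by (rule Lim_null_comparison[OF _ t])
qed

section \<open>Bounded harmonic functions and Liouville's theorem\<close>

lemma nbrs_shift: "nbrs (x - a) = (\<lambda>y. y - a) ` nbrs x"
  by (cases x, cases a) (auto simp: nbrs_def)

lemma avg_shift: "avg (\<lambda>y. f (y - a)) x = avg f (x - a)"
proof -
  have "inj_on (\<lambda>y. y - a) (nbrs x)" by (auto simp: inj_on_def)
  then show ?thesis by (simp add: avg_def nbrs_shift sum.reindex)
qed

lemma avg_pot_shift: "avg (\<lambda>y. pot (y - a)) x = pot (x - a) + (if x = a then 1 else 0)"
  using avg_shift[of pot a x] by (simp add: avg_pot)

text \<open>The analytic form of recurrence: \<open>pot (y - a0)\<close> is nonnegative, harmonic
  off \<open>a0\<close> and has finite sublevel sets. A bounded \<open>f\<close> that vanishes on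
  \<open>A\<close> is therefore below every positive multiple of it.\<close>

lemma bounded_harmonic_zero:
  assumes fin: "finite A" and a0: "a0 \<in> A" and bdd: "\<And>y. \<bar>f y\<bar> \<le> B"
    and harm: "\<And>y. y \<notin> A \<Longrightarrow> avg f y = f y" and zero: "\<And>y. y \<in> A \<Longrightarrow> f y = 0"
  shows "f x = 0"
proof (cases "x \<in> A")
  case xA: False
  have p0: "pot (x - a0) > 0" using xA a0 by (intro pot_pos) auto
  have "\<bar>f x\<bar> \<le> 0"
  proof (rule field_le_epsilon)
    fix e :: real assume e: "e > 0"
    define d where "d = e / pot (x - a0)"
    have d: "d > 0" using e p0 by (simp add: d_def)
    define N where "N = max (B / d) (pot (x - a0))"
    define D where "D = {y. y \<notin> A \<and> pot (y - a0) \<le> N}"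
    have "\<bar>f x\<bar> \<le> d * pot (x - a0)"
    proof (rule comparison_principle[where D = D and f = f and w = "\<lambda>y. d * pot (y - a0)"])
      have "finite ((\<lambda>y. y - a0) -` {p. pot p \<le> N})" by (intro finite_vimageI finite_pot_le) (simp add: inj_def)
      then show "finite D" by (rule rev_finite_subset) (auto simp: D_def)
      show "x \<in> D" using xA by (simp add: D_def N_def)
    next
      fix y assume "y \<in> D"
      then have y: "y \<notin> A" "y \<noteq> a0" using a0 by (auto simp: D_def)
      then show "\<bar>avg f y - f y\<bar> \<le> d * pot (y - a0) - avg (\<lambda>y. d * pot (y - a0)) y"
        by (simp add: avg_linear avg_pot_shift harm)
    next
      fix z y assume "y \<notin> D"
      then consider "y \<in> A" | "B / d < pot (y - a0)" by (auto simp: D_def N_def)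
      then show "\<bar>f y\<bar> \<le> d * pot (y - a0)"
      proof cases
        case 1
        then show ?thesis using zero d pot_nonneg by simp
      next
        case 2
        then have "B < d * pot (y - a0)" using d by (simp add: field_simps)
        then show ?thesis using bdd[of y] by linarith
      qed
    qed
    then show "\<bar>f x\<bar> \<le> 0 + e" using p0 by (simp add: d_def)
  qed
  then show ?thesis by simp
qed (simp add: zero)

section \<open>Liouville's theorem for sublinear growth\<close>

lemma filterlim_cofinite_inj: "inj f \<Longrightarrow> filterlim f cofinite cofinite"
  unfolding filterlim_iff eventually_cofinite
  using finite_vimageI by (fastforce simp: vimage_def)

lemma sublinear_compose:
  assumes u: "sublinear u" and f: "inj f" "\<And>x. znorm (f x) \<le> znorm x + K"
  shows "sublinear (\<lambda>x. u (f x))"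
proof -
  have "(\<lambda>x. u (f x)) \<in> o[cofinite](\<lambda>x. znorm (f x))"
    by (rule landau_o.small.compose[OF u filterlim_cofinite_inj[OF f(1)]])
  moreover have "(\<lambda>x. znorm (f x)) \<in> O[cofinite](znorm)"
  proof (rule bigoI[where c = 2])
    have "\<forall>\<^sub>F x in cofinite. K \<le> znorm x" using znorm_at_top unfolding filterlim_at_top by blast
    then show "\<forall>\<^sub>F x in cofinite. norm (znorm (f x)) \<le> 2 * norm (znorm x)"
    proof eventually_elim
      case (elim x)
      then show ?case using f(2)[of x] by simp
    qed
  qed
  ultimately show ?thesis by (rule landau_o.small_big_trans)
qed

lemma sublinear_shift: "sublinear u \<Longrightarrow> sublinear (\<lambda>x. u (x - a))"
  by (rule sublinear_compose[where K = "znorm a"]) (auto simp: inj_def znorm_triangle)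

lemma sublinear_swap: "sublinear u \<Longrightarrow> sublinear (\<lambda>x. u (snd x, fst x))"
  by (rule sublinear_compose[where K = 0]) (auto simp: inj_def znorm_def add.commute)

lemma sublinear_affine_bound:
  assumes u: "sublinear u" and e: "d > 0"
  shows "\<exists>C\<ge>0. \<forall>x. \<bar>u x\<bar> \<le> d * (\<bar>of_int (fst x)\<bar> + \<bar>of_int (snd x)\<bar>) + C"
proof -
  obtain C where C: "C \<ge> 0" "\<And>x. norm (u x) \<le> d * norm (znorm x) + C"
    using cofinite_le_imp_le_plus_const[OF landau_o.smallD[OF u e]] by blast
  have "\<bar>u x\<bar> \<le> d * (\<bar>of_int (fst x)\<bar> + \<bar>of_int (snd x)\<bar>) + C" for x
    using C(2)[of x] mult_left_mono[OF znorm_le_coords[of x] less_imp_le[OF e]] by simp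
  then show ?thesis using C(1) by blast
qed

lemma avg_swap: "avg (\<lambda>x. u (snd x, fst x)) x = avg u (snd x, fst x)"
  by (simp add: avg_expand)

text \<open>The difference of a harmonic function and its reflection vanishes on the axis; in a box of
  side \<open>N\<close> on one side of the axis it is dominated by a multiple of the harmonic polynomial
  \<open>b\<^sup>2 - a\<^sup>2 + 2 N a\<close>.\<close>

lemma sublinear_harmonic_reflection:
  assumes harm: "\<And>x. avg u x = u x" and sub: "sublinear u"
  shows "u (- a, b) = u (a, b)"
proof -
  define v where "v x = u x - u (- fst x, snd x)" for x
  have avgv: "avg v x = v x" for x
  proof -
    have "avg (\<lambda>x. u (- fst x, snd x)) x = avg u (- fst x, snd x)" by (simp add: avg_expand)
    then show ?thesis unfolding v_def by (simp add: avg_linear harm)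
  qed
  have pos: "\<bar>v (a, b)\<bar> \<le> 0" if a: "a > 0" for a b
  proof (rule field_le_epsilon)
    fix e :: real assume e: "e > 0"
    \<comment> \<open>As the box grows, the bound tends to 4 d * 2 a = e.\<close>
    define d where "d = e / (8 * of_int a)"
    have d: "d > 0" using e a by (simp add: d_def)
    obtain C where C: "C \<ge> 0" "\<And>x. \<bar>u x\<bar> \<le> d * (\<bar>of_int (fst x)\<bar> + \<bar>of_int (snd x)\<bar>) + C"
      using sublinear_affine_bound[OF sub d] by blast
    have bound: "\<bar>v (a, b)\<bar> \<le> (4 * d + 2 * C / real N) * ((of_int b ^ 2 - of_int a ^ 2) / real N + 2 * of_int a)"
      if N: "int N > a" "int N > \<bar>b\<bar>" for N
    proof -
      define M where "M = 4 * d * real N + 2 * C"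
      have N0: "real N > 0" using N a by linarith
      have M0: "M \<ge> 0" using d C N0 by (simp add: M_def)
      define h where "h x = real_of_int (snd x) ^ 2 - of_int (fst x) ^ 2 + 2 * real N * of_int (fst x)" for x :: pt
      have avgh: "avg h x = h x" for x
        by (simp add: avg_expand h_def power2_eq_square field_simps)
      define D where "D = {x. 0 < fst x \<and> fst x < int N \<and> \<bar>snd x\<bar> < int N}"
      have "\<bar>v (a, b)\<bar> \<le> M / real N ^ 2 * h (a, b)"
      proof (rule comparison_principle[where D = D and f = v and w = "\<lambda>x. M / real N ^ 2 * h x"])
        have "D \<subseteq> {0..int N} \<times> {- int N..int N}" by (auto simp: D_def)
        then show "finite D" by (rule finite_subset) auto
        show "(a, b) \<in> D" using N a by (simp add: D_def)
        show "\<bar>avg v x - v x\<bar> \<le> M / real N ^ 2 * h x - avg (\<lambda>x. M / real N ^ 2 * h x) x" for x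
          unfolding avg_linear(3) avgv avgh by simp
      next
        fix x y assume x: "x \<in> D" and y: "y \<in> nbrs x" "y \<notin> D"
        have rng: "0 \<le> fst y" "fst y \<le> int N" "\<bar>snd y\<bar> \<le> int N" using x y(1) by (auto simp: D_def nbrs_def)
        have rng': "0 \<le> real_of_int (fst y)" "real_of_int (fst y) \<le> real N" "\<bar>real_of_int (snd y)\<bar> \<le> real N" using rng by linarith+
        show "\<bar>v y\<bar> \<le> M / real N ^ 2 * h y"
        proof (cases "fst y = 0")
          case True
          then have "v y = 0" by (cases y) (simp add: v_def)
          moreover have "h y \<ge> 0" using True by (simp add: h_def)
          ultimately show ?thesis using M0 by simp
        next
          case False
          then have b: "fst y = int N \<or> \<bar>snd y\<bar> = int N" using y(2) rng by (auto simp: D_def)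
          have "h y \<ge> real N ^ 2"
          proof -
            have "h y = real_of_int (snd y) ^ 2 + of_int (fst y) * (2 * real N - of_int (fst y))"
              by (simp add: h_def power2_eq_square algebra_simps)
            moreover have "real_of_int (fst y) * (2 * real N - of_int (fst y)) \<ge> 0" using rng' by (intro mult_nonneg_nonneg) auto
            moreover have "real_of_int (snd y) ^ 2 = real N ^ 2 \<or> real_of_int (fst y) * (2 * real N - of_int (fst y)) = real N ^ 2"
            proof (cases "fst y = int N")
              case True
              then show ?thesis by (simp add: power2_eq_square)
            next
              case False
              then have "\<bar>real_of_int (snd y)\<bar> = real N" using b by linarith
              then show ?thesis by (metis power2_abs)
            qed
            ultimately show ?thesis by (smt (verit) zero_le_power2)
          qed
          then have "M / real N ^ 2 * real N ^ 2 \<le> M / real N ^ 2 * h y" using M0 by (intro mult_left_mono) auto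
          then have 1: "M \<le> M / real N ^ 2 * h y" using N0 by simp
          have "\<bar>v y\<bar> \<le> 2 * (d * (\<bar>of_int (fst y)\<bar> + \<bar>of_int (snd y)\<bar>) + C)"
            using C(2)[of y] C(2)[of "(- fst y, snd y)"] unfolding v_def by simp
          also have "\<dots> \<le> 2 * (d * (real N + real N) + C)"
            using rng' d by (intro mult_left_mono add_right_mono add_mono) auto
          also have "\<dots> = M" by (simp add: M_def)
          finally show ?thesis using 1 by linarith
        qed
      qed
      also have "\<dots> = (4 * d + 2 * C / real N) * ((of_int b ^ 2 - of_int a ^ 2) / real N + 2 * of_int a)"
        using N0 by (simp add: M_def h_def field_simps power2_eq_square)
      finally show ?thesis .
    qed
    have "\<bar>v (a, b)\<bar> \<le> (4 * d + 2 * C * 0) * ((of_int b ^ 2 - of_int a ^ 2) * 0 + 2 * of_int a)"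
    proof (rule tendsto_lowerbound)
      have n: "(\<lambda>N. 1 / real N) \<longlonglongrightarrow> 0" by real_asymp
      have "(\<lambda>N. (4 * d + 2 * C * (1 / real N)) * ((of_int b ^ 2 - of_int a ^ 2) * (1 / real N) + 2 * of_int a))
         \<longlonglongrightarrow> (4 * d + 2 * C * 0) * ((of_int b ^ 2 - of_int a ^ 2) * 0 + 2 * of_int a)"
        by (intro tendsto_intros n)
      then show "(\<lambda>N. (4 * d + 2 * C / real N) * ((of_int b ^ 2 - of_int a ^ 2) / real N + 2 * of_int a))
         \<longlonglongrightarrow> (4 * d + 2 * C * 0) * ((of_int b ^ 2 - of_int a ^ 2) * 0 + 2 * of_int a)" by simp
      show "\<forall>\<^sub>F N in sequentially. \<bar>v (a, b)\<bar> \<le> (4 * d + 2 * C / real N) * ((of_int b ^ 2 - of_int a ^ 2) / real N + 2 * of_int a)"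
        using eventually_gt_at_top[of "nat (a + \<bar>b\<bar>)"] by eventually_elim (rule bound; use a in linarith)
    qed simp
    then show "\<bar>v (a, b)\<bar> \<le> 0 + e" using a by (simp add: d_def)
  qed
  consider "a > 0" | "a = 0" | "a < 0" by linarith
  then show ?thesis
  proof cases
    case 1
    then show ?thesis using pos[of a b] by (simp add: v_def)
  next
    case 3
    then show ?thesis using pos[of "- a" b] by (simp add: v_def)
  qed simp
qed

text \<open>The reflection in the vertical line through \<open>a + 1\<close> exchanges
  \<open>a\<close> and \<open>a + 2\<close>.\<close>

lemma sublinear_harmonic_period:
  assumes harm: "\<And>x. avg u x = u x" and sub: "sublinear u"
  shows "u (a + 2, b) = u (a, b)"
proof -
  define w where "w x = u (x - (- (a + 1), 0))" for x
  have "w (- 1, b) = w (1, b)"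
  proof (rule sublinear_harmonic_reflection)
    show "avg w x = w x" for x unfolding w_def avg_shift harm ..
    show "sublinear w" unfolding w_def by (rule sublinear_shift[OF sub])
  qed
  then show ?thesis by (simp add: w_def add.commute)
qed

lemma int_period_2:
  assumes "\<And>x. g (x + 2) = (g (x :: int) :: 'a)"
  shows "g x = g (x mod 2)"
proof -
  have "g (y + 2 * k) = g y" for y k
  proof (induction k rule: int_induct[where k = 0])
    case (step1 i)
    then show ?case using assms[of "y + 2 * i"] by (simp add: algebra_simps)
  next
    case (step2 i)
    then show ?case using assms[of "y + 2 * (i - 1)"] by (simp add: algebra_simps)
  qed simp
  from this[of "x mod 2" "x div 2"] show ?thesis by (simp add: add.commute)
qed

text \<open>Period 2 in both directions leaves only four values, so \<open>u\<close> is bounded, and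
  \<open>u - u 0\<close> falls under \<open>bounded_harmonic_zero\<close> with the set {0}.\<close>

theorem liouville_sublinear:
  assumes harm: "\<And>x. avg u x = u x" and sub: "sublinear u"
  shows "u x = u 0"
proof -
  have p1: "u (a + 2, b) = u (a, b)" for a b by (rule sublinear_harmonic_period[OF harm sub])
  have p2: "u (a, b + 2) = u (a, b)" for a b
    using sublinear_harmonic_period[of "\<lambda>x. u (snd x, fst x)" b a] sublinear_swap[OF sub]
    by (simp add: avg_swap harm)
  have per: "u (a, b) = u (a mod 2, b mod 2)" for a b
    using int_period_2[of "\<lambda>a. u (a, b)" a] int_period_2[of "\<lambda>b. u (a mod 2, b)" b] p1 p2 by simp
  define B where "B = \<bar>u (0,0)\<bar> + \<bar>u (0,1)\<bar> + \<bar>u (1,0)\<bar> + \<bar>u (1,1)\<bar>"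
  have B: "\<bar>u x\<bar> \<le> B" for x
  proof -
    obtain a b where x: "x = (a, b)" by (cases x)
    have "a mod 2 = 0 \<or> a mod 2 = 1" "b mod 2 = 0 \<or> b mod 2 = 1" by auto
    then show ?thesis unfolding x per[of a b] B_def by auto
  qed
  have "u x - u 0 = 0"
  proof (rule bounded_harmonic_zero[where f = "\<lambda>x. u x - u 0" and A = "{0}" and ?a0.0 = 0])
    show "\<bar>u y - u 0\<bar> \<le> 2 * B" for y using B[of y] B[of 0] by linarith
    show "avg (\<lambda>x. u x - u 0) y = u y - u 0" if "y \<notin> {0}" for y by (simp add: avg_linear harm)
  qed auto
  then show ?thesis by simp
qed

lemma bounded_harmonic_limit:
  assumes fin: "finite A" and bdd: "\<And>y. \<bar>f y\<bar> \<le> B" and harm: "\<And>y. y \<notin> A \<Longrightarrow> avg f y = f y"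
  shows "\<exists>c. (f \<longlongrightarrow> c) cofinite"
proof -
  \<comment> \<open>The charge of \<open>f\<close>, supported on \<open>A\<close>. Subtracting its
    potential leaves a function that is harmonic everywhere and still sublinear.\<close>
  define \<phi> where "\<phi> z = avg f z - f z" for z
  define g where "g y = f y - (\<Sum>z\<in>A. \<phi> z * pot (y - z))" for y
  have g: "avg g y = g y" for y
  proof -
    have "avg g y = avg f y - (\<Sum>z\<in>A. \<phi> z * (pot (y - z) + (if y = z then 1 else 0)))"
      unfolding g_def by (simp only: avg_linear avg_sum avg_pot_shift)
    also have "(\<Sum>z\<in>A. \<phi> z * (pot (y - z) + (if y = z then 1 else 0))) = (\<Sum>z\<in>A. \<phi> z * pot (y - z)) + (\<Sum>z\<in>A. if y = z then \<phi> z else 0)"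
      unfolding sum.distrib[symmetric] by (intro sum.cong) auto
    also have "(\<Sum>z\<in>A. if y = z then \<phi> z else 0) = avg f y - f y"
      using fin harm[of y] by (simp add: \<phi>_def)
    finally have "avg g y = avg f y - ((\<Sum>z\<in>A. \<phi> z * pot (y - z)) + (avg f y - f y))" .
    moreover have "g y = f y - (\<Sum>z\<in>A. \<phi> z * pot (y - z))" by (simp add: g_def)
    ultimately show ?thesis by linarith
  qed
  have "sublinear (\<lambda>y. \<phi> z * pot (y - z))" for z
    using sublinear_shift[OF sublinear_pot] by (cases "\<phi> z = 0") auto
  then have "sublinear g"
    unfolding g_def by (intro sum_in_smallo big_sum_in_smallo sublinear_bounded[OF bdd])
  then have gc: "g y = g 0" for y by (rule liouville_sublinear[OF g])
  define \<Phi> where "\<Phi> = (\<Sum>z\<in>A. \<phi> z)"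
  define r where "r y = (\<Sum>z\<in>A. \<phi> z * (pot (y - z) - pot y))" for y
  have f: "f y = g 0 + r y + \<Phi> * pot y" for y
    using gc[of y] by (simp add: g_def r_def \<Phi>_def sum_distrib_right right_diff_distrib sum_subtractf)
  have "(r \<longlongrightarrow> (\<Sum>z\<in>A. \<phi> z * 0)) cofinite"
    unfolding r_def by (intro tendsto_sum tendsto_mult tendsto_const pot_diff_tendsto_0)
  then have r0: "(r \<longlongrightarrow> 0) cofinite" by simp
  \<comment> \<open>Up to bounded terms \<open>f\<close> is the total charge times
    \<open>pot\<close>; since \<open>pot\<close> tends to infinity and \<open>f\<close> is bounded,
    the total charge vanishes.\<close>
  have "\<Phi> = 0"
  proof (rule ccontr)
    assume P: "\<Phi> \<noteq> 0"
    have "\<forall>\<^sub>F y in cofinite. \<bar>r y\<bar> < 1" using tendstoD[OF r0, of 1] by simp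
    moreover have "\<forall>\<^sub>F y in cofinite. (B + \<bar>g 0\<bar> + 2) / \<bar>\<Phi>\<bar> \<le> pot y" using pot_at_top by (simp add: filterlim_at_top)
    ultimately have "\<forall>\<^sub>F y in (cofinite :: pt filter). False"
    proof eventually_elim
      case (elim y)
      have "B + \<bar>g 0\<bar> + 2 \<le> \<bar>\<Phi>\<bar> * pot y" using elim(2) P by (simp add: field_simps)
      also have "\<dots> = \<bar>\<Phi> * pot y\<bar>" by (simp add: abs_mult pot_nonneg)
      finally show False using bdd[of y] elim(1) unfolding f[of y] by linarith
    qed
    then show False using cofinite_pt_neq_bot by simp
  qed
  then have "f = (\<lambda>y. g 0 + r y)" using f by auto
  moreover have "((\<lambda>y. g 0 + r y) \<longlongrightarrow> g 0 + 0) cofinite" by (intro tendsto_intros r0)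
  ultimately show ?thesis by auto
qed

section \<open>Hitting distributions and harmonic measure\<close>

lemma first_hit_Suc:
  "first_hit A (Suc k) y x = avg (\<lambda>z. if z \<in> A then (if k = 0 \<and> z = x then 1 else 0) else first_hit A k z x) y"
  by (simp add: avg_def)

declare first_hit.simps(2) [simp del]

lemma avg_nonneg: "(\<And>y. y \<in> nbrs x \<Longrightarrow> f y \<ge> 0) \<Longrightarrow> avg f x \<ge> 0"
  by (simp add: avg_def sum_nonneg)

lemma first_hit_nonneg: "first_hit A k y x \<ge> 0"
  by (induction k arbitrary: y) (auto simp: first_hit_Suc intro!: avg_nonneg)

lemma first_hit_sum_le: "(\<Sum>k<N. first_hit A k y x) \<le> 1"
proof (induction N arbitrary: y)
  case (Suc N)
  have "(\<Sum>k<Suc N. first_hit A k y x) = (\<Sum>k<N. first_hit A (Suc k) y x)"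
    by (subst sum.lessThan_Suc_shift) simp
  also have "\<dots> = avg (\<lambda>z. \<Sum>k<N. if z \<in> A then (if k = 0 \<and> z = x then 1 else 0) else first_hit A k z x) y"
    by (simp add: first_hit_Suc avg_sum)
  also have "\<dots> \<le> avg (\<lambda>_. 1) y"
  proof (rule avg_mono)
    fix z
    show "(\<Sum>k<N. if z \<in> A then (if k = 0 \<and> z = x then 1 else 0) else first_hit A k z x) \<le> (1::real)"
    proof (cases "z \<in> A")
      case True
      have "(\<Sum>k<N. if z \<in> A then (if k = 0 \<and> z = x then 1 else 0) else first_hit A k z x) \<le> (\<Sum>k<N. if k = 0 then 1 else (0::real))"
        using True by (intro sum_mono) auto
      also have "\<dots> \<le> 1" by simp
      finally show ?thesis .
    next
      case False
      then show ?thesis using Suc[of z] by simp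
    qed
  qed
  finally show ?case by (simp add: avg_linear)
qed simp

lemma first_hit_summable: "summable (\<lambda>k. first_hit A k y x)"
  by (rule summableI_nonneg_bounded[OF first_hit_nonneg first_hit_sum_le])

lemma hit_dist_bounds: "0 \<le> hit_dist A y x" "hit_dist A y x \<le> 1"
  unfolding hit_dist_def
  by (auto intro!: suminf_nonneg suminf_le_const first_hit_summable first_hit_nonneg first_hit_sum_le)

text \<open>The hitting law with time 0 counted, in contrast to \<open>hit_dist\<close>, which
  starts at time 1. This version is harmonic off \<open>A\<close> with indicator values on
  \<open>A\<close>; off the finite set \<open>A\<close> the two agree, so they have the same
  limit.\<close>

definition entrance :: "pt set \<Rightarrow> pt \<Rightarrow> pt \<Rightarrow> real" where
  "entrance A x y = (if y \<in> A then (if y = x then 1 else 0) else hit_dist A y x)"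

lemma hit_dist_eq_avg: "hit_dist A y x = avg (entrance A x) y"
proof -
  have "(\<lambda>k. first_hit A (Suc k) y x) sums avg (entrance A x) y"
    unfolding first_hit_Suc unfolding avg_def
  proof (intro sums_divide sums_sum)
    fix z
    show "(\<lambda>k. if z \<in> A then (if k = 0 \<and> z = x then 1 else 0) else first_hit A k z x) sums entrance A x z"
    proof (cases "z \<in> A")
      case True
      then show ?thesis using sums_single[of 0 "\<lambda>_. 1::real"] by (cases "z = x") (simp_all add: entrance_def)
    next
      case False
      then show ?thesis using summable_sums[OF first_hit_summable[of A z x]] by (simp add: entrance_def hit_dist_def)
    qed
  qed
  then have "(\<lambda>k. first_hit A k y x) sums (avg (entrance A x) y + first_hit A 0 y x)"
    by (subst (asm) sums_Suc_iff) simp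
  then show ?thesis by (simp add: hit_dist_def sums_iff)
qed

lemma entrance_bounds: "0 \<le> entrance A x y" "entrance A x y \<le> 1"
  using hit_dist_bounds[of A y x] by (auto simp: entrance_def)

lemma entrance_harmonic: "y \<notin> A \<Longrightarrow> avg (entrance A x) y = entrance A x y"
  using hit_dist_eq_avg[of A y x] by (simp add: entrance_def)

lemma hm_tendsto_entrance:
  assumes "finite A"
  shows "(entrance A x \<longlongrightarrow> hm A x) cofinite"
proof -
  have "\<bar>entrance A x y\<bar> \<le> 1" for y using entrance_bounds[of A x y] by simp
  from bounded_harmonic_limit[OF assms this entrance_harmonic]
  obtain c where c: "(entrance A x \<longlongrightarrow> c) cofinite" by blast
  have ev: "\<forall>\<^sub>F y in cofinite. entrance A x y = hit_dist A y x"
    unfolding eventually_cofinite by (rule finite_subset[OF _ assms]) (auto simp: entrance_def)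
  have "((\<lambda>y. hit_dist A y x) \<longlongrightarrow> c) cofinite" using c ev by (rule Lim_transform_eventually)
  then have "hm A x = c" unfolding hm_def by (intro tendsto_Lim cofinite_pt_neq_bot)
  then show ?thesis using c by simp
qed

lemma hm_tendsto: "finite A \<Longrightarrow> ((\<lambda>y. hit_dist A y x) \<longlongrightarrow> hm A x) cofinite"
proof (rule Lim_transform_eventually[OF hm_tendsto_entrance])
  assume "finite A"
  then show "\<forall>\<^sub>F y in cofinite. entrance A x y = hit_dist A y x"
    unfolding eventually_cofinite by (rule rev_finite_subset) (auto simp: entrance_def)
qed

lemma hm_nonneg: "finite A \<Longrightarrow> hm A x \<ge> 0"
  using tendsto_lowerbound[OF hm_tendsto_entrance _ cofinite_pt_neq_bot] entrance_bounds by simp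

lemma entrance_expansion:
  assumes fin: "finite A" and ne: "A \<noteq> {}" and bdd: "\<And>y. \<bar>f y\<bar> \<le> B"
    and harm: "\<And>y. y \<notin> A \<Longrightarrow> avg f y = f y"
  shows "f y = (\<Sum>x\<in>A. f x * entrance A x y)"
proof -
  obtain a0 where a0: "a0 \<in> A" using ne by blast
  have "f y - (\<Sum>x\<in>A. f x * entrance A x y) = 0"
  proof (rule bounded_harmonic_zero[where f = "\<lambda>y. f y - (\<Sum>x\<in>A. f x * entrance A x y)", OF fin a0])
    fix y
    have "\<bar>\<Sum>x\<in>A. f x * entrance A x y\<bar> \<le> (\<Sum>x\<in>A. \<bar>f x\<bar>)"
    proof (rule order_trans[OF sum_abs sum_mono])
      fix x
      show "\<bar>f x * entrance A x y\<bar> \<le> \<bar>f x\<bar>"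
        unfolding abs_mult using entrance_bounds[of A x y] by (simp add: mult_left_le)
    qed
    then show "\<bar>f y - (\<Sum>x\<in>A. f x * entrance A x y)\<bar> \<le> B + (\<Sum>x\<in>A. \<bar>f x\<bar>)"
      using bdd[of y] by linarith
  next
    fix y assume "y \<notin> A"
    then show "avg (\<lambda>y. f y - (\<Sum>x\<in>A. f x * entrance A x y)) y = f y - (\<Sum>x\<in>A. f x * entrance A x y)"
      by (simp add: avg_linear avg_sum harm entrance_harmonic)
  next
    fix y assume y: "y \<in> A"
    then have "(\<Sum>x\<in>A. f x * entrance A x y) = (\<Sum>x\<in>A. if y = x then f x else 0)"
      by (intro sum.cong) (auto simp: entrance_def)
    also have "\<dots> = f y" using fin y by simp
    finally show "f y - (\<Sum>x\<in>A. f x * entrance A x y) = 0" by simp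
  qed
  then show ?thesis by simp
qed

text \<open>Sending the starting point in \<open>entrance_expansion\<close> to infinity turns each
  bounded function that is harmonic off \<open>A\<close> into a linear identity for harmonic
  measure. Total mass 1 and the equilibrium identity are instances.\<close>

lemma harmonic_limit_eq_hm:
  assumes fin: "finite A" and ne: "A \<noteq> {}" and bdd: "\<And>y. \<bar>f y\<bar> \<le> B"
    and harm: "\<And>y. y \<notin> A \<Longrightarrow> avg f y = f y" and lim: "(f \<longlongrightarrow> L) cofinite"
  shows "(\<Sum>x\<in>A. f x * hm A x) = L"
proof (rule tendsto_unique[OF cofinite_pt_neq_bot _ lim])
  have "((\<lambda>y. \<Sum>x\<in>A. f x * entrance A x y) \<longlongrightarrow> (\<Sum>x\<in>A. f x * hm A x)) cofinite"
    by (intro tendsto_intros hm_tendsto_entrance fin)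
  moreover have "(\<lambda>y. \<Sum>x\<in>A. f x * entrance A x y) = f"
    by (rule ext) (rule entrance_expansion[OF fin ne bdd harm, symmetric])
  ultimately show "(f \<longlongrightarrow> (\<Sum>x\<in>A. f x * hm A x)) cofinite" by (simp only:)
qed

lemma hm_sum:
  assumes "finite A" "A \<noteq> {}"
  shows "(\<Sum>x\<in>A. hm A x) = 1"
  using harmonic_limit_eq_hm[OF assms, of "\<lambda>_. 1" 1 1] by (simp add: avg_linear)

lemma tendsto_cofinite_bounded:
  fixes f :: "pt \<Rightarrow> real"
  assumes "(f \<longlongrightarrow> L) cofinite"
  shows "\<exists>B. \<forall>y. \<bar>f y\<bar> \<le> B"
proof -
  have "\<forall>\<^sub>F y in cofinite. \<bar>f y - L\<bar> < 1" using tendstoD[OF assms, of 1] by (simp add: dist_real_def)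
  then have "\<forall>\<^sub>F y in cofinite. \<bar>f y\<bar> \<le> \<bar>L\<bar> + 1" by eventually_elim linarith
  from cofinite_le_imp_le_plus_const[OF this] show ?thesis by blast
qed

text \<open>The potential of the harmonic measure is constant on the set: for two points of the set, the
  difference of the shifted kernels is harmonic off the set and vanishes at infinity.\<close>

lemma equilibrium_aux:
  assumes fin: "finite A" and w: "w \<in> A" "w' \<in> A"
  shows "(\<Sum>z\<in>A. pot (z - w) * hm A z) = (\<Sum>z\<in>A. pot (z - w') * hm A z)"
proof -
  define f where "f y = pot (y - w) - pot (y - w')" for y
  have "((\<lambda>y. (pot (y - w) - pot y) - (pot (y - w') - pot y)) \<longlongrightarrow> 0 - 0) cofinite"
    by (intro tendsto_diff pot_diff_tendsto_0)
  then have lim: "(f \<longlongrightarrow> 0) cofinite" by (simp add: f_def[abs_def])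
  then obtain B where B: "\<And>y. \<bar>f y\<bar> \<le> B" using tendsto_cofinite_bounded by blast
  have "avg f y = f y" if "y \<notin> A" for y
  proof -
    have "y \<noteq> w" "y \<noteq> w'" using w that by auto
    then show ?thesis unfolding f_def avg_linear avg_pot_shift by simp
  qed
  then have "(\<Sum>x\<in>A. f x * hm A x) = 0" using fin w B lim by (intro harmonic_limit_eq_hm) auto
  then show ?thesis by (simp add: f_def left_diff_distrib sum_subtractf)
qed

text \<open>The Robin constant. By \<open>equilibrium_aux\<close> the choice of base point is
  immaterial, so it extends \<open>cap0\<close> to sets without the origin and behaves well under
  isometries.\<close>

definition robin :: "pt set \<Rightarrow> real" where
  "robin A = (\<Sum>z\<in>A. pot (z - (SOME w. w \<in> A)) * hm A z)"

lemma robin_eq: "finite A \<Longrightarrow> w \<in> A \<Longrightarrow> (\<Sum>z\<in>A. pot (z - w) * hm A z) = robin A"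
  unfolding robin_def by (rule equilibrium_aux) (auto intro: someI)

lemma cap0_eq_robin: "finite A \<Longrightarrow> 0 \<in> A \<Longrightarrow> cap0 A = robin A"
  using robin_eq[of A 0] by (simp add: cap0_def)

text \<open>A walk from outside meets \<open>A\<close> before it can reach a site enclosed by
  \<open>A\<close>. For balls this confines harmonic measure to the rim.\<close>

lemma hm_interior:
  assumes fin: "finite A" and x: "nbrs x \<subseteq> A"
  shows "hm A x = 0"
proof -
  have fh: "first_hit A k y x = 0" if "y \<notin> A" for k y
    using that
  proof (induction k arbitrary: y)
    case (Suc k)
    have "first_hit A (Suc k) y x = avg (\<lambda>_. 0) y"
      unfolding first_hit_Suc
    proof (rule avg_cong)
      fix z assume z: "z \<in> nbrs y"
      have "z \<noteq> x"
      proof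
        assume "z = x"
        then have "y \<in> nbrs x" using z by (cases x, cases y) (auto simp: nbrs_def)
        then show False using x Suc.prems by blast
      qed
      then show "(if z \<in> A then (if k = 0 \<and> z = x then 1 else 0) else first_hit A k z x) = 0"
        using Suc.IH[of z] by auto
    qed
    then show ?case by (simp add: avg_linear)
  qed simp
  have "hit_dist A y x = 0" if "y \<notin> A" for y using fh[OF that] by (simp add: hit_dist_def)
  then have "\<forall>\<^sub>F y in cofinite. hit_dist A y x = 0"
    unfolding eventually_cofinite by (intro finite_subset[OF _ fin]) blast
  then have "((\<lambda>y. hit_dist A y x) \<longlongrightarrow> 0) cofinite" by (rule tendsto_eventually)
  with hm_tendsto[OF fin] show ?thesis by (rule tendsto_unique[OF cofinite_pt_neq_bot])
qed

section \<open>Lattice isometries\<close>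

lemma nbrs_iff: "y \<in> nbrs x \<longleftrightarrow> znorm (y - x) = 1"
proof -
  obtain a b where ab: "y - x = (a, b)" by (cases "y - x")
  have y: "y = (fst x + a, snd x + b)" using ab by (cases x, cases y) auto
  have "znorm (y - x) = 1 \<longleftrightarrow> real_of_int (a^2 + b^2) = 1" by (simp add: ab znorm_def)
  also have "\<dots> \<longleftrightarrow> a^2 + b^2 = 1" by linarith
  also have "\<dots> \<longleftrightarrow> (a, b) \<in> {(1, 0), (-1, 0), (0, 1), (0, -1)}"
  proof
    assume e: "a^2 + b^2 = 1"
    have "a^2 \<le> 1" "b^2 \<le> 1" using e zero_le_power2[of a] zero_le_power2[of b] by linarith+
    then have "\<bar>a\<bar> \<le> 1" "\<bar>b\<bar> \<le> 1" by (simp_all add: abs_square_le_1)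
    then have "a = -1 \<or> a = 0 \<or> a = 1" "b = -1 \<or> b = 0 \<or> b = 1" by linarith+
    then show "(a, b) \<in> {(1, 0), (-1, 0), (0, 1), (0, -1)}" using e by auto
  qed auto
  also have "\<dots> \<longleftrightarrow> y \<in> nbrs x" unfolding y by (auto simp: nbrs_def)
  finally show ?thesis by simp
qed

lemma lattice_isometry_inj: "lattice_isometry f \<Longrightarrow> inj f"
  unfolding lattice_isometry_def inj_def by (metis cancel_comm_monoid_add_class.diff_cancel right_minus_eq znorm_eq_0_iff)

lemma card_nbrs: "card (nbrs x) = 4"
  by (simp add: nbrs_def)

lemma lattice_isometry_nbrs:
  assumes f: "lattice_isometry f"
  shows "f ` nbrs x = nbrs (f x)"
proof (rule card_subset_eq)
  have "znorm (f z - f x) = znorm (z - x)" for z using f unfolding lattice_isometry_def by blast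
  then show "f ` nbrs x \<subseteq> nbrs (f x)" unfolding image_subset_iff by (simp add: nbrs_iff Ball_def)
  have "inj_on f (nbrs x)" using lattice_isometry_inj[OF f] by (rule inj_on_subset) auto
  then show "card (f ` nbrs x) = card (nbrs (f x))" by (simp add: card_image card_nbrs)
qed simp

lemma avg_isometry:
  assumes f: "lattice_isometry f"
  shows "avg (\<lambda>z. g (f z)) y = avg g (f y)"
proof -
  have "inj_on f (nbrs y)" using lattice_isometry_inj[OF f] by (rule inj_on_subset) auto
  then show ?thesis by (simp add: avg_def sum.reindex flip: lattice_isometry_nbrs[OF f])
qed

lemma first_hit_isometry:
  assumes f: "lattice_isometry f"
  shows "first_hit (f ` A) k (f y) (f x) = first_hit A k y x"
proof (induction k arbitrary: y)
  case (Suc k)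
  have iff: "f z \<in> f ` A \<longleftrightarrow> z \<in> A" "f z = f x \<longleftrightarrow> z = x" for z
    using lattice_isometry_inj[OF f] by (auto simp: inj_eq inj_image_mem_iff)
  have "first_hit (f ` A) (Suc k) (f y) (f x)
      = avg (\<lambda>z. if f z \<in> f ` A then (if k = 0 \<and> f z = f x then 1 else 0) else first_hit (f ` A) k (f z) (f x)) y"
    unfolding first_hit_Suc by (rule avg_isometry[OF f, symmetric])
  also have "\<dots> = first_hit A (Suc k) y x" unfolding first_hit_Suc iff Suc ..
  finally show ?case .
qed simp

lemma hm_isometry:
  assumes f: "lattice_isometry f" and fin: "finite A"
  shows "hm (f ` A) (f x) = hm A x"
proof -
  have "filterlim f cofinite cofinite" by (rule filterlim_cofinite_inj[OF lattice_isometry_inj[OF f]])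
  with hm_tendsto[of "f ` A" "f x"] fin have "((\<lambda>y. hit_dist (f ` A) (f y) (f x)) \<longlongrightarrow> hm (f ` A) (f x)) cofinite"
    by (auto intro: filterlim_compose)
  then have "((\<lambda>y. hit_dist A y x) \<longlongrightarrow> hm (f ` A) (f x)) cofinite"
    by (simp add: hit_dist_def first_hit_isometry[OF f])
  then show ?thesis using tendsto_unique[OF cofinite_pt_neq_bot] hm_tendsto[OF fin] by blast
qed

text \<open>Liouville's theorem takes the place of a classification of the isometries: the two
  kernels carry the same unit charge at \<open>w\<close> and differ by a bounded function since the
  norms agree, and both vanish at \<open>w\<close>.\<close>

lemma pot_isometry:
  assumes f: "lattice_isometry f"
  shows "pot (f z - f w) = pot (z - w)"
proof -
  define g where "g y = pot (f y - f w) - pot (y - w)" for y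
  obtain C where C: "C \<ge> 0" "\<And>p. p \<noteq> 0 \<Longrightarrow> \<bar>pot p - 2 / pi * ln (znorm p)\<bar> \<le> C" using pot_log_bound by blast
  have inj: "f y = f w \<longleftrightarrow> y = w" for y using lattice_isometry_inj[OF f] by (simp add: inj_eq)
  have bd: "\<bar>g y\<bar> \<le> 2 * C" for y
  proof (cases "y = w")
    case False
    have zn: "znorm (f y - f w) = znorm (y - w)" using f unfolding lattice_isometry_def by blast
    have "\<bar>pot (f y - f w) - 2 / pi * ln (znorm (f y - f w))\<bar> \<le> C" using C(2) inj[of y] False by simp
    moreover have "\<bar>pot (y - w) - 2 / pi * ln (znorm (y - w))\<bar> \<le> C" using C(2) False by simp
    ultimately show ?thesis unfolding g_def zn by linarith
  qed (use C in \<open>simp add: g_def\<close>)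
  have "avg g y = g y" for y
  proof -
    have "avg g y = avg (\<lambda>y. pot (f y - f w)) y - avg (\<lambda>y. pot (y - w)) y" unfolding g_def avg_linear ..
    also have "avg (\<lambda>y. pot (f y - f w)) y = avg (\<lambda>z. pot (z - f w)) (f y)" by (rule avg_isometry[OF f])
    finally show ?thesis unfolding avg_pot_shift inj g_def by simp
  qed
  then have "g y = g 0" for y using sublinear_bounded[OF bd] by (rule liouville_sublinear)
  from this[of z] this[of w] have "g z = g w" by (simp only:)
  then show ?thesis by (simp add: g_def)
qed

lemma robin_isometry:
  assumes f: "lattice_isometry f" and fin: "finite A" and ne: "A \<noteq> {}"
  shows "robin (f ` A) = robin A"
proof -
  obtain w where w: "w \<in> A" using ne by blast
  have "inj_on f A" using lattice_isometry_inj[OF f] by (rule inj_on_subset) auto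
  then have "(\<Sum>z\<in>f ` A. pot (z - f w) * hm (f ` A) z) = (\<Sum>z\<in>A. pot (z - w) * hm A z)"
    by (simp add: sum.reindex pot_isometry[OF f] hm_isometry[OF f fin])
  then show ?thesis using robin_eq[of "f ` A" "f w"] robin_eq[of A w] fin w by simp
qed

section \<open>Capacities\<close>

text \<open>Evaluating the equilibrium equation of \<open>insert x A\<close> at \<open>x\<close>, and integrating it against
  the harmonic measure of \<open>A\<close>, gives two equations for the mass \<open>q\<close> of \<open>A\<close> and the capacity.\<close>

lemma robin_insert:
  assumes fin: "finite A" and ne: "A \<noteq> {}" and x: "x \<notin> A"
    and E: "\<And>z. z \<in> A \<Longrightarrow> \<bar>pot (x - z) - a\<bar> \<le> E"
  obtains e1 e2 q where "\<bar>e1\<bar> \<le> E" "\<bar>e2\<bar> \<le> E" "a + e2 \<ge> 1"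
    "robin (insert x A) = q * (a + e1)" "robin (insert x A) = q * robin A + (1 - q) * (a + e2)"
proof -
  define K where "K = insert x A"
  have K: "finite K" "K \<noteq> {}" using fin by (auto simp: K_def)
  have E0: "E \<ge> 0" using ne E by (meson abs_ge_zero ex_in_conv order_trans)
  have sumK: "(\<Sum>z\<in>K. g z) = g x + (\<Sum>z\<in>A. g z)" for g :: "pt \<Rightarrow> real"
    using fin x by (simp add: K_def)
  define q where "q = (\<Sum>z\<in>A. hm K z)"
  have q0: "q \<ge> 0" unfolding q_def by (intro sum_nonneg hm_nonneg K)
  have hx: "hm K x = 1 - q" using hm_sum[OF K] unfolding sumK by (simp add: q_def)
  define r where "r = (\<Sum>z\<in>A. (pot (x - z) - a) * hm K z)"
  have r: "\<bar>r\<bar> \<le> E * q"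
    unfolding r_def q_def sum_distrib_left
    by (intro order_trans[OF sum_abs] sum_mono) (simp add: abs_mult hm_nonneg K E mult_right_mono)
  \<comment> \<open>The mean deviation of the kernel over the mass of \<open>A\<close>. If q = 0,
    the division yields 0, which is consistent because then r = 0 as well.\<close>
  define e1 where "e1 = r / q"
  have qe1: "q * e1 = r" using r by (cases "q = 0") (auto simp: e1_def)
  have e1: "\<bar>e1\<bar> \<le> E"
    using r q0 E0 by (cases "q = 0") (auto simp: e1_def abs_div field_simps)
  have "robin K = (\<Sum>z\<in>K. pot (z - x) * hm K z)" using robin_eq[of K x] K by (simp add: K_def)
  also have "\<dots> = (\<Sum>z\<in>A. pot (x - z) * hm K z)" unfolding sumK by (simp add: pot_commute[of x])
  also have "\<dots> = a * q + r" by (simp add: q_def r_def left_diff_distrib sum_subtractf sum_distrib_left)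
  finally have eq1: "robin K = q * (a + e1)" using qe1 by (simp add: algebra_simps)
  define b where "b = (\<Sum>y\<in>A. pot (x - y) * hm A y)"
  define e2 where "e2 = (\<Sum>y\<in>A. (pot (x - y) - a) * hm A y)"
  have b: "b = a + e2" using hm_sum[OF fin ne]
    by (simp add: b_def e2_def left_diff_distrib sum_subtractf flip: sum_distrib_left)
  have "\<bar>e2\<bar> \<le> (\<Sum>y\<in>A. E * hm A y)" unfolding e2_def
    by (intro order_trans[OF sum_abs] sum_mono) (simp add: abs_mult hm_nonneg fin E mult_right_mono)
  then have e2: "\<bar>e2\<bar> \<le> E" using hm_sum[OF fin ne] by (simp flip: sum_distrib_left)
  \<comment> \<open>This lower bound later keeps the denominator in
    \<open>robin_insert_formula\<close> away from 0.\<close>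
  have "(\<Sum>y\<in>A. 1 * hm A y) \<le> b" unfolding b_def
    using x by (intro sum_mono mult_right_mono hm_nonneg fin pot_ge_1) auto
  then have b1: "b \<ge> 1" using hm_sum[OF fin ne] by simp
  have eqy: "robin K = (1 - q) * pot (x - y) + (\<Sum>z\<in>A. pot (z - y) * hm K z)" if "y \<in> A" for y
    using robin_eq[of K y] K that unfolding sumK by (simp add: K_def hx[unfolded K_def] mult.commute)
  have "robin K = (\<Sum>y\<in>A. robin K * hm A y)" using hm_sum[OF fin ne] by (simp flip: sum_distrib_left)
  also have "\<dots> = (\<Sum>y\<in>A. ((1 - q) * pot (x - y) + (\<Sum>z\<in>A. pot (z - y) * hm K z)) * hm A y)"
    by (intro sum.cong refl) (simp only: eqy)
  also have "\<dots> = (\<Sum>y\<in>A. (1 - q) * pot (x - y) * hm A y) + (\<Sum>y\<in>A. (\<Sum>z\<in>A. pot (z - y) * hm K z) * hm A y)"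
    by (simp only: distrib_right sum.distrib)
  also have "(\<Sum>y\<in>A. (1 - q) * pot (x - y) * hm A y) = (1 - q) * b"
    by (simp only: b_def sum_distrib_left mult.assoc)
  also have "(\<Sum>y\<in>A. (\<Sum>z\<in>A. pot (z - y) * hm K z) * hm A y) = (\<Sum>y\<in>A. \<Sum>z\<in>A. hm K z * (pot (z - y) * hm A y))"
    by (intro sum.cong refl) (simp add: sum_distrib_left mult_ac)
  also have "(\<Sum>y\<in>A. \<Sum>z\<in>A. hm K z * (pot (z - y) * hm A y)) = (\<Sum>z\<in>A. \<Sum>y\<in>A. hm K z * (pot (z - y) * hm A y))"
    by (rule sum.swap)
  also have "\<dots> = (\<Sum>z\<in>A. hm K z * robin A)"
  proof (intro sum.cong refl)
    fix z assume z: "z \<in> A"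
    have "(\<Sum>y\<in>A. pot (z - y) * hm A y) = (\<Sum>y\<in>A. pot (y - z) * hm A y)" by (simp add: pot_commute[of z])
    also have "\<dots> = robin A" by (rule robin_eq[OF fin z])
    finally show "(\<Sum>y\<in>A. hm K z * (pot (z - y) * hm A y)) = hm K z * robin A" by (simp flip: sum_distrib_left)
  qed
  also have "\<dots> = q * robin A" by (simp add: q_def sum_distrib_right)
  finally have eq2: "robin K = q * robin A + (1 - q) * (a + e2)" by (simp add: b)
  show ?thesis using that[of e1 e2 q] e1 e2 eq1 eq2 b b1 by (simp add: K_def)
qed

text \<open>Elimination of \<open>q\<close> from the two equations. The errors are averages of
  \<open>pot (x - z) - a\<close> against two probability weights, hence at most \<open>E\<close>.
  The denominator times \<open>q\<close> equals \<open>a + e2\<close>, which is at least 1.\<close>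

lemma robin_insert_formula:
  assumes "finite A" "A \<noteq> {}" "x \<notin> A" "\<And>z. z \<in> A \<Longrightarrow> \<bar>pot (x - z) - a\<bar> \<le> E"
  obtains e1 e2 where "\<bar>e1\<bar> \<le> E" "\<bar>e2\<bar> \<le> E" "2 * a + e1 + e2 - robin A \<noteq> 0"
    "robin (insert x A) = (a + e1) * (a + e2) / (2 * a + e1 + e2 - robin A)"
proof -
  obtain e1 e2 q where e: "\<bar>e1\<bar> \<le> E" "\<bar>e2\<bar> \<le> E" "a + e2 \<ge> 1"
    and r: "robin (insert x A) = q * (a + e1)" "robin (insert x A) = q * robin A + (1 - q) * (a + e2)"
    using robin_insert[OF assms] by blast
  define T where "T = 2 * a + e1 + e2 - robin A"
  have qT: "q * T = a + e2" using r by (simp add: T_def algebra_simps)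
  then have T0: "T \<noteq> 0" using e(3) by auto
  then have "q = (a + e2) / T" using qT by (simp add: field_simps)
  then have "robin (insert x A) = (a + e1) * (a + e2) / T" using r(1) by simp
  then show ?thesis using that[of e1 e2] e T0 by (simp add: T_def)
qed

lemma robin_singleton: "robin {x} = 0"
  using robin_eq[of "{x}" x] by simp

lemma robin_pair: "x \<noteq> 0 \<Longrightarrow> robin {0, x} = pot x / 2"
proof -
  assume x: "x \<noteq> 0"
  obtain e1 e2 where "\<bar>e1\<bar> \<le> 0" "\<bar>e2\<bar> \<le> 0" "robin (insert x {0}) = (pot x + e1) * (pot x + e2) / (2 * pot x + e1 + e2 - robin {0})"
    using robin_insert_formula[of "{0}" x "pot x" 0] x by auto
  then show ?thesis using pot_pos[OF x] by (simp add: robin_singleton insert_commute)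
qed

text \<open>Evaluated at \<open>u\<close>, the equilibrium identity gives \<open>robin A\<close> >=
  1 - \<open>hm A u\<close>, and one of two distinct points has mass at most 1/2. It is used to
  divide by the capacity when a relative error is formed.\<close>

lemma robin_ge_half:
  assumes fin: "finite A" and v: "v \<in> A" and w: "w \<in> A" and ne: "v \<noteq> w"
  shows "robin A \<ge> 1 / 2"
proof -
  have ge: "robin A \<ge> 1 - hm A u" if u: "u \<in> A" for u
  proof -
    have "1 - hm A u = (\<Sum>z\<in>A - {u}. hm A z)" using hm_sum[OF fin] u fin by (auto simp: sum_diff1)
    also have "\<dots> \<le> (\<Sum>z\<in>A - {u}. pot (z - u) * hm A z)"
    proof (rule sum_mono)
      fix z assume "z \<in> A - {u}"
      then have "1 * hm A z \<le> pot (z - u) * hm A z" by (intro mult_right_mono pot_ge_1 hm_nonneg fin) auto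
      then show "hm A z \<le> pot (z - u) * hm A z" by simp
    qed
    also have "\<dots> = (\<Sum>z\<in>A. pot (z - u) * hm A z)" using fin u by (simp add: sum_diff1)
    finally show ?thesis using robin_eq[OF fin u] by simp
  qed
  have "hm A v + hm A w = (\<Sum>z\<in>{v, w}. hm A z)" using ne by simp
  also have "\<dots> \<le> (\<Sum>z\<in>A. hm A z)" using v w fin by (intro sum_mono2) (auto simp: hm_nonneg)
  also have "\<dots> = 1" using v by (intro hm_sum fin) auto
  finally have "hm A v + hm A w \<le> 1" .
  then show ?thesis using ge[OF v] ge[OF w] by linarith
qed

text \<open>Three equilibrium equations and total mass 1 determine the capacity. Nonnegativity of
  the masses yields as by-products a triangle inequality for the kernel and the sign of the
  denominator of \<open>Psi\<close>.\<close>

lemma robin_triple: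
  fixes x y :: pt
  defines "a \<equiv> pot x" and "b \<equiv> pot y" and "d \<equiv> pot (x - y)"
  assumes x: "x \<noteq> 0" and y: "y \<noteq> 0" and xy: "x \<noteq> y"
  shows "robin {0, x, y} = Psi x y" and "\<bar>a - b\<bar> \<le> d"
    and "a * b + a * d + b * d - (a^2 + b^2 + d^2) / 2 > 0"
proof -
  define K where "K = {0, x, y}"
  define c p0 p1 p2 where "c = robin K" and "p0 = hm K 0" and "p1 = hm K x" and "p2 = hm K y"
  have K: "finite K" "K \<noteq> {}" by (auto simp: K_def)
  have sumK: "(\<Sum>z\<in>K. g z) = g 0 + g x + g y" for g :: "pt \<Rightarrow> real" using x y xy by (auto simp: K_def)
  have abd: "a > 0" "b > 0" "d > 0" using x y xy by (auto simp: a_def b_def d_def intro!: pot_pos)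
  have p: "p0 \<ge> 0" "p1 \<ge> 0" "p2 \<ge> 0" "p0 + p1 + p2 = 1"
    using hm_sum[OF K] unfolding sumK by (auto simp: p0_def p1_def p2_def hm_nonneg K)
  have c: "c = a * p1 + b * p2" "c = a * p0 + d * p2" "c = b * p0 + d * p1"
    using robin_eq[of K 0] robin_eq[of K x] robin_eq[of K y] K pot_commute[of y x] unfolding sumK
    by (auto simp: K_def c_def p0_def p1_def p2_def a_def b_def d_def)
  define D where "D = a * b + a * d + b * d - (a^2 + b^2 + d^2) / 2"
  \<comment> \<open>Each of these combinations of the three equations isolates one mass.\<close>
  have e0: "c * (a + b - d) = 2 * (a * b) * p0" using c by algebra
  have e1: "c * (a + d - b) = 2 * (a * d) * p1" using c by algebra
  have e2: "c * (b + d - a) = 2 * (b * d) * p2" using c by algebra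
  have "c * (2 * D) = d * (c * (a + b - d)) + b * (c * (a + d - b)) + a * (c * (b + d - a))"
    by (simp add: D_def power2_eq_square algebra_simps)
  also have "\<dots> = 2 * (a * b * d) * (p0 + p1 + p2)" unfolding e0 e1 e2 by (simp add: algebra_simps)
  finally have cD: "c * D = a * b * d" using p by simp
  have "c \<ge> 0" using c(1) p abd by simp
  moreover have "c \<noteq> 0" using cD abd by auto
  ultimately have c0: "c > 0" by simp
  then show D0: "a * b + a * d + b * d - (a^2 + b^2 + d^2) / 2 > 0"
    using cD abd unfolding D_def[symmetric] by (metis mult_pos_pos zero_less_mult_pos)
  have "c = a * b * d / D" using cD D0 unfolding D_def[symmetric] by (simp add: field_simps)
  then show "robin {0, x, y} = Psi x y" by (simp add: c_def K_def Psi_def D_def a_def b_def d_def)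
  have "c * (a + d - b) \<ge> 0" "c * (b + d - a) \<ge> 0" unfolding e1 e2 using p abd by auto
  then have "a + d - b \<ge> 0" "b + d - a \<ge> 0" using c0 by (auto simp: zero_le_mult_iff)
  then show "\<bar>a - b\<bar> \<le> d" by linarith
qed

section \<open>Capacities of balls\<close>

lemma finite_zball: "finite (zball x r)"
proof -
  have "zball x r \<subseteq> (\<lambda>p. p + x) ` {p. znorm p \<le> r}"
  proof
    fix y assume "y \<in> zball x r"
    then show "y \<in> (\<lambda>p. p + x) ` {p. znorm p \<le> r}" by (intro image_eqI[of _ _ "y - x"]) (auto simp: zball_def)
  qed
  then show ?thesis by (rule finite_subset) (intro finite_imageI finite_znorm_le)
qed

text \<open>Only rim points carry harmonic measure, and there the kernel seen from the centre is
  2/pi ln r up to a constant that depends neither on the radius nor on the centre.\<close>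

lemma robin_zball: "\<exists>C. \<forall>x r. r \<ge> 1 \<longrightarrow> \<bar>robin (zball x r) - 2 / pi * ln r\<bar> \<le> C"
proof -
  obtain C where C: "C \<ge> 0" "\<And>p. p \<noteq> 0 \<Longrightarrow> \<bar>pot p - 2 / pi * ln (znorm p)\<bar> \<le> C" using pot_log_bound by blast
  have "\<bar>robin (zball x r) - 2 / pi * ln r\<bar> \<le> C + 1" if r: "r \<ge> 1" for x r
  proof -
    define A where "A = zball x r"
    have fin: "finite A" and xA: "x \<in> A" using r by (auto simp: A_def finite_zball) (simp add: zball_def)
    have rob: "robin A = (\<Sum>z\<in>A. pot (z - x) * hm A z)" using robin_eq[OF fin xA] by simp
    have pi2: "0 \<le> 2 / pi" "2 / pi \<le> 1" using pi_gt3 by auto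
    have lr: "ln r \<ge> 0" using r by simp
    have lr0: "2 / pi * ln r \<ge> 0" using pi2 lr by (intro mult_nonneg_nonneg)
    have "\<bar>(pot (z - x) - 2 / pi * ln r) * hm A z\<bar> \<le> (C + 1) * hm A z" if z: "z \<in> A" for z
    proof (cases "nbrs z \<subseteq> A")
      case True
      then show ?thesis using hm_interior[OF fin] by simp
    next
      case False
      then obtain y where y: "y \<in> nbrs z" "y \<notin> A" by blast
      have up: "pot (z - x) \<le> 2 / pi * ln r + C"
      proof (cases "z = x")
        case False
        then have zx: "z - x \<noteq> 0" by simp
        have "ln (znorm (z - x)) \<le> ln r" using z znorm_ge_1[OF zx] by (subst ln_le_cancel_iff) (auto simp: A_def zball_def)
        then have "2 / pi * ln (znorm (z - x)) \<le> 2 / pi * ln r" using pi2 by (intro mult_left_mono)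
        then show ?thesis using C(2)[OF zx] by linarith
      qed (use C lr0 in simp)
      \<comment> \<open>For r >= 2 a rim point is at distance at least r - 1 >= r / 2 from the
        centre; for smaller r the left side is at most 0 because 2/pi ln r <= 1.\<close>
      have lo: "2 / pi * ln r - C - 1 \<le> pot (z - x)"
      proof (cases "r \<ge> 2")
        case True
        have "znorm (y - x) \<le> znorm (y - z) + znorm (z - x)" using znorm_triangle(1)[of "y - z" "z - x"] by simp
        moreover have "znorm (y - z) = 1" using y(1) by (simp add: nbrs_iff)
        ultimately have zn: "znorm (z - x) \<ge> r / 2" using y(2) True by (simp add: A_def zball_def)
        then have zx: "z - x \<noteq> 0" using r by auto
        have "ln (znorm (z - x)) \<ge> ln (r / 2)" using zn r by (subst ln_le_cancel_iff) auto
        then have "ln r - ln (znorm (z - x)) \<le> 1" using r ln2_le_25_over_36 by (simp add: ln_div)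
        then have "2 / pi * (ln r - ln (znorm (z - x))) \<le> 2 / pi * 1" using pi2 by (intro mult_left_mono)
        then show ?thesis using C(2)[OF zx] pi2 unfolding right_diff_distrib by linarith
      next
        case False
        then have "ln r \<le> ln 2" using r by (subst ln_le_cancel_iff) auto
        then have "2 / pi * ln r \<le> 1 * 1" using pi2 lr ln2_le_25_over_36 by (intro mult_mono) auto
        then show ?thesis using C pot_nonneg[of "z - x"] by linarith
      qed
      have "\<bar>pot (z - x) - 2 / pi * ln r\<bar> \<le> C + 1" using up lo by linarith
      then show ?thesis using hm_nonneg[OF fin, of z] by (simp add: abs_mult mult_right_mono)
    qed
    then have "\<bar>\<Sum>z\<in>A. (pot (z - x) - 2 / pi * ln r) * hm A z\<bar> \<le> (\<Sum>z\<in>A. (C + 1) * hm A z)"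
      by (intro order_trans[OF sum_abs] sum_mono)
    moreover have "(\<Sum>z\<in>A. hm A z) = 1" using hm_sum[OF fin] xA by auto
    ultimately show ?thesis
      unfolding A_def[symmetric] rob left_diff_distrib sum_subtractf sum_distrib_left[symmetric] by simp
  qed
  then show ?thesis by blast
qed

lemma gamma'_limit:
  obtains C where "C > 0" "\<And>p. p \<noteq> 0 \<Longrightarrow> \<bar>pot p - 2 / pi * ln (znorm p) - gamma'\<bar> \<le> C / znorm p ^ 2"
proof -
  obtain \<gamma> C where C: "\<And>p. p \<noteq> 0 \<Longrightarrow> \<bar>pot p - 2 / pi * ln (znorm p) - \<gamma>\<bar> \<le> C / znorm p ^ 2"
    using pot_asymptotic_exists by blast
  have "((\<lambda>r. C / r ^ 2) \<longlongrightarrow> 0) at_top" by real_asymp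
  then have t: "((\<lambda>p. C / znorm p ^ 2) \<longlongrightarrow> 0) cofinite" by (rule filterlim_compose[OF _ znorm_at_top])
  have "\<forall>\<^sub>F p in cofinite. norm (pot p - 2 / pi * ln (znorm p) - \<gamma>) \<le> C / znorm p ^ 2"
    unfolding eventually_cofinite by (rule finite_subset[of _ "{0}"]) (use C in \<open>force+\<close>)
  then have "((\<lambda>p. pot p - 2 / pi * ln (znorm p) - \<gamma>) \<longlongrightarrow> 0) cofinite" by (rule Lim_null_comparison[OF _ t])
  then have "((\<lambda>p. pot p - 2 / pi * ln (znorm p)) \<longlongrightarrow> \<gamma>) cofinite" by (simp add: LIM_zero_iff)
  then have g: "gamma' = \<gamma>" unfolding gamma'_def by (intro tendsto_Lim cofinite_pt_neq_bot)
  have "\<bar>pot p - 2 / pi * ln (znorm p) - gamma'\<bar> \<le> (\<bar>C\<bar> + 1) / znorm p ^ 2" if "p \<noteq> 0" for p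
    using C[OF that] unfolding g by (rule order_trans) (intro divide_right_mono, auto)
  then show ?thesis by (intro that[of "\<bar>C\<bar> + 1"]) auto
qed

section \<open>The vacant set\<close>

text \<open>The law prescribes probabilities only for sets containing the origin. Since the
  singleton {0} has Robin constant 0, the origin is almost surely vacant, and inserting it changes
  the event by a null set.\<close>

lemma pv_eq:
  assumes V: "vacant_law M \<alpha> V" and fin: "finite A"
  shows "pv M V A = exp (- pi * \<alpha> * robin (insert 0 A))"
proof -
  interpret prob_space M using V by (simp add: vacant_law_def)
  define ev where "ev A = {\<omega>\<in>space M. A \<subseteq> V \<omega>}" for A
  have meas: "ev A \<in> sets M" if "finite A" for A using V that unfolding vacant_law_def ev_def by blast
  have law: "measure M (ev A) = exp (- pi * \<alpha> * robin A)" if "finite A" "0 \<in> A" for A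
    using V that cap0_eq_robin[of A] unfolding vacant_law_def ev_def by (simp add: cap_def)
  have "measure M (ev {0}) = 1" by (simp add: law robin_singleton)
  then have "AE \<omega> in M. \<omega> \<in> ev {0}" using AE_prob_1 by blast
  then have "measure M (ev A) = measure M (ev (insert 0 A))"
    using fin by (intro finite_measure_eq_AE meas) (auto simp: ev_def)
  then show ?thesis using law[of "insert 0 A"] fin by (simp add: pv_def ev_def)
qed

lemma pv_singleton:
  assumes V: "vacant_law M \<alpha> V"
  shows "pv M V {x} = exp (- pi * \<alpha> * pot x / 2)"
proof (cases "x = 0")
  case True
  then show ?thesis using pv_eq[OF V, of "{x}"] by (simp add: robin_singleton)
next
  case False
  then show ?thesis using pv_eq[OF V, of "{x}"] by (simp add: robin_pair)
qed

lemma pv_pair: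
  assumes V: "vacant_law M \<alpha> V" and "x \<noteq> 0" "y \<noteq> 0" "x \<noteq> y"
  shows "pv M V {x, y} = exp (- pi * \<alpha> * Psi x y)"
  using pv_eq[OF V, of "{x, y}"] robin_triple(1)[OF assms(2-4)] by simp

text \<open>The pair {0, x} is mapped to itself, so the sets whose capacities enter the two
  numerators are isometric and the denominators coincide.\<close>

lemma cpv_isometry:
  assumes V: "vacant_law M \<alpha> V" and fin: "finite A" and f: "lattice_isometry f" "f 0 = x" "f x = 0"
  shows "cpv M V A x = cpv M V (f ` A) x"
proof -
  have "f ` (insert 0 (A \<union> {x})) = insert 0 (f ` A \<union> {x})" using f(2,3) by auto
  then have "robin (insert 0 (f ` A \<union> {x})) = robin (insert 0 (A \<union> {x}))"
    using robin_isometry[OF f(1), of "insert 0 (A \<union> {x})"] fin by simp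
  then show ?thesis using pv_eq[OF V, of "A \<union> {x}"] pv_eq[OF V, of "f ` A \<union> {x}"] fin
    by (simp add: cpv_def)
qed

lemma lattice_isometry_reflection: "lattice_isometry (\<lambda>a. x - a)"
  unfolding lattice_isometry_def
proof (intro allI)
  fix u v
  have "x - u - (x - v) = v - u" by simp
  then show "znorm (x - u - (x - v)) = znorm (u - v)" by (simp only: znorm_minus_commute)
qed

lemma abs_exp_minus_1_le:
  fixes u :: real
  assumes "\<bar>u\<bar> \<le> 1"
  shows "\<bar>exp u - 1\<bar> \<le> 2 * \<bar>u\<bar>"
proof (cases "u \<ge> 0")
  case True
  have "exp u \<le> 1 + u + u\<^sup>2" using assms True by (intro exp_bound) auto
  moreover have "u^2 \<le> u" using assms True by (simp add: power2_eq_square mult_left_le)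
  ultimately show ?thesis using exp_ge_add_one_self[of u] True by simp
next
  case False
  then have "exp u \<le> 1" by simp
  then show ?thesis using exp_ge_add_one_self[of u] False by linarith
qed

lemma pv_singleton_asymptotic:
  assumes \<alpha>: "\<alpha> > 0" and V: "vacant_law M \<alpha> V"
  shows "(\<lambda>x. pv M V {x} / (exp (- gamma' * pi * \<alpha> / 2) * znorm x powr (- \<alpha>)) - 1)
         \<in> O[cofinite](\<lambda>x. znorm x powr (-2))"
proof -
  obtain C where C: "C > 0" "\<And>p. p \<noteq> 0 \<Longrightarrow> \<bar>pot p - 2 / pi * ln (znorm p) - gamma'\<bar> \<le> C / znorm p ^ 2"
    using gamma'_limit by blast
  define K where "K = pi * \<alpha> / 2 * C"
  have K: "K > 0" using \<alpha> C by (simp add: K_def)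
  have ev: "\<forall>\<^sub>F x in cofinite. max 1 K \<le> znorm x" using znorm_at_top unfolding filterlim_at_top by blast
  show ?thesis
  proof (rule bigoI[where c = "2 * K"], use ev in eventually_elim)
    case (elim x)
    define r where "r = znorm x"
    have r: "r \<ge> 1" "r \<ge> K" using elim by (auto simp: r_def)
    have x0: "x \<noteq> 0" using elim by auto
    \<comment> \<open>The logarithm of the ratio to be estimated; pi/2 times 2/pi turns the
      logarithm in the kernel into the power -\<alpha>.\<close>
    define u where "u = - (pi * \<alpha> / 2) * (pot x - 2 / pi * ln r - gamma')"
    have "\<bar>u\<bar> = pi * \<alpha> / 2 * \<bar>pot x - 2 / pi * ln r - gamma'\<bar>" using \<alpha> by (simp add: u_def abs_mult)
    also have "\<dots> \<le> pi * \<alpha> / 2 * (C / r ^ 2)" using C(2)[OF x0] \<alpha> unfolding r_def by (intro mult_left_mono) auto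
    finally have u: "\<bar>u\<bar> \<le> K / r ^ 2" by (simp add: K_def)
    have "K * 1 \<le> r * r" using r K by (intro mult_mono) auto
    then have "K / r ^ 2 \<le> 1" using r by (simp add: divide_le_eq power2_eq_square)
    then have u1: "\<bar>u\<bar> \<le> 1" using u by linarith
    have "r powr (- \<alpha>) = exp (- \<alpha> * ln r)" using r by (simp add: powr_def)
    then have "exp (- gamma' * pi * \<alpha> / 2) * r powr (- \<alpha>) = exp (- gamma' * pi * \<alpha> / 2 + (- \<alpha> * ln r))"
      by (simp only: exp_add)
    then have "pv M V {x} / (exp (- gamma' * pi * \<alpha> / 2) * r powr (- \<alpha>)) = exp (- pi * \<alpha> * pot x / 2 - (- gamma' * pi * \<alpha> / 2 + (- \<alpha> * ln r)))"
      unfolding pv_singleton[OF V] by (simp only: exp_diff)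
    also have "- pi * \<alpha> * pot x / 2 - (- gamma' * pi * \<alpha> / 2 + (- \<alpha> * ln r)) = u"
      by (simp add: u_def field_simps)
    finally have "norm (pv M V {x} / (exp (- gamma' * pi * \<alpha> / 2) * r powr (- \<alpha>)) - 1) = \<bar>exp u - 1\<bar>" by simp
    also have "\<dots> \<le> 2 * \<bar>u\<bar>" by (rule abs_exp_minus_1_le[OF u1])
    also have "\<dots> \<le> 2 * (K / r ^ 2)" using u by simp
    also have "\<dots> = 2 * K * norm (r powr (-2))" using r by (simp add: powr_minus powr_numeral divide_inverse)
    finally show ?case by (simp add: r_def)
  qed
qed

text \<open>The inserted point is \<open>x\<close> and the reference value is \<open>pot x\<close>,
  with deviations of order r / |x|. The stated errors are larger by logarithms that are bounded
  below, since ln r >= 1/2 and ln |x| >= 1.\<close>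

lemma cpv_far:
  assumes V: "vacant_law M \<alpha> V"
  shows "\<exists>C1 C2. \<forall>r A x. r \<ge> 2 \<longrightarrow> 0 \<in> A \<longrightarrow> A \<subseteq> zball 0 r \<longrightarrow> znorm x \<ge> 2 * r \<longrightarrow>
          (\<exists>e1 e2. \<bar>e1\<bar> \<le> C1 * (r * ln r * ln (znorm x) / znorm x)
                 \<and> \<bar>e2\<bar> \<le> C2 * (r * ln r / znorm x)
                 \<and> cpv M V A x = exp (- (pi * \<alpha> / 4) * cap A * (1 + e1)
                                      / (1 - cap A / (2 * pot x) + e2)))"
    (is "\<exists>C1 C2. \<forall>r A x. _ r \<longrightarrow> _ A \<longrightarrow> _ r A \<longrightarrow> _ r x \<longrightarrow> ?P C1 C2 r A x")
proof -
  obtain C where C: "C > 0" "\<And>x z. x \<noteq> 0 \<Longrightarrow> znorm z \<le> znorm x / 2 \<Longrightarrow> \<bar>pot (x - z) - pot x\<bar> \<le> C * znorm z / znorm x"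
    using pot_diff_bound by blast
  \<comment> \<open>The factor 2 offsets ln r >= 1/2. In \<open>C1\<close> the factor 4 + 2 C is the
    bound (2 + C) d of the numerator error divided by a capacity of at least 1/2.\<close>
  define C2 where "C2 = 2 * C"
  define C1 where "C1 = (4 + 2 * C) * C2"
  have "?P C1 C2 r A x"
    if r: "r \<ge> 2" and A: "0 \<in> A" "A \<subseteq> zball 0 r" and x: "znorm x \<ge> 2 * r" for r A x
  proof -
    have finA: "finite A" using A(2) finite_zball by (rule finite_subset)
    have x0: "x \<noteq> 0" using r x by auto
    have zx: "znorm x > 0" using r x by linarith
    have xA: "x \<notin> A" using A(2) r x by (auto simp: zball_def)
    define a where "a = pot x"
    have a1: "a \<ge> 1" unfolding a_def by (rule pot_ge_1[OF x0])
    define d where "d = C * (r / znorm x)"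
    have d0: "d \<ge> 0" using C r zx by (simp add: d_def)
    have "r / znorm x \<le> 1 / 2" using zx x by (simp add: field_simps)
    then have "d \<le> C * (1 / 2)" unfolding d_def using C by (intro mult_left_mono) auto
    then have d1: "d \<le> C / 2" by simp
    have bd: "\<bar>pot (x - z) - a\<bar> \<le> d" if "z \<in> A" for z
    proof -
      have z: "znorm z \<le> r" using that A(2) by (auto simp: zball_def)
      then have "\<bar>pot (x - z) - a\<bar> \<le> C * znorm z / znorm x" unfolding a_def using x x0 by (intro C) auto
      also have "\<dots> \<le> C * r / znorm x" using z C zx by (intro divide_right_mono mult_left_mono) auto
      finally show ?thesis by (simp add: d_def)
    qed
    have cpv: "cpv M V A x = exp (- pi * \<alpha> * (robin (insert x A) - a / 2))"
    proof -
      have "cpv M V A x = exp (- pi * \<alpha> * robin (insert x A)) / exp (- pi * \<alpha> * a / 2)"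
      proof -
        have "insert 0 (insert x A) = insert x A" using A(1) by auto
        then show ?thesis using finA by (simp add: cpv_def pv_eq[OF V] robin_pair[OF x0] a_def)
      qed
      also have "\<dots> = exp (- pi * \<alpha> * robin (insert x A) - (- pi * \<alpha> * a / 2))" by (simp only: exp_diff)
      finally show ?thesis by (simp add: algebra_simps)
    qed
    have capA: "cap A = robin A" using A(1) cap0_eq_robin[OF finA] by (simp add: cap_def)
    have "1 / 2 \<le> ln (2::real)" using ln2_ge_two_thirds by linarith
    also have "ln 2 \<le> ln r" using r by (subst ln_le_cancel_iff) auto
    finally have lr: "ln r \<ge> 1 / 2" .
    have "1 = ln (exp (1::real))" by simp
    also have "\<dots> \<le> ln (znorm x)" using r x exp_le by (subst ln_le_cancel_iff) auto
    finally have lx: "ln (znorm x) \<ge> 1" .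
    have g2: "d \<le> C2 * (r * ln r / znorm x)"
    proof -
      have "1 * (r / znorm x) \<le> (2 * ln r) * (r / znorm x)" using lr r zx by (intro mult_right_mono) auto
      then have "C * (1 * (r / znorm x)) \<le> C * ((2 * ln r) * (r / znorm x))" using C by (intro mult_left_mono) auto
      then show ?thesis by (simp add: d_def C2_def mult_ac)
    qed
    have g1: "(4 + 2 * C) * d \<le> C1 * (r * ln r * ln (znorm x) / znorm x)"
    proof -
      have p0: "C2 * (r * ln r / znorm x) \<ge> 0" using d0 g2 by linarith
      have "d \<le> C2 * (r * ln r / znorm x) * ln (znorm x)"
        using g2 mult_left_mono[OF lx p0] by linarith
      then have "(4 + 2 * C) * d \<le> (4 + 2 * C) * (C2 * (r * ln r / znorm x) * ln (znorm x))"
        using C by (intro mult_left_mono) auto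
      then show ?thesis by (simp add: C1_def mult_ac)
    qed
    show ?thesis
    \<comment> \<open>Here the capacity vanishes and no relative error can be formed, but both sides
      of the formula are 1.\<close>
    proof (cases "A = {0}")
      case True
      have "robin (insert x A) = a / 2" unfolding True a_def robin_pair[OF x0, symmetric] by (simp only: insert_commute)
      then have "cpv M V A x = 1" unfolding cpv by simp
      moreover have "cap A = 0" using capA robin_singleton[of 0] True by simp
      moreover have "C1 * (r * ln r * ln (znorm x) / znorm x) \<ge> 0" "C2 * (r * ln r / znorm x) \<ge> 0"
        using g1 g2 d0 C mult_nonneg_nonneg[of "4 + 2 * C" d] by linarith+
      ultimately show ?thesis by (intro exI[of _ 0]) simp
    next
      case False
      then obtain w where w: "w \<in> A" "w \<noteq> 0" using A(1) by blast
      define cA where "cA = robin A"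
      have cA: "cA \<ge> 1 / 2" unfolding cA_def using robin_ge_half[OF finA w(1) A(1) w(2)] .
      obtain e1 e2 where e: "\<bar>e1\<bar> \<le> d" "\<bar>e2\<bar> \<le> d" "2 * a + e1 + e2 - robin A \<noteq> 0"
          "robin (insert x A) = (a + e1) * (a + e2) / (2 * a + e1 + e2 - robin A)"
        using robin_insert_formula[OF finA _ xA bd] A(1) by blast
      define T where "T = 2 * a + e1 + e2 - cA"
      have T0: "T \<noteq> 0" using e(3) by (simp add: T_def cA_def)
      \<comment> \<open>Read off after subtracting a / 2: over the denominator 2 T the numerator is
        a cA + a (e1 + e2) + 2 e1 e2, and a cA is factored out of it.\<close>
      define f1 f2 where "f1 = (e1 + e2 + 2 * e1 * e2 / a) / cA" and "f2 = (e1 + e2) / (2 * a)"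
      have den: "1 - cA / (2 * a) + f2 = T / (2 * a)" using a1 by (simp add: T_def f2_def field_simps)
      have num: "cA * (1 + f1) = (a * cA + a * (e1 + e2) + 2 * e1 * e2) / a" using a1 cA by (simp add: f1_def field_simps)
      have "robin (insert x A) - a / 2 = (2 * ((a + e1) * (a + e2)) - a * T) / (2 * T)"
        unfolding e(4) cA_def[symmetric] T_def[symmetric] using T0 by (simp add: field_simps)
      also have "2 * ((a + e1) * (a + e2)) - a * T = a * cA + a * (e1 + e2) + 2 * e1 * e2" by (simp add: T_def algebra_simps)
      also have "\<dots> / (2 * T) = (1 / 4) * (cA * (1 + f1)) / (T / (2 * a))"
        unfolding num using a1 T0 by (simp add: field_simps)
      finally have "- pi * \<alpha> * (robin (insert x A) - a / 2) = - (pi * \<alpha> / 4) * cA * (1 + f1) / (1 - cA / (2 * a) + f2)"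
        unfolding den by simp
      then have eq: "cpv M V A x = exp (- (pi * \<alpha> / 4) * cap A * (1 + f1) / (1 - cap A / (2 * pot x) + f2))"
        unfolding cpv capA cA_def a_def by (simp only:)
      have "\<bar>2 * e1 * e2 / a\<bar> \<le> C * d"
      proof -
        have "\<bar>e1\<bar> * \<bar>e2\<bar> \<le> (C / 2) * d" using e d1 d0 by (intro mult_mono) auto
        moreover have "\<bar>2 * e1 * e2 / a\<bar> \<le> 2 * (\<bar>e1\<bar> * \<bar>e2\<bar>) / 1"
          unfolding abs_divide abs_mult using a1 by (intro frac_le) auto
        ultimately show ?thesis by simp
      qed
      then have n: "\<bar>e1 + e2 + 2 * e1 * e2 / a\<bar> \<le> 2 * d + C * d" using e by linarith
      have "\<bar>f1\<bar> = \<bar>e1 + e2 + 2 * e1 * e2 / a\<bar> / cA" using cA by (simp add: f1_def)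
      also have "\<dots> \<le> (2 * d + C * d) / (1 / 2)" using n cA by (intro frac_le) auto
      also have "\<dots> = (4 + 2 * C) * d" by (simp add: algebra_simps)
      finally have b1: "\<bar>f1\<bar> \<le> C1 * (r * ln r * ln (znorm x) / znorm x)" using g1 by linarith
      have "\<bar>f2\<bar> = \<bar>e1 + e2\<bar> / (2 * a)" using a1 by (simp add: f2_def)
      also have "\<dots> \<le> (2 * d) / 2" using e a1 by (intro frac_le) auto
      finally have b2: "\<bar>f2\<bar> \<le> C2 * (r * ln r / znorm x)" using g2 by linarith
      show ?thesis using b1 b2 eq by blast
    qed
  qed
  then show ?thesis by blast
qed

section \<open>Logarithmic ratios along sequences\<close>

lemma bounded_over_at_top:
  fixes f :: "nat \<Rightarrow> real"
  assumes l: "filterlim l at_top sequentially" and f: "\<forall>\<^sub>F n in sequentially. \<bar>f n\<bar> \<le> C"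
  shows "(\<lambda>n. f n / l n) \<longlonglongrightarrow> 0"
proof -
  have "((\<lambda>x. C / x) \<longlongrightarrow> 0) at_top" by real_asymp
  then have t: "(\<lambda>n. C / l n) \<longlonglongrightarrow> 0" by (rule filterlim_compose[OF _ l])
  have "\<forall>\<^sub>F n in sequentially. l n > 0" using l by (simp add: filterlim_at_top_dense)
  with f have "\<forall>\<^sub>F n in sequentially. norm (f n / l n) \<le> C / l n"
    by eventually_elim (simp add: divide_right_mono)
  then show ?thesis by (rule Lim_null_comparison[OF _ t])
qed

lemma at_top_if_ratio_limit:
  assumes l: "filterlim l at_top sequentially" and f: "(\<lambda>n. f n / l n) \<longlonglongrightarrow> c" and c: "c > (0::real)"
  shows "filterlim f at_top sequentially"
proof (rule filterlim_mono_eventually[OF filterlim_tendsto_pos_mult_at_top[OF f c l] order_refl order_refl])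
  have "\<forall>\<^sub>F n in sequentially. l n > 0" using l by (simp add: filterlim_at_top_dense)
  then show "\<forall>\<^sub>F n in sequentially. f n / l n * l n = f n" by eventually_elim simp
qed

text \<open>The bound \<open>pot_log_bound\<close> is uniform over all nonzero points, so
  \<open>P n\<close> may remain bounded, as differences of two points can when \<beta> is 0.\<close>

lemma pot_ratio_limit:
  assumes P: "\<forall>\<^sub>F n in sequentially. P n \<noteq> 0" and l: "filterlim l at_top sequentially"
    and lim: "(\<lambda>n. ln (znorm (P n)) / l n) \<longlonglongrightarrow> \<beta>"
  shows "(\<lambda>n. pot (P n) / l n) \<longlonglongrightarrow> 2 / pi * \<beta>"
proof -
  obtain C where C: "\<And>p. p \<noteq> 0 \<Longrightarrow> \<bar>pot p - 2 / pi * ln (znorm p)\<bar> \<le> C" using pot_log_bound by blast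
  have 1: "(\<lambda>n. (pot (P n) - 2 / pi * ln (znorm (P n))) / l n) \<longlonglongrightarrow> 0"
    by (rule bounded_over_at_top[OF l, of _ C]) (use P in eventually_elim, use C in blast)
  have "(\<lambda>n. (pot (P n) - 2 / pi * ln (znorm (P n))) / l n + 2 / pi * (ln (znorm (P n)) / l n)) \<longlonglongrightarrow> 0 + 2 / pi * \<beta>"
    by (intro tendsto_intros 1 lim)
  then show ?thesis by (simp add: diff_divide_distrib)
qed

text \<open>For \<beta> = 0 the rescaled numerator and denominator of \<open>Psi\<close> both tend
  to 0. Dividing both by D leaves A + B - D/2 - (A - B)^2 / (2 D), where the last term is at most |A
  - B| / 2 by the triangle inequality for the kernel and hence vanishes in the limit.\<close>

lemma Psi_ratio_limit:
  assumes nz: "\<And>n. X n \<noteq> 0 \<and> Y n \<noteq> 0 \<and> X n \<noteq> Y n"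
    and l: "filterlim l at_top sequentially" and \<beta>: "0 \<le> \<beta>" "\<beta> \<le> 1"
    and a: "(\<lambda>n. pot (X n) / l n) \<longlonglongrightarrow> 2 / pi" and b: "(\<lambda>n. pot (Y n) / l n) \<longlonglongrightarrow> 2 / pi"
    and d: "(\<lambda>n. pot (X n - Y n) / l n) \<longlonglongrightarrow> 2 / pi * \<beta>"
  shows "(\<lambda>n. Psi (X n) (Y n) / l n) \<longlonglongrightarrow> 4 / (pi * (4 - \<beta>))"
proof -
  define A B D where "A n = pot (X n) / l n" and "B n = pot (Y n) / l n" and "D n = pot (X n - Y n) / l n" for n
  have l0: "\<forall>\<^sub>F n in sequentially. l n > 0" using l by (simp add: filterlim_at_top_dense)
  define R where "R n = (A n - B n)^2 / D n" for n
  have "(\<lambda>n. A n - B n) \<longlonglongrightarrow> 2 / pi - 2 / pi" unfolding A_def B_def by (intro tendsto_diff a b)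
  then have AB0: "(\<lambda>n. \<bar>A n - B n\<bar>) \<longlonglongrightarrow> 0" by (simp add: tendsto_rabs_zero)
  have "\<forall>\<^sub>F n in sequentially. norm (R n) \<le> \<bar>A n - B n\<bar>"
    using l0
  proof eventually_elim
    case (elim n)
    have "\<bar>pot (X n) - pot (Y n)\<bar> \<le> pot (X n - Y n)" using robin_triple(2) nz by blast
    then have "\<bar>pot (X n) - pot (Y n)\<bar> / l n \<le> pot (X n - Y n) / l n" using elim by (intro divide_right_mono) auto
    then have t: "\<bar>A n - B n\<bar> \<le> D n" using elim by (simp add: A_def B_def D_def flip: diff_divide_distrib)
    have Dp: "D n > 0" using pot_pos[of "X n - Y n"] nz[of n] elim by (simp add: D_def)
    have "\<bar>A n - B n\<bar> * \<bar>A n - B n\<bar> \<le> \<bar>A n - B n\<bar> * D n" using t by (intro mult_left_mono) auto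
    then show ?case using Dp by (simp add: R_def abs_mult power2_eq_square divide_le_eq)
  qed
  then have R0: "R \<longlonglongrightarrow> 0" by (rule Lim_null_comparison[OF _ AB0])
  have den: "2 / pi + 2 / pi - (2 / pi * \<beta>) / 2 - 0 / 2 = (4 - \<beta>) / pi" by (simp add: field_simps)
  have "(\<lambda>n. A n * B n / (A n + B n - D n / 2 - R n / 2)) \<longlonglongrightarrow> 2 / pi * (2 / pi) / (2 / pi + 2 / pi - (2 / pi * \<beta>) / 2 - 0 / 2)"
    by (intro R0 a[folded A_def] b[folded B_def] d[folded D_def] tendsto_const tendsto_mult tendsto_divide tendsto_add tendsto_diff)
      (use den \<beta> in simp_all)
  also have "2 / pi * (2 / pi) / (2 / pi + 2 / pi - (2 / pi * \<beta>) / 2 - 0 / 2) = 4 / (pi * (4 - \<beta>))" unfolding den by simp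
  finally have lim: "(\<lambda>n. A n * B n / (A n + B n - D n / 2 - R n / 2)) \<longlonglongrightarrow> 4 / (pi * (4 - \<beta>))" .
  have e: "\<forall>\<^sub>F n in sequentially. A n * B n / (A n + B n - D n / 2 - R n / 2) = Psi (X n) (Y n) / l n"
    using l0
  proof eventually_elim
    case (elim n)
    define p q d' where "p = pot (X n)" and "q = pot (Y n)" and "d' = pot (X n - Y n)"
    have d0: "d' > 0" unfolding d'_def using nz[of n] by (intro pot_pos) auto
    have G0: "p * q + p * d' + q * d' - (p^2 + q^2 + d'^2) / 2 > 0"
      unfolding p_def q_def d'_def using robin_triple(3) nz by blast
    define G where "G = p + q - d' / 2 - (p - q)^2 / (2 * d')"
    have GG: "d' * G = p * q + p * d' + q * d' - (p^2 + q^2 + d'^2) / 2"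
      using d0 by (simp add: G_def field_simps power2_eq_square)
    then have "G > 0" using G0 d0 by (metis zero_less_mult_pos)
    have "Psi (X n) (Y n) = p * q * d' / (d' * G)" unfolding GG by (simp add: Psi_def p_def q_def d'_def)
    also have "\<dots> = p * q / G" using d0 by simp
    finally have P: "Psi (X n) (Y n) = p * q / G" .
    have R': "R n = (p - q)^2 / d' / l n"
      using elim d0 by (simp add: R_def A_def B_def D_def p_def[symmetric] q_def[symmetric] d'_def[symmetric] field_simps power2_eq_square)
    have "A n + B n - D n / 2 - R n / 2 = G / l n"
      unfolding R' G_def by (simp add: A_def B_def D_def p_def q_def d'_def add_divide_distrib diff_divide_distrib)
    then show ?case unfolding P using elim \<open>G > 0\<close> by (simp add: A_def B_def p_def q_def field_simps)
  qed
  with lim show ?thesis by (rule Lim_transform_eventually)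
qed

lemma pair_asymptotics:
  assumes \<alpha>: "\<alpha> > 0" and V: "vacant_law M \<alpha> V" and \<beta>: "0 \<le> \<beta>" "\<beta> \<le> 1"
    and nz: "\<forall>n. X n \<noteq> 0 \<and> Y n \<noteq> 0 \<and> X n \<noteq> Y n"
    and X: "filterlim (\<lambda>n. znorm (X n)) at_top sequentially"
    and Y: "(\<lambda>n. ln (znorm (Y n)) / ln (znorm (X n))) \<longlonglongrightarrow> 1"
    and XY: "(\<lambda>n. ln (znorm (X n - Y n)) / ln (znorm (X n))) \<longlonglongrightarrow> \<beta>"
  shows "(\<lambda>n. ln (pv M V {X n, Y n}) / ln (znorm (X n))) \<longlonglongrightarrow> - 4 * \<alpha> / (4 - \<beta>)"
    and "\<forall>\<^sub>F n in sequentially. vcor M V (X n) (Y n) > 0"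
    and "(\<lambda>n. ln (vcor M V (X n) (Y n)) / ln (znorm (X n))) \<longlonglongrightarrow> - \<alpha> * \<beta> / (4 - \<beta>)"
proof -
  define l where "l n = ln (znorm (X n))" for n
  have l: "filterlim l at_top sequentially" unfolding l_def by (rule filterlim_compose[OF ln_at_top X])
  have l0: "\<forall>\<^sub>F n in sequentially. l n > 0" using l by (simp add: filterlim_at_top_dense)
  have inv_l: "(\<lambda>n. 1 / l n) \<longlonglongrightarrow> 0"
    using tendsto_inverse_0_at_top[OF l] by (simp add: inverse_eq_divide)
  have "\<forall>\<^sub>F n in sequentially. ln (znorm (X n)) / l n = 1" using l0 by eventually_elim (simp add: l_def)
  then have "(\<lambda>n. ln (znorm (X n)) / l n) \<longlonglongrightarrow> 1" by (rule tendsto_eventually)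
  then have a: "(\<lambda>n. pot (X n) / l n) \<longlonglongrightarrow> 2 / pi" using pot_ratio_limit[of X l 1] nz l by simp
  have b: "(\<lambda>n. pot (Y n) / l n) \<longlonglongrightarrow> 2 / pi" using pot_ratio_limit[of Y l 1] nz l Y by (simp add: l_def)
  have d: "(\<lambda>n. pot (X n - Y n) / l n) \<longlonglongrightarrow> 2 / pi * \<beta>" using nz l XY unfolding l_def by (intro pot_ratio_limit) auto
  have Psi: "(\<lambda>n. Psi (X n) (Y n) / l n) \<longlonglongrightarrow> 4 / (pi * (4 - \<beta>))"
    using nz by (intro Psi_ratio_limit[OF _ l \<beta> a b d]) auto
  have \<beta>4: "4 - \<beta> > 0" using \<beta> by simp
  have "(\<lambda>n. - pi * \<alpha> * (Psi (X n) (Y n) / l n)) \<longlonglongrightarrow> - pi * \<alpha> * (4 / (pi * (4 - \<beta>)))"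
    by (intro tendsto_intros Psi)
  then show "(\<lambda>n. ln (pv M V {X n, Y n}) / ln (znorm (X n))) \<longlonglongrightarrow> - 4 * \<alpha> / (4 - \<beta>)"
    using nz \<beta>4 by (simp add: pv_pair[OF V] l_def mult.commute)
  define px py where "px n = pv M V {X n}" and "py n = pv M V {Y n}" for n
  \<comment> \<open>The logarithm of the joint probability over the product of the marginals. It
    tends to infinity because its rate \<open>d\<close> is positive for \<beta> <= 1, so the joint
    probability dominates the covariance.\<close>
  define D where "D n = pi * \<alpha> * ((pot (X n) + pot (Y n)) / 2 - Psi (X n) (Y n))" for n
  define d where "d = \<alpha> * (4 - 2 * \<beta>) / (4 - \<beta>)"
  have d0: "d > 0" using \<alpha> \<beta> by (simp add: d_def)
  have "(\<lambda>n. pi * \<alpha> * ((pot (X n) / l n + pot (Y n) / l n) / 2 - Psi (X n) (Y n) / l n))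
      \<longlonglongrightarrow> pi * \<alpha> * ((2 / pi + 2 / pi) / 2 - 4 / (pi * (4 - \<beta>)))"
    by (intro tendsto_intros a b Psi) auto
  moreover have "pi * \<alpha> * ((2 / pi + 2 / pi) / 2 - 4 / (pi * (4 - \<beta>))) = d"
    using \<beta>4 by (simp add: d_def field_simps)
  moreover have "pi * \<alpha> * ((pot (X n) / l n + pot (Y n) / l n) / 2 - Psi (X n) (Y n) / l n) = D n / l n" for n
  proof -
    have "(p / t + q / t) / 2 - r / t = ((p + q) / 2 - r) / t" for p q r t :: real
      by (simp add: add_divide_distrib diff_divide_distrib)
    then show ?thesis by (simp add: D_def)
  qed
  ultimately have Dl: "(\<lambda>n. D n / l n) \<longlonglongrightarrow> d" by simp
  have D: "filterlim D at_top sequentially" by (rule at_top_if_ratio_limit[OF l Dl d0])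
  have p_0: "(\<lambda>n. exp (- pi * \<alpha> * pot (P n) / 2)) \<longlonglongrightarrow> 0" if "(\<lambda>n. pot (P n) / l n) \<longlonglongrightarrow> 2 / pi" for P
  proof -
    have "((\<lambda>x. exp (- (pi * \<alpha> / 2 * x))) \<longlongrightarrow> 0) at_top"
      by (intro filterlim_compose[OF exp_at_bot] filterlim_compose[OF filterlim_uminus_at_bot_at_top]
          filterlim_tendsto_pos_mult_at_top[OF tendsto_const] filterlim_ident) (use \<alpha> in auto)
    from filterlim_compose[OF this at_top_if_ratio_limit[OF l that]] show ?thesis by simp
  qed
  have px: "px \<longlonglongrightarrow> 0" unfolding px_def pv_singleton[OF V] by (rule p_0[OF a])
  have py: "py \<longlonglongrightarrow> 0" unfolding py_def pv_singleton[OF V] by (rule p_0[OF b])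
  \<comment> \<open>The exact logarithm of the correlation: half the logarithms of the two
    marginals, plus \<open>D n\<close>, plus three terms that tend to 0. Its rate is -\<alpha> +
    d.\<close>
  define L where "L n = - pi * \<alpha> * (pot (X n) + pot (Y n)) / 4 + D n + ln (1 - exp (- D n)) - ln (1 - px n) / 2 - ln (1 - py n) / 2" for n
  have ev: "\<forall>\<^sub>F n in sequentially. vcor M V (X n) (Y n) = exp (L n)"
    using filterlim_at_top_dense[THEN iffD1, OF D, rule_format, of 0]
  proof eventually_elim
    case (elim n)
    have pX: "pot (X n) > 0" and pY: "pot (Y n) > 0" using nz by (auto intro!: pot_pos)
    have px': "px n = exp (- pi * \<alpha> * pot (X n) / 2)" "py n = exp (- pi * \<alpha> * pot (Y n) / 2)"
      by (simp_all add: px_def py_def pv_singleton[OF V])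
    have p1: "0 < px n" "px n < 1" "0 < py n" "py n < 1" using pX pY \<alpha> by (simp_all add: px')
    have ne: "X n \<noteq> 0" "Y n \<noteq> 0" "X n \<noteq> Y n" using nz by auto
    have "pv M V {X n, Y n} = exp (- pi * \<alpha> * pot (X n) / 2 + - pi * \<alpha> * pot (Y n) / 2 + D n)"
      unfolding pv_pair[OF V ne] by (simp add: D_def field_simps)
    then have num: "pv M V {X n, Y n} - px n * py n = px n * py n * (exp (D n) - 1)"
      unfolding exp_add px'[symmetric] by (simp add: algebra_simps)
    have ed: "exp (D n) - 1 = exp (D n) * (1 - exp (- D n))" by (simp add: algebra_simps exp_minus)
    have e1: "1 - exp (- D n) > 0" using elim by simp
    define u v where "u = 1 - px n" and "v = 1 - py n"
    have uv: "u > 0" "v > 0" using p1 by (auto simp: u_def v_def)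
    have "vcor M V (X n) (Y n) = px n * py n * (exp (D n) * (1 - exp (- D n))) / sqrt (px n * u * (py n * v))"
      unfolding vcor_def px_def[symmetric] py_def[symmetric] num ed u_def v_def ..
    also have "\<dots> = exp (ln (px n) + ln (py n) + D n + ln (1 - exp (- D n)) - (ln (px n) + ln u + (ln (py n) + ln v)) / 2)"
    proof -
      have "sqrt (px n * u * (py n * v)) = exp ((ln (px n) + ln u + (ln (py n) + ln v)) / 2)"
      proof -
        have "exp ((ln (px n) + ln u + (ln (py n) + ln v)) / 2) ^ 2 = exp (ln (px n) + ln u + (ln (py n) + ln v))"
          by (simp add: power2_eq_square flip: exp_add)
        also have "\<dots> = px n * u * (py n * v)" using p1 uv by (simp add: exp_add)
        finally show ?thesis by (intro real_sqrt_unique) auto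
      qed
      then show ?thesis using p1 e1 by (simp only: exp_diff exp_add exp_ln)
    qed
    also have "ln (px n) + ln (py n) + D n + ln (1 - exp (- D n)) - (ln (px n) + ln u + (ln (py n) + ln v)) / 2 = L n"
      by (simp add: L_def u_def v_def px' field_simps)
    finally show ?case .
  qed
  show "\<forall>\<^sub>F n in sequentially. vcor M V (X n) (Y n) > 0" using ev by eventually_elim simp
  have "((\<lambda>x. 1 - exp (- x :: real)) \<longlongrightarrow> 1) at_top" by real_asymp
  then have "(\<lambda>n. 1 - exp (- D n)) \<longlonglongrightarrow> 1" by (rule filterlim_compose[OF _ D])
  then have l1: "(\<lambda>n. ln (1 - exp (- D n))) \<longlonglongrightarrow> ln 1" by (rule tendsto_ln) simp
  have l2: "(\<lambda>n. ln (1 - px n)) \<longlonglongrightarrow> ln (1 - 0)" by (intro tendsto_ln tendsto_diff tendsto_const px) simp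
  have l3: "(\<lambda>n. ln (1 - py n)) \<longlonglongrightarrow> ln (1 - 0)" by (intro tendsto_ln tendsto_diff tendsto_const py) simp
  have "(\<lambda>n. - pi * \<alpha> / 4 * (pot (X n) / l n + pot (Y n) / l n) + D n / l n
      + (ln (1 - exp (- D n)) - ln (1 - px n) / 2 - ln (1 - py n) / 2) * (1 / l n))
    \<longlonglongrightarrow> - pi * \<alpha> / 4 * (2 / pi + 2 / pi) + d + (ln 1 - ln (1 - 0) / 2 - ln (1 - 0) / 2) * 0"
    by (intro tendsto_intros a b Dl l1 l2 l3 inv_l) auto
  moreover have "- pi * \<alpha> / 4 * (2 / pi + 2 / pi) + d + (ln 1 - ln (1 - 0) / 2 - ln (1 - 0) / 2) * (0::real) = - \<alpha> * \<beta> / (4 - \<beta>)"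
    using \<beta>4 by (simp add: d_def field_simps)
  moreover have "- pi * \<alpha> / 4 * (pot (X n) / l n + pot (Y n) / l n) + D n / l n
      + (ln (1 - exp (- D n)) - ln (1 - px n) / 2 - ln (1 - py n) / 2) * (1 / l n) = L n / l n" for n
    by (simp add: L_def add_divide_distrib diff_divide_distrib distrib_left)
  ultimately have "(\<lambda>n. L n / l n) \<longlonglongrightarrow> - \<alpha> * \<beta> / (4 - \<beta>)" by simp
  moreover have "\<forall>\<^sub>F n in sequentially. L n / l n = ln (vcor M V (X n) (Y n)) / ln (znorm (X n))"
    using ev by eventually_elim (simp add: l_def)
  ultimately show "(\<lambda>n. ln (vcor M V (X n) (Y n)) / ln (znorm (X n))) \<longlonglongrightarrow> - \<alpha> * \<beta> / (4 - \<beta>)"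
    by (rule Lim_transform_eventually)
qed

text \<open>Now the origin is the point inserted into the ball, with reference value
  \<open>pot (X n)\<close>. Deviations that are merely bounded suffice, since everything is divided
  by ln S.\<close>

lemma ball_asymptotics:
  fixes S R :: "nat \<Rightarrow> real"
  assumes V: "vacant_law M \<alpha> V" and \<beta>: "\<beta> < 1"
    and S: "filterlim S at_top sequentially" and R: "\<forall>n. R n \<ge> 1"
    and X: "(\<lambda>n. ln (znorm (X n)) / ln (S n)) \<longlonglongrightarrow> 1"
    and RS: "(\<lambda>n. ln (R n) / ln (S n)) \<longlonglongrightarrow> \<beta>"
  shows "(\<lambda>n. ln (pv M V (zball (X n) (R n))) / ln (S n)) \<longlonglongrightarrow> - 2 * \<alpha> / (2 - \<beta>)"
proof -
  define l where "l n = ln (S n)" for n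
  have l: "filterlim l at_top sequentially" unfolding l_def by (rule filterlim_compose[OF ln_at_top S])
  have l0: "\<forall>\<^sub>F n in sequentially. l n > 0" using l by (simp add: filterlim_at_top_dense)
  obtain C' where C': "C' > 0" "\<And>x z. x \<noteq> 0 \<Longrightarrow> znorm z \<le> znorm x / 2 \<Longrightarrow> \<bar>pot (x - z) - pot x\<bar> \<le> C' * znorm z / znorm x"
    using pot_diff_bound by blast
  obtain C'' where C'': "\<And>x r. r \<ge> 1 \<Longrightarrow> \<bar>robin (zball x r) - 2 / pi * ln r\<bar> \<le> C''" using robin_zball by blast
  \<comment> \<open>Since \<beta> < 1, the radius is eventually at most half the distance to the
    origin; the origin is then outside the ball and \<open>pot_diff_bound\<close> applies around the
    centre.\<close>
  have "(\<lambda>n. ln (znorm (X n)) / l n - ln (R n) / l n) \<longlonglongrightarrow> 1 - \<beta>" unfolding l_def by (intro tendsto_diff X RS)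
  then have "filterlim (\<lambda>n. (ln (znorm (X n)) / l n - ln (R n) / l n) * l n) at_top sequentially"
    using \<beta> by (intro filterlim_tendsto_pos_mult_at_top[OF _ _ l]) auto
  then have "\<forall>\<^sub>F n in sequentially. ln 2 < (ln (znorm (X n)) / l n - ln (R n) / l n) * l n"
    by (simp add: filterlim_at_top_dense)
  then have ev: "\<forall>\<^sub>F n in sequentially. X n \<noteq> 0 \<and> R n \<le> znorm (X n) / 2"
    using l0
  proof eventually_elim
    case (elim n)
    have R1: "R n \<ge> 1" using R by blast
    have "ln 2 + ln (R n) < ln (znorm (X n))" using elim by (simp add: left_diff_distrib)
    then have lt: "ln (2 * R n) < ln (znorm (X n))" using R1 by (simp add: ln_mult)
    have "ln (2 * R n) > 0" using R1 by simp
    then have "X n \<noteq> 0" using lt by auto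
    then have "znorm (X n) > 0" using znorm_ge_1[of "X n"] by linarith
    then have "2 * R n < znorm (X n)" using lt R1 by simp
    then show ?case using \<open>X n \<noteq> 0\<close> by simp
  qed
  define good where "good n e1 e2 \<longleftrightarrow> \<bar>e1\<bar> \<le> C' \<and> \<bar>e2\<bar> \<le> C' \<and>
      robin (insert 0 (zball (X n) (R n))) = (pot (X n) + e1) * (pot (X n) + e2) / (2 * pot (X n) + e1 + e2 - robin (zball (X n) (R n)))" for n e1 e2
  have "\<exists>e1 e2. good n e1 e2" if n: "X n \<noteq> 0 \<and> R n \<le> znorm (X n) / 2" for n
  proof -
    have R1: "R n \<ge> 1" using R by blast
    have zX: "znorm (X n) > 0" using n znorm_ge_1[of "X n"] by linarith
    define A where "A = zball (X n) (R n)"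
    have "X n \<in> A" using R1 by (simp add: A_def zball_def)
    then have ne: "A \<noteq> {}" by blast
    have x0: "0 \<notin> A" using n R1 by (auto simp: A_def zball_def)
    \<comment> \<open>The kernel is even, so its value here is that at z = X n - (X n - z), a
      displacement by at most the radius.\<close>
    have bd: "\<bar>pot (0 - z) - pot (X n)\<bar> \<le> C'" if "z \<in> A" for z
    proof -
      have z: "znorm (X n - z) \<le> R n" using that by (simp add: A_def zball_def znorm_minus_commute)
      have "\<bar>pot (X n - (X n - z)) - pot (X n)\<bar> \<le> C' * znorm (X n - z) / znorm (X n)"
        using n z by (intro C') auto
      also have "\<dots> \<le> C' * znorm (X n) / znorm (X n)"
        using n z zX R1 C' by (intro divide_right_mono mult_left_mono) auto
      finally show ?thesis using zX n by simp
    qed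
    obtain e1 e2 where "\<bar>e1\<bar> \<le> C'" "\<bar>e2\<bar> \<le> C'"
       "robin (insert 0 A) = (pot (X n) + e1) * (pot (X n) + e2) / (2 * pot (X n) + e1 + e2 - robin A)"
      using robin_insert_formula[OF _ ne x0 bd] finite_zball A_def by metis
    then show ?thesis unfolding good_def A_def by blast
  qed
  then have "\<exists>e1 e2. X n \<noteq> 0 \<and> R n \<le> znorm (X n) / 2 \<longrightarrow> good n e1 e2" for n by blast
  then obtain e1 e2 where e: "\<And>n. X n \<noteq> 0 \<and> R n \<le> znorm (X n) / 2 \<Longrightarrow> good n (e1 n) (e2 n)" by metis
  have evg: "\<forall>\<^sub>F n in sequentially. good n (e1 n) (e2 n)" using ev by eventually_elim (rule e)
  have e1: "(\<lambda>n. e1 n / l n) \<longlonglongrightarrow> 0"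
    by (rule bounded_over_at_top[OF l, of _ C']) (use evg in eventually_elim, simp add: good_def)
  have e2: "(\<lambda>n. e2 n / l n) \<longlonglongrightarrow> 0"
    by (rule bounded_over_at_top[OF l, of _ C']) (use evg in eventually_elim, simp add: good_def)
  have "\<forall>\<^sub>F n in sequentially. X n \<noteq> 0" using ev by eventually_elim simp
  then have a: "(\<lambda>n. pot (X n) / l n) \<longlonglongrightarrow> 2 / pi"
    using pot_ratio_limit[OF _ l, of X 1] X by (simp add: l_def)
  have "(\<lambda>n. (robin (zball (X n) (R n)) - 2 / pi * ln (R n)) / l n) \<longlonglongrightarrow> 0"
    using R by (intro bounded_over_at_top[OF l, of _ C''] always_eventually allI C'') auto
  then have "(\<lambda>n. (robin (zball (X n) (R n)) - 2 / pi * ln (R n)) / l n + 2 / pi * (ln (R n) / l n)) \<longlonglongrightarrow> 0 + 2 / pi * \<beta>"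
    unfolding l_def by (intro tendsto_intros RS)
  then have c: "(\<lambda>n. robin (zball (X n) (R n)) / l n) \<longlonglongrightarrow> 2 / pi * \<beta>" by (simp add: diff_divide_distrib)
  define Q where "Q n = (pot (X n) / l n + e1 n / l n) * (pot (X n) / l n + e2 n / l n)
      / (2 * (pot (X n) / l n) + e1 n / l n + e2 n / l n - robin (zball (X n) (R n)) / l n)" for n
  have den: "2 * (2 / pi) + 0 + 0 - 2 / pi * \<beta> = 2 * (2 - \<beta>) / pi" by (simp add: field_simps)
  have "(\<lambda>n. - pi * \<alpha> * Q n) \<longlonglongrightarrow> - pi * \<alpha> * ((2 / pi + 0) * (2 / pi + 0) / (2 * (2 / pi) + 0 + 0 - 2 / pi * \<beta>))"
    unfolding Q_def
  proof (intro a c e1 e2 tendsto_const tendsto_mult tendsto_divide tendsto_add tendsto_diff)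
    show "2 * (2 / pi) + 0 + 0 - 2 / pi * \<beta> \<noteq> 0" unfolding den using \<beta> by simp
  qed
  also have "- pi * \<alpha> * ((2 / pi + 0) * (2 / pi + 0) / (2 * (2 / pi) + 0 + 0 - 2 / pi * \<beta>)) = - 2 * \<alpha> / (2 - \<beta>)"
    unfolding den using \<beta> by (simp add: field_simps)
  finally have lim: "(\<lambda>n. - pi * \<alpha> * Q n) \<longlonglongrightarrow> - 2 * \<alpha> / (2 - \<beta>)" .
  have "\<forall>\<^sub>F n in sequentially. - pi * \<alpha> * Q n = ln (pv M V (zball (X n) (R n))) / ln (S n)"
    using evg l0
  proof eventually_elim
    case (elim n)
    have sc: "(p / t + u / t) * (p / t + v / t) / (2 * (p / t) + u / t + v / t - w / t) = ((p + u) * (p + v) / (2 * p + u + v - w)) / t"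
      if "t > 0" for p u v w t :: real
    proof -
      have "(p / t + u / t) * (p / t + v / t) = ((p + u) * (p + v)) / (t * t)"
        by (simp flip: add_divide_distrib)
      moreover have "2 * (p / t) + u / t + v / t - w / t = (2 * p + u + v - w) / t"
        by (simp add: add_divide_distrib diff_divide_distrib)
      ultimately show ?thesis using that by simp
    qed
    have "Q n = robin (insert 0 (zball (X n) (R n))) / l n"
      unfolding Q_def sc[OF elim(2)] using elim(1) by (simp add: good_def)
    then show ?case by (simp add: pv_eq[OF V finite_zball] l_def)
  qed
  with lim show ?thesis by (rule Lim_transform_eventually)
qed

theorem theorem2p3:
  fixes M :: "'w measure" and V :: "'w \<Rightarrow> pt set" and \<alpha> :: real
  assumes "\<alpha> > 0" and "vacant_law M \<alpha> V"
  shows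
   \<comment> \<open>(i)\<close>
   "(\<forall>x A. finite A \<longrightarrow> cpv M V A x = cpv M V ((\<lambda>a. x - a) ` A) x)
    \<and> (\<forall>x A f. x \<noteq> 0 \<longrightarrow> finite A \<longrightarrow> lattice_isometry f \<longrightarrow> f 0 = x \<longrightarrow> f x = 0 \<longrightarrow>
          cpv M V A x = cpv M V (f ` A) x)
   \<comment> \<open>(ii)\<close>
    \<and> (\<forall>x. pv M V {x} = exp (- pi * \<alpha> * pot x / 2))
    \<and> (\<lambda>x. pv M V {x} / (exp (- gamma' * pi * \<alpha> / 2) * znorm x powr (- \<alpha>)) - 1)
         \<in> O[cofinite](\<lambda>x. znorm x powr (-2))
   \<comment> \<open>(iii)\<close>
    \<and> (\<exists>C1 C2. \<forall>r A x. r \<ge> 2 \<longrightarrow> 0 \<in> A \<longrightarrow> A \<subseteq> zball 0 r \<longrightarrow> znorm x \<ge> 2 * r \<longrightarrow>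
          (\<exists>e1 e2. \<bar>e1\<bar> \<le> C1 * (r * ln r * ln (znorm x) / znorm x)
                 \<and> \<bar>e2\<bar> \<le> C2 * (r * ln r / znorm x)
                 \<and> cpv M V A x = exp (- (pi * \<alpha> / 4) * cap A * (1 + e1)
                                      / (1 - cap A / (2 * pot x) + e2))))
   \<comment> \<open>(iv)\<close>
    \<and> (\<forall>x y. x \<noteq> 0 \<longrightarrow> y \<noteq> 0 \<longrightarrow> x \<noteq> y \<longrightarrow> pv M V {x, y} = exp (- pi * \<alpha> * Psi x y))
    \<and> (\<forall>\<beta> X Y. 0 \<le> \<beta> \<longrightarrow> \<beta> \<le> 1 \<longrightarrow>
          (\<forall>n. X n \<noteq> 0 \<and> Y n \<noteq> 0 \<and> X n \<noteq> Y n) \<longrightarrow>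
          filterlim (\<lambda>n. znorm (X n)) at_top sequentially \<longrightarrow>
          (\<lambda>n. ln (znorm (Y n)) / ln (znorm (X n))) \<longlonglongrightarrow> 1 \<longrightarrow>
          (\<lambda>n. ln (znorm (X n - Y n)) / ln (znorm (X n))) \<longlonglongrightarrow> \<beta> \<longrightarrow>
          ((\<lambda>n. ln (pv M V {X n, Y n}) / ln (znorm (X n))) \<longlonglongrightarrow> - 4 * \<alpha> / (4 - \<beta>))
          \<and> (\<forall>\<^sub>F n in sequentially. vcor M V (X n) (Y n) > 0)
          \<and> ((\<lambda>n. ln (vcor M V (X n) (Y n)) / ln (znorm (X n))) \<longlonglongrightarrow> - \<alpha> * \<beta> / (4 - \<beta>)))
   \<comment> \<open>(v)\<close>
    \<and> (\<forall>\<beta> (S :: nat \<Rightarrow> real) X (R :: nat \<Rightarrow> real). \<beta> < 1 \<longrightarrow>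
          filterlim S at_top sequentially \<longrightarrow> (\<forall>n. R n \<ge> 1) \<longrightarrow>
          (\<lambda>n. ln (znorm (X n)) / ln (S n)) \<longlonglongrightarrow> 1 \<longrightarrow>
          (\<lambda>n. ln (R n) / ln (S n)) \<longlonglongrightarrow> \<beta> \<longrightarrow>
          (\<lambda>n. ln (pv M V (zball (X n) (R n))) / ln (S n)) \<longlonglongrightarrow> - 2 * \<alpha> / (2 - \<beta>))"
proof (intro conjI, goal_cases)
  case 1
  show ?case by (intro allI impI cpv_isometry[OF assms(2) _ lattice_isometry_reflection]) auto
next
  case 2
  show ?case using cpv_isometry[OF assms(2)] by blast
next
  case 3
  show ?case using pv_singleton[OF assms(2)] by blast
next
  case 4
  show ?case by (rule pv_singleton_asymptotic[OF assms])
next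
  case 5
  show ?case by (rule cpv_far[OF assms(2)])
next
  case 6
  show ?case using pv_pair[OF assms(2)] by blast
next
  case 7
  show ?case using pair_asymptotics[OF assms] by (intro allI impI conjI)
next
  case 8
  show ?case by (intro allI impI) (rule ball_asymptotics[OF assms(2)]; assumption)
qed

end
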